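(* Let $p\in[1,\infty]$, let $\mathbf{Y}=(\mathbf{Y}^1,\dots,\mathbf{Y}^n)$ be a sample of i.i.d. Gaussian vectors in $\mathbb{R}^K$ with mean $\mu$, and let $\phi:\mathbb{R}^K\to\mathbb{R}$ be any subadditive function bounded by the $\ell_p$-norm. (i) For all $\alpha\in(0,1)$, with probability at least $1-\alpha$, $$\phi(\overline{\mathbf{Y}}-\mu)<\mathbb{E}[\phi(\overline{\mathbf{Y}}-\mu)]+\frac{\|\sigma\|_p\,\overline{\Phi}^{-1}(\alpha/2)}{\sqrt n},$$ and the same bound holds for the corresponding lower deviations, i.e., with probability at least $1-\alpha$, $\phi(\overline{\mathbf{Y}}-\mu)>\mathbb{E}[\phi(\overline{\mathbf{Y}}-\mu)]-\|\sigma\|_p\,\overline{\Phi}^{-1}(\alpha/2)/\sqrt n$. (ii) Let $W$ be an exchangeable resampling weight vector. Then, for all $\alpha\in(0,1)$, with probability at least $1-\alpha$, $$\mathbb{E}_W[\phi(\overline{\mathbf{Y}}^{\langle W-\overline{W}\rangle})]<\mathbb{E}[\phi(\overline{\mathbf{Y}}^{\langle W-\overline{W}\rangle})]+\frac{\|\sigma\|_pC_W\,\overline{\Phi}^{-1}(\alpha/2)}{n},$$ and the same bound holds for the corresponding lower deviations, i.e., with probability at least $1-\alpha$, $\mathbb{E}_W[\phi(\overline{\mathbf{Y}}^{\langle W-\overline{W}\rangle})]>\mathbb{E}[\phi(\overline{\mathbf{Y}}^{\langle W-\overline{W}\rangle})]-\|\sigma\|_pC_W\,\overline{\Phi}^{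-1}(\alpha/2)/n$.
   Context: $K\ge1$ and $n\ge2$ are integers; the covariance matrix of the $\mathbf{Y}^i$ is arbitrary. $\overline{\mathbf{Y}}=\frac1n\sum_{i=1}^n\mathbf{Y}^i$, and for $w\in\mathbb{R}^n$, $\overline{\mathbf{Y}}^{\langle w\rangle}=\frac1n\sum_{i=1}^nw_i\mathbf{Y}^i$. $\sigma=(\sigma_k)_{1\le k\le K}$ with $\sigma_k=\mathrm{Var}^{1/2}(\mathbf{Y}^1_k)$; $\overline{\Phi}(x)=\mathbb{P}(X\ge x)$ for $X\sim\mathcal N(0,1)$; $\|\cdot\|_p$ is the $\ell_p$-norm (max-norm for $p=\infty$). Subadditive means $\phi(x+x')\le\phi(x)+\phi(x')$; bounded by the $\ell_p$-norm means $|\phi(x)|\le\|x\|_p$ for all $x$. A resampling weight vector is an $\mathbb{R}^n$-valued random vector $W=(W_i)_{1\le i\le n}$, independent of $\mathbf{Y}$, with $\mathbb{E}[W_i^2]<\infty$ for all $i$ and $n^{-1}\sum_{i=1}^n\mathbb{E}|W_i-\overline{W}|>0$, where $\overline{W}=\frac1n\sum_{i=1}^nW_i$; it is exchangeable if its distribution is invariant under permutations of the indices. $W-\overline{W}$ denotes $(W_i-\overline{W})_{1\le i\le n}$. $\mathbb{E}_W$ denotes expectation over $W$ only, i.e. conditionally on $\mathbf{Y}$, and $C_W=\big(\frac{n}{n-1}\mathbb{E}[(W_1-\overline{W})^2]\big)^{1/2}$.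
   Formalization: The strict bounds in (i) and (ii) are claimed only when σ ≠ 0; for σ = 0, where Y^i = μ almost surely and both sides equal 0 so that the strict inequalities fail, almost sure equality with the expectation is stated instead. *)

theory Defs
  imports "HOL-Probability.Probability"
begin

definition lp_norm :: "ennreal \<Rightarrow> real ^ 'k \<Rightarrow> real" where
  "lp_norm p x =
    (if p = \<infinity> then infnorm x
     else (\<Sum>k\<in>UNIV. \<bar>x $ k\<bar> powr enn2real p) powr (1 / enn2real p))"

definition normal_tail :: "real \<Rightarrow> real" where
  "normal_tail x = measure std_normal_distribution {x..}"

text \<open>\<open>normal_tail\<close> is a strictly decreasing bijection from the reals onto \<open>{0<..<1}\<close>, so on that
  interval \<open>inv normal_tail\<close> is its genuine inverse.\<close>

definition normal_quantile :: "real \<Rightarrow> real" where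
  "normal_quantile = inv normal_tail"

text \<open>The normal law of mean \<open>m\<close> and standard deviation \<open>s \<ge> 0\<close>; for \<open>s = 0\<close> it is the point mass
  at \<open>m\<close>.  Allowing \<open>s = 0\<close> makes every covariance matrix, including singular ones, admissible in
  the definition of Gaussian vectors.\<close>

definition normal_law :: "real \<Rightarrow> real \<Rightarrow> real measure" where
  "normal_law m s = (if s = 0 then return borel m else density lborel (normal_density m s))"

definition gaussian_vector :: "'a measure \<Rightarrow> ('a \<Rightarrow> real ^ 'k) \<Rightarrow> bool" where
  "gaussian_vector M X \<longleftrightarrow>
    X \<in> borel_measurable M \<and>
    (\<forall>a. \<exists>m s. s \<ge> 0 \<and> distr M borel (\<lambda>\<omega>. a \<bullet> X \<omega>) = normal_law m s)"

definition std_dev :: "'a measure \<Rightarrow> ('a \<Rightarrow> real ^ 'k) \<Rightarrow> real ^ 'k" where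
  "std_dev M X = (\<chi> k. sqrt (\<integral>\<omega>. (X \<omega> $ k - (\<integral>\<omega>'. X \<omega>' $ k \<partial>M))\<^sup>2 \<partial>M))"

text \<open>Families \<open>(X\<^sub>1, \<dots>, X\<^sub>n)\<close> are functions on \<open>nat\<close> of which only the values at \<open>1, \<dots>, n\<close> matter.
  As random elements they are regarded as maps into the product space over \<open>{1..n}\<close>.\<close>

definition joint :: "nat \<Rightarrow> (nat \<Rightarrow> 'a \<Rightarrow> 'b) \<Rightarrow> 'a \<Rightarrow> (nat \<Rightarrow> 'b)" where
  "joint n X \<omega> = (\<lambda>i\<in>{1..n}. X i \<omega>)"

definition generated_algebra ::
    "'a measure \<Rightarrow> nat \<Rightarrow> (nat \<Rightarrow> 'a \<Rightarrow> 'b::topological_space) \<Rightarrow> 'a measure" where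
  "generated_algebra M n X =
    vimage_algebra (space M) (joint n X) (\<Pi>\<^sub>M i\<in>{1..n}. borel)"

definition iid_gaussian_sample ::
    "'a measure \<Rightarrow> nat \<Rightarrow> real ^ 'k \<Rightarrow> (nat \<Rightarrow> 'a \<Rightarrow> real ^ 'k) \<Rightarrow> bool" where
  "iid_gaussian_sample M n \<mu> Y \<longleftrightarrow>
    prob_space.indep_vars M (\<lambda>_. borel) Y {1..n} \<and>
    (\<forall>i\<in>{1..n}. \<forall>j\<in>{1..n}. distr M borel (Y i) = distr M borel (Y j)) \<and>
    (\<forall>i\<in>{1..n}. gaussian_vector M (Y i) \<and> (\<integral>\<omega>. Y i \<omega> \<partial>M) = \<mu>)"

definition average :: "nat \<Rightarrow> (nat \<Rightarrow> 'b) \<Rightarrow> 'b::real_vector" where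
  "average n x = (1 / real n) *\<^sub>R (\<Sum>i=1..n. x i)"

definition weighted_average :: "nat \<Rightarrow> (nat \<Rightarrow> real) \<Rightarrow> (nat \<Rightarrow> 'b) \<Rightarrow> 'b::real_vector" where
  "weighted_average n w x = average n (\<lambda>i. w i *\<^sub>R x i)"

definition centered :: "nat \<Rightarrow> (nat \<Rightarrow> 'a \<Rightarrow> real) \<Rightarrow> nat \<Rightarrow> 'a \<Rightarrow> real" where
  "centered n W i \<omega> = W i \<omega> - average n (\<lambda>j. W j \<omega>)"

text \<open>Independence of \<open>W\<close> and \<open>Y\<close> is stated through the generated sigma-algebras, because
  \<open>indep_var\<close> requires both random elements to take values in the same type.\<close>

definition resampling_weights ::
    "'a measure \<Rightarrow> nat \<Rightarrow> (nat \<Rightarrow> 'a \<Rightarrow> real ^ 'k) \<Rightarrow> (nat \<Rightarrow> 'a \<Rightarrow> real) \<Rightarrow> bool" where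
  "resampling_weights M n Y W \<longleftrightarrow>
    (\<forall>i\<in>{1..n}. W i \<in> borel_measurable M) \<and>
    prob_space.indep_set M (sets (generated_algebra M n W)) (sets (generated_algebra M n Y)) \<and>
    (\<forall>i\<in>{1..n}. integrable M (\<lambda>\<omega>. (W i \<omega>)\<^sup>2)) \<and>
    (1 / real n) * (\<Sum>i=1..n. \<integral>\<omega>. \<bar>centered n W i \<omega>\<bar> \<partial>M) > 0"

definition exchangeable :: "'a measure \<Rightarrow> nat \<Rightarrow> (nat \<Rightarrow> 'a \<Rightarrow> real) \<Rightarrow> bool" where
  "exchangeable M n W \<longleftrightarrow>
    (\<forall>\<pi>. \<pi> permutes {1..n} \<longrightarrow>
      distr M (\<Pi>\<^sub>M i\<in>{1..n}. borel) (joint n (\<lambda>i. W (\<pi> i))) =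
      distr M (\<Pi>\<^sub>M i\<in>{1..n}. borel) (joint n W))"

definition weight_constant :: "'a measure \<Rightarrow> nat \<Rightarrow> (nat \<Rightarrow> 'a \<Rightarrow> real) \<Rightarrow> real" where
  "weight_constant M n W =
    sqrt (real n / (real n - 1) * (\<integral>\<omega>. (centered n W 1 \<omega>)\<^sup>2 \<partial>M))"

text \<open>The expectation over the weights only, that is, conditionally on the sample \<open>Y\<close>.\<close>

definition weight_expectation ::
    "'a measure \<Rightarrow> nat \<Rightarrow> (nat \<Rightarrow> 'a \<Rightarrow> real ^ 'k) \<Rightarrow> ('a \<Rightarrow> real) \<Rightarrow> 'a \<Rightarrow> real" where
  "weight_expectation M n Y = real_cond_exp M (generated_algebra M n Y)"

end

theory Submission
  imports Defs
begin

text \<open>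
  The functional of the average in the first part and the conditional expectation in the second part
  are Lipschitz functions of the independent standard normal variables from which Gaussian vectors with
  the given law can be built.
  Both parts are therefore instances of the concentration inequality of Cirel'son, Ibragimov and
  Sudakov around the mean (\<open>gaussian_concentration\<close>): if \<open>F\<close> is \<open>L\<close>-Lipschitz for the Euclidean norm
  and \<open>z\<close> is a standard Gaussian vector, then \<open>F z\<close> is at least \<open>t\<close> above its mean with probability at
  most \<open>2 * normal_tail (t / L)\<close>. The factor \<open>2\<close> is why the quantile is taken at \<open>\<alpha> / 2\<close>.

  Why the inequality holds. Split \<open>z\<close> into a walk of \<open>N\<close> independent Gaussian steps of size
  \<open>\<delta> = 1 / sqrt N\<close> and let \<open>u\<^sub>j\<close> be the average of \<open>F\<close> over the last \<open>j\<close> steps; along the walk these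
  averages form a martingale that leads from the mean of \<open>F\<close> to the value of \<open>F\<close>. A Gaussian average
  of a Lipschitz function has a first-order expansion with a quadratic error and a gradient of norm at
  most \<open>L\<close> (\<open>smooth_taylor\<close>, by the Cameron--Martin formula \<open>std_gauss_shift\<close>); for the last step to be
  covered as well, \<open>F\<close> itself is replaced by its average at a small scale \<open>\<epsilon>\<close>. Hence every increment of
  the martingale is, up to a centred error of second moment \<open>O(1 / N\<^sup>2)\<close>, conditionally normal with
  standard deviation at most \<open>L * \<delta>\<close>. If there were no error, the reflection principle would finish
  the proof: the function \<open>reach x b y = min 1 (2 * P(y + b Z \<ge> x))\<close> is the probability that a Brownian
  motion started at \<open>y\<close> reaches level \<open>x\<close> within time \<open>b\<^sup>2\<close>, and its mean does not increase when a
  centred normal increment is added to \<open>y\<close> and at least the variance of the increment is taken off the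
  time (\<open>reach_supermartingale\<close>, \<open>reach_mono\<close>). The errors are uncorrelated, so that their sum has
  second moment \<open>O(1 / N)\<close>, and Chebyshev's inequality removes them as \<open>N\<close> tends to infinity
  (\<open>walk_bound\<close>).

  How the sample enters. A Gaussian vector is given by the laws of its one-dimensional projections.
  Its covariance matrix is a Gram matrix \<open>B B\<^sup>T\<close> (\<open>psd_gram\<close>), and since projections determine a law
  (\<open>cramer_wold\<close>), the sample is distributed like \<open>\<mu> + B g\<^sub>1, \<dots>, \<mu> + B g\<^sub>n\<close> with standard Gaussian
  \<open>g\<^sub>i\<close> (\<open>iid_gaussian_sample_law\<close>). The \<open>k\<close>-th row of \<open>B\<close> has norm \<open>\<sigma>\<^sub>k\<close>, so a linear combination of the
  \<open>B g\<^sub>i\<close> is bounded componentwise by \<open>\<sigma>\<close> times the norm of the same combination of the \<open>g\<^sub>i\<close>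
  (\<open>lp_norm_block_combination\<close>). For the average this gives the Lipschitz constant
  \<open>lp_norm p \<sigma> / sqrt n\<close>. For resampling, independence lets the conditional expectation be computed by
  freezing the sample (\<open>weight_expectation_freeze\<close>); by Jensen's inequality its Lipschitz constant is
  controlled by the covariance matrix of the centred exchangeable weights, which is \<open>C\<^sub>W\<^sup>2\<close> times the
  orthogonal projection onto the vectors of sum zero (\<open>exchangeable_quadratic_form\<close>), and is
  \<open>lp_norm p \<sigma> * C\<^sub>W / n\<close>. If \<open>\<sigma> = 0\<close>, both Lipschitz constants vanish and both functions are constant.
\<close>

section \<open>The normal law on the line\<close>

abbreviation stdN :: "real measure" where "stdN \<equiv> std_normal_distribution"

lemma prob_stdN: "prob_space stdN"
  using real_dist_normal_dist by (simp add: real_distribution_def)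

lemma normal_law_affine:
  assumes "s \<ge> 0"
  shows "normal_law m s = distr stdN borel (\<lambda>z. m + s * z)"
proof (cases "s = 0")
  case True
  interpret prob_space stdN by (rule prob_stdN)
  show ?thesis
    using True by (simp add: normal_law_def)
next
  case False
  interpret prob_space stdN by (rule prob_stdN)
  have "distributed stdN lborel (\<lambda>x. x) std_normal_density"
    by (auto simp: distributed_def intro!: measure_eqI simp: emeasure_distr)
  from normal_density_affine[OF this, of s m] False assms
  have "distributed stdN lborel (\<lambda>x. m + s * x) (normal_density m s)" by simp
  then have "distr stdN lborel (\<lambda>x. m + s * x) = density lborel (normal_density m s)"
    by (simp add: distributed_def)
  moreover have "distr stdN lborel (\<lambda>x. m + s * x) = distr stdN borel (\<lambda>x. m + s * x)"
    by (intro distr_cong) auto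
  ultimately show ?thesis using False by (simp add: normal_law_def)
qed

lemma real_distribution_normal_law: "s \<ge> 0 \<Longrightarrow> real_distribution (normal_law m s)"
  using prob_space.real_distribution_distr[OF prob_stdN] by (simp add: normal_law_affine)

lemma char_normal_law:
  assumes "s \<ge> 0"
  shows "char (normal_law m s) t = iexp (t * m) * complex_of_real (exp (- (s * t)\<^sup>2 / 2))"
proof -
  have "char (normal_law m s) t = (CLINT z|stdN. iexp (t * m) * iexp ((s * t) * z))"
    unfolding char_def normal_law_affine[OF assms]
    by (subst integral_distr) (auto simp: algebra_simps exp_add[symmetric] intro!: Bochner_Integration.integral_cong)
  also have "\<dots> = iexp (t * m) * char stdN (s * t)"
    unfolding char_def by (subst integral_mult_right_zero) simp
  finally show ?thesis by (simp add: char_std_normal_distribution)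
qed

lemma stdN_uminus: "distr stdN borel uminus = stdN"
proof (rule Levy_uniqueness)
  show "real_distribution (distr stdN borel uminus)"
    by (intro prob_space.real_distribution_distr prob_stdN) simp
  have "char (distr stdN borel uminus) t = char stdN (- t)" for t
    by (simp add: char_def integral_distr)
  then show "char (distr stdN borel uminus) = char stdN"
    by (auto simp: char_std_normal_distribution)
qed (rule real_dist_normal_dist)

text \<open>
  The sum of independent centred normal variables is normal with the variances added: the two
  characteristic functions agree.
\<close>

lemma stdN_rotate:
  "distr (stdN \<Otimes>\<^sub>M stdN) borel (\<lambda>(x, y). c * x + d * y) = distr stdN borel (\<lambda>x. sqrt (c\<^sup>2 + d\<^sup>2) * x)"
  (is "?L = ?R")
proof (rule Levy_uniqueness)
  interpret N: prob_space stdN by (rule prob_stdN)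
  interpret P: pair_prob_space stdN stdN ..
  show "real_distribution ?L" "real_distribution ?R"
    by (auto intro!: P.real_distribution_distr N.real_distribution_distr)
  show "char ?L = char ?R"
  proof
    fix t
    have R: "char ?R t = complex_of_real (exp (- (sqrt (c\<^sup>2 + d\<^sup>2) * t)\<^sup>2 / 2))"
      using char_normal_law[of "sqrt (c\<^sup>2 + d\<^sup>2)" 0 t] by (simp add: normal_law_affine)
    have "char ?L t = (CLINT p|stdN \<Otimes>\<^sub>M stdN. iexp (t * c * fst p) * iexp (t * d * snd p))"
      unfolding char_def
      by (subst integral_distr) (auto simp: algebra_simps exp_add[symmetric] split_beta intro!: Bochner_Integration.integral_cong)
    also have "\<dots> = (CLINT x|stdN. CLINT y|stdN. iexp (t * c * x) * iexp (t * d * y))"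
      by (subst P.integral_fst'[symmetric])
         (auto intro!: P.integrable_const_bound[where B=1] simp: norm_mult)
    also have "\<dots> = char stdN (t * c) * char stdN (t * d)"
      unfolding char_def by (simp add: mult.assoc)
    also have "\<dots> = char ?R t"
      unfolding R char_std_normal_distribution of_real_mult[symmetric] exp_add[symmetric]
      by (simp add: power_mult_distrib field_simps)
    finally show "char ?L t = char ?R t" .
  qed
qed

text \<open>
  The one-dimensional Cameron--Martin formula: completing the square in the density.
\<close>

lemma stdN_shift: "distr stdN borel (\<lambda>x. x + z) = density stdN (\<lambda>x. exp (z * x - z\<^sup>2 / 2))"
proof -
  have "distr stdN borel (\<lambda>x. x + z) = normal_law z 1"
    by (simp add: normal_law_affine add.commute)
  also have "\<dots> = density lborel (normal_density z 1)" by (simp add: normal_law_def)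
  also have "\<dots> = density stdN (\<lambda>x. exp (z * x - z\<^sup>2 / 2))"
    by (subst density_density_eq)
       (auto intro!: density_cong AE_I2 simp: ennreal_mult'[symmetric] normal_density_def exp_add[symmetric] field_simps power2_eq_square)
  finally show ?thesis .
qed

lemma stdN_exp:
  shows "integrable stdN (\<lambda>x. exp (s * x))" "(\<integral>x. exp (s * x) \<partial>stdN) = exp (s\<^sup>2 / 2)"
proof -
  interpret S: prob_space "distr stdN borel (\<lambda>x. x + s)"
    by (intro prob_space.prob_space_distr prob_stdN) simp
  have "has_bochner_integral (density stdN (\<lambda>x. exp (s * x - s\<^sup>2 / 2))) (\<lambda>x. 1) (1::real)"
    unfolding stdN_shift[symmetric] using S.prob_space by (simp add: has_bochner_integral_iff)
  then have "has_bochner_integral stdN (\<lambda>x. exp (s * x - s\<^sup>2 / 2) *\<^sub>R (1::real)) 1"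
    using integrable_density[of "\<lambda>x. 1::real" stdN "\<lambda>x. exp (s * x - s\<^sup>2 / 2)"]
      integral_density[of "\<lambda>x. 1::real" stdN "\<lambda>x. exp (s * x - s\<^sup>2 / 2)"]
    unfolding has_bochner_integral_iff by auto
  then have "has_bochner_integral stdN (\<lambda>x. exp (s\<^sup>2 / 2) * (exp (s * x - s\<^sup>2 / 2) *\<^sub>R (1::real))) (exp (s\<^sup>2/2) * 1)"
    by (rule has_bochner_integral_mult_right) 
  then have "has_bochner_integral stdN (\<lambda>x. exp (s * x)) (exp (s\<^sup>2/2))"
    by (simp add: exp_add[symmetric])
  then show "integrable stdN (\<lambda>x. exp (s * x))" "(\<integral>x. exp (s * x) \<partial>stdN) = exp (s\<^sup>2 / 2)"
    by (auto simp: has_bochner_integral_iff)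
qed

lemma stdN_moments:
  shows "integrable stdN (\<lambda>x. x)" "(\<integral>x. x \<partial>stdN) = 0"
    "integrable stdN (\<lambda>x. x\<^sup>2)" "(\<integral>x. x\<^sup>2 \<partial>stdN) = 1"
  using integrable_std_normal_distribution_moment[of 1] integral_std_normal_distribution_moment_odd[of 1]
    integrable_std_normal_distribution_moment[of 2] std_normal_distribution_even_moments(1)[of 1]
  by (auto simp: power2_eq_square)

lemma stdN_singleton: "measure stdN {x} = 0"
  by (simp add: measure_def emeasure_density nn_integral_indicator_singleton)

lemma normal_tail_eq_cdf: "normal_tail x = 1 - cdf stdN x"
proof -
  interpret N: real_distribution stdN by (rule real_dist_normal_dist)
  have "measure stdN ({x} \<union> {x<..}) = measure stdN {x} + measure stdN {x<..}"
    by (rule N.finite_measure_Union) auto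
  moreover have "{x} \<union> {x<..} = {x..}" "UNIV - {..x} = {x<..}" by auto
  moreover have "measure stdN (space stdN - {..x}) = 1 - measure stdN {..x}"
    by (rule N.prob_compl) simp
  ultimately show ?thesis
    by (simp add: normal_tail_def cdf_def stdN_singleton)
qed

lemma isCont_normal_tail: "isCont normal_tail x"
proof -
  interpret N: real_distribution stdN by (rule real_dist_normal_dist)
  have "isCont (cdf stdN) x" by (simp add: N.isCont_cdf stdN_singleton)
  then have "isCont (\<lambda>x. 1 - cdf stdN x) x" by (intro continuous_intros)
  then show ?thesis by (simp add: normal_tail_eq_cdf[abs_def])
qed

lemma normal_tail_antimono: "x \<le> y \<Longrightarrow> normal_tail y \<le> normal_tail x"
proof -
  interpret N: real_distribution stdN by (rule real_dist_normal_dist)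
  show "x \<le> y \<Longrightarrow> normal_tail y \<le> normal_tail x"
    unfolding normal_tail_def by (intro N.finite_measure_mono) auto
qed

lemma normal_tail_uminus: "normal_tail x = cdf stdN (- x)"
proof -
  have "normal_tail x = measure (distr stdN borel uminus) {x..}"
    by (simp add: normal_tail_def stdN_uminus)
  also have "\<dots> = measure stdN {..- x}"
    by (subst measure_distr) (auto intro!: arg_cong[where f="measure stdN"])
  finally show ?thesis by (simp add: cdf_def)
qed

lemma normal_tail_0: "normal_tail 0 = 1 / 2"
  using normal_tail_uminus[of 0] normal_tail_eq_cdf[of 0] by simp

text \<open>
  By continuity the tail attains every value strictly between its limits \<open>0\<close> and \<open>1\<close>, and any
  right inverse recovers an attained value.
\<close>

lemma normal_tail_quantile:
  assumes "0 < \<beta>" "\<beta> < 1"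
  shows "normal_tail (normal_quantile \<beta>) = \<beta>"
proof -
  interpret N: real_distribution stdN by (rule real_dist_normal_dist)
  have "eventually (\<lambda>x. cdf stdN x > 1 - \<beta>) at_top"
    using N.cdf_lim_at_top_prob assms by (intro order_tendstoD) auto
  then obtain b where b: "\<And>x. x \<ge> b \<Longrightarrow> cdf stdN x > 1 - \<beta>" by (auto simp: eventually_at_top_linorder)
  have "eventually (\<lambda>x. cdf stdN x < 1 - \<beta>) at_bot"
    using N.cdf_lim_at_bot assms by (intro order_tendstoD) auto
  then obtain a where a: "\<And>x. x \<le> a \<Longrightarrow> cdf stdN x < 1 - \<beta>" by (auto simp: eventually_at_bot_linorder)
  have "\<exists>x\<ge>min a b. x \<le> max a b \<and> normal_tail x = \<beta>"
  proof (rule IVT2)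
    show "normal_tail (max a b) \<le> \<beta>" using b[of "max a b"] by (simp add: normal_tail_eq_cdf)
    show "\<beta> \<le> normal_tail (min a b)" using a[of "min a b"] by (simp add: normal_tail_eq_cdf)
  qed (auto simp: isCont_normal_tail)
  then have "\<beta> \<in> range normal_tail" by auto
  then show ?thesis unfolding normal_quantile_def by (rule f_inv_into_f)
qed

lemma normal_quantile_pos: "0 < \<beta> \<Longrightarrow> \<beta> < 1/2 \<Longrightarrow> 0 < normal_quantile \<beta>"
  using normal_tail_quantile[of \<beta>] normal_tail_antimono[of "normal_quantile \<beta>" 0] normal_tail_0
  by (rule_tac ccontr) auto

section \<open>Standard Gaussian measure on finitely many coordinates\<close>

abbreviation std_gauss :: "'i set \<Rightarrow> ('i \<Rightarrow> real) measure" where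
  "std_gauss I \<equiv> \<Pi>\<^sub>M i\<in>I. stdN"

lemma prob_std_gauss: "prob_space (std_gauss I)"
  by (intro prob_space_PiM prob_stdN)

lemma sets_std_gauss [measurable_cong]: "sets (std_gauss I) = sets (\<Pi>\<^sub>M i\<in>I. borel)"
  by (intro sets_PiM_cong) auto

lemma space_std_gauss: "space (std_gauss I) = extensional I"
  by (simp add: space_PiM PiE_def)

lemma std_gauss_indep_coords: "prob_space.indep_vars (std_gauss I) (\<lambda>_. stdN) (\<lambda>i z. z i) I"
proof -
  interpret P: prob_space "std_gauss I" by (rule prob_std_gauss)
  have "distr (std_gauss I) (std_gauss I) (\<lambda>x. \<lambda>i\<in>I. x i) = distr (std_gauss I) (std_gauss I) (\<lambda>x. x)"
    by (rule distr_cong) (auto simp: space_PiM)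
  also have "\<dots> = (\<Pi>\<^sub>M i\<in>I. distr (std_gauss I) stdN (\<lambda>z. z i))"
    by (auto intro!: PiM_cong distr_PiM_component[symmetric, where M="\<lambda>_. stdN"] prob_stdN)
  finally have eq: "distr (std_gauss I) (std_gauss I) (\<lambda>x. \<lambda>i\<in>I. x i) = (\<Pi>\<^sub>M i\<in>I. distr (std_gauss I) stdN (\<lambda>z. z i))" .
  show ?thesis
  proof (cases "I = {}")
    case True
    show ?thesis unfolding P.indep_vars_def2 P.indep_sets_def by (simp add: True)
  next
    case False
    show ?thesis by (rule iffD2[OF P.indep_vars_iff_distr_eq_PiM'[OF False] eq]) simp
  qed
qed

text \<open>
  The coordinates are independent, so characteristic functions multiply. This reduces every question
  about a linear functional of a standard Gaussian vector to one normal variable.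
\<close>

lemma std_gauss_linear_law:
  assumes I: "finite I"
  shows "distr (std_gauss I) borel (\<lambda>z. \<Sum>i\<in>I. a i * z i) = normal_law 0 (L2_set a I)"
proof (rule Levy_uniqueness)
  interpret P: prob_space "std_gauss I" by (rule prob_std_gauss)
  show "real_distribution (distr (std_gauss I) borel (\<lambda>z. \<Sum>i\<in>I. a i * z i))"
    by (intro P.real_distribution_distr) measurable
  show "real_distribution (normal_law 0 (L2_set a I))"
    by (simp add: real_distribution_normal_law L2_set_nonneg)
  have "P.indep_vars (\<lambda>_. stdN) (\<lambda>i z. z i) I"
    by (rule std_gauss_indep_coords)
  then have ind: "P.indep_vars (\<lambda>_. borel) (\<lambda>i z. a i * z i) I"
    by (rule P.indep_vars_compose2) simp
  have law: "distr (std_gauss I) borel (\<lambda>z. a i * z i) = distr stdN borel (\<lambda>x. a i * x)" if "i \<in> I" for i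
  proof -
    have "distr stdN borel (\<lambda>x. a i * x) = distr (distr (std_gauss I) stdN (\<lambda>z. z i)) borel (\<lambda>x. a i * x)"
      using distr_PiM_component[of I "\<lambda>_. stdN" i] that prob_stdN by simp
    also have "\<dots> = distr (std_gauss I) borel (\<lambda>z. a i * z i)"
      using that by (subst distr_distr) (auto simp: comp_def)
    finally show ?thesis by simp
  qed
  show "char (distr (std_gauss I) borel (\<lambda>z. \<Sum>i\<in>I. a i * z i)) = char (normal_law 0 (L2_set a I))"
  proof
    fix t
    have "char (distr (std_gauss I) borel (\<lambda>z. \<Sum>i\<in>I. a i * z i)) t
        = (\<Prod>i\<in>I. char (distr (std_gauss I) borel (\<lambda>z. a i * z i)) t)"
      by (rule P.char_distr_sum[OF ind])
    also have "\<dots> = (\<Prod>i\<in>I. complex_of_real (exp (- (a i * t)\<^sup>2 / 2)))"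
    proof (rule prod.cong[OF refl])
      fix i assume i: "i \<in> I"
      have "char (distr stdN borel (\<lambda>x. a i * x)) t = char stdN (a i * t)"
        by (simp add: char_def integral_distr mult_ac)
      then show "char (distr (std_gauss I) borel (\<lambda>z. a i * z i)) t = complex_of_real (exp (- (a i * t)\<^sup>2 / 2))"
        using law[OF i] by (simp add: char_std_normal_distribution)
    qed
    also have "\<dots> = complex_of_real (exp (\<Sum>i\<in>I. - (a i * t)\<^sup>2 / 2))"
      by (simp add: exp_sum[OF I])
    also have "(\<Sum>i\<in>I. - (a i * t)\<^sup>2 / 2) = - (L2_set a I * t)\<^sup>2 / 2"
      by (simp add: L2_set_def power_mult_distrib sum_nonneg sum_distrib_right sum_negf sum_divide_distrib[symmetric])
    also have "complex_of_real (exp (- (L2_set a I * t)\<^sup>2 / 2)) = char (normal_law 0 (L2_set a I)) t"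
      by (simp add: char_normal_law L2_set_nonneg)
    finally show "char (distr (std_gauss I) borel (\<lambda>z. \<Sum>i\<in>I. a i * z i)) t = char (normal_law 0 (L2_set a I)) t" .
  qed
qed

lemma std_gauss_linear_distr:
  assumes I: "finite I" and f [measurable]: "f \<in> borel_measurable borel"
  shows "distr (std_gauss I) borel (\<lambda>z. f (\<Sum>i\<in>I. a i * z i)) = distr stdN borel (\<lambda>x. f (L2_set a I * x))"
proof -
  have "distr (std_gauss I) borel (\<lambda>z. f (\<Sum>i\<in>I. a i * z i)) = distr (distr (std_gauss I) borel (\<lambda>z. \<Sum>i\<in>I. a i * z i)) borel f"
    by (subst distr_distr) (auto simp: comp_def)
  also have "\<dots> = distr (distr stdN borel (\<lambda>x. L2_set a I * x)) borel f"
    by (simp add: std_gauss_linear_law[OF I] normal_law_affine L2_set_nonneg)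
  also have "\<dots> = distr stdN borel (\<lambda>x. f (L2_set a I * x))"
    by (subst distr_distr) (auto simp: comp_def)
  finally show ?thesis .
qed

lemma std_gauss_linear_integrable:
  fixes f :: "real \<Rightarrow> real"
  assumes I: "finite I" and f [measurable]: "f \<in> borel_measurable borel"
  shows "integrable (std_gauss I) (\<lambda>z. f (\<Sum>i\<in>I. a i * z i)) \<longleftrightarrow> integrable stdN (\<lambda>x. f (L2_set a I * x))"
proof -
  have "integrable (std_gauss I) (\<lambda>z. f (\<Sum>i\<in>I. a i * z i))
      \<longleftrightarrow> integrable (distr (std_gauss I) borel (\<lambda>z. f (\<Sum>i\<in>I. a i * z i))) (\<lambda>x. x)"
    by (subst integrable_distr_eq) auto
  also have "\<dots> \<longleftrightarrow> integrable stdN (\<lambda>x. f (L2_set a I * x))"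
    unfolding std_gauss_linear_distr[OF I f] by (subst integrable_distr_eq) auto
  finally show ?thesis .
qed

lemma std_gauss_linear_integral:
  fixes f :: "real \<Rightarrow> real"
  assumes I: "finite I" and f [measurable]: "f \<in> borel_measurable borel"
  shows "(\<integral>z. f (\<Sum>i\<in>I. a i * z i) \<partial>std_gauss I) = (\<integral>x. f (L2_set a I * x) \<partial>stdN)"
proof -
  have "(\<integral>z. f (\<Sum>i\<in>I. a i * z i) \<partial>std_gauss I)
      = (\<integral>x. x \<partial>distr (std_gauss I) borel (\<lambda>z. f (\<Sum>i\<in>I. a i * z i)))"
    by (subst integral_distr) auto
  also have "\<dots> = (\<integral>x. f (L2_set a I * x) \<partial>stdN)"
    unfolding std_gauss_linear_distr[OF I f] by (subst integral_distr) auto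
  finally show ?thesis .
qed

lemma std_gauss_linear_moments:
  assumes I: "finite I"
  shows "integrable (std_gauss I) (\<lambda>z. \<Sum>i\<in>I. a i * z i)"
    "(\<integral>z. (\<Sum>i\<in>I. a i * z i) \<partial>std_gauss I) = 0"
    "integrable (std_gauss I) (\<lambda>z. (\<Sum>i\<in>I. a i * z i)\<^sup>2)"
    "(\<integral>z. (\<Sum>i\<in>I. a i * z i)\<^sup>2 \<partial>std_gauss I) = (L2_set a I)\<^sup>2"
proof -
  show "integrable (std_gauss I) (\<lambda>z. \<Sum>i\<in>I. a i * z i)"
    by (subst std_gauss_linear_integrable[OF I, where f="\<lambda>x. x"]) (auto intro: stdN_moments)
  show "(\<integral>z. (\<Sum>i\<in>I. a i * z i) \<partial>std_gauss I) = 0"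
    by (subst std_gauss_linear_integral[OF I, where f="\<lambda>x. x"]) (auto simp: stdN_moments)
  show "integrable (std_gauss I) (\<lambda>z. (\<Sum>i\<in>I. a i * z i)\<^sup>2)"
    by (subst std_gauss_linear_integrable[OF I, where f="\<lambda>x. x\<^sup>2"])
       (auto simp: power_mult_distrib intro: stdN_moments)
  show "(\<integral>z. (\<Sum>i\<in>I. a i * z i)\<^sup>2 \<partial>std_gauss I) = (L2_set a I)\<^sup>2"
    by (subst std_gauss_linear_integral[OF I, where f="\<lambda>x. x\<^sup>2"]) (auto simp: power_mult_distrib stdN_moments)
qed

lemma std_gauss_coord_square:
  assumes I: "finite I" and j: "j \<in> I"
  shows "integrable (std_gauss I) (\<lambda>z. (z j)\<^sup>2)"
proof -
  have "(\<Sum>i\<in>I. (if i = j then 1 else 0) * z i) = z j" for z :: "'a \<Rightarrow> real"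
    using I j by (simp add: if_distrib[of "\<lambda>x. x * _"] cong: if_cong)
  then show ?thesis
    using std_gauss_linear_moments(3)[OF I, of "\<lambda>i. if i = j then 1 else 0"] by simp
qed

lemma std_gauss_norm_integrable:
  assumes I: "finite I"
  shows "integrable (std_gauss I) (\<lambda>z. (L2_set z I)\<^sup>2)" "integrable (std_gauss I) (\<lambda>z. L2_set z I)"
proof -
  interpret P: prob_space "std_gauss I" by (rule prob_std_gauss)
  have eq: "(L2_set z I)\<^sup>2 = (\<Sum>i\<in>I. (z i)\<^sup>2)" for z :: "'a \<Rightarrow> real"
    by (simp add: L2_set_def sum_nonneg)
  show 1: "integrable (std_gauss I) (\<lambda>z. (L2_set z I)\<^sup>2)"
    unfolding eq by (intro Bochner_Integration.integrable_sum std_gauss_coord_square I)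
  have [measurable]: "(\<lambda>z. L2_set z I) \<in> borel_measurable (std_gauss I)"
    unfolding L2_set_def by measurable
  show "integrable (std_gauss I) (\<lambda>z. L2_set z I)"
    by (rule P.square_integrable_imp_integrable[OF _ 1]) simp
qed

lemma std_gauss_map:
  assumes I: "finite I" and f: "\<And>i. f i \<in> borel_measurable borel"
  shows "distr (std_gauss I) (\<Pi>\<^sub>M i\<in>I. borel) (\<lambda>z. \<lambda>i\<in>I. f i (z i)) = (\<Pi>\<^sub>M i\<in>I. distr stdN borel (f i))"
    (is "?D = PiM I ?S")
proof -
  interpret S: product_prob_space ?S
    by (intro product_prob_spaceI prob_space.prob_space_distr prob_stdN) (simp add: f)
  interpret N: product_prob_space "\<lambda>_::'a. stdN"
    by (intro product_prob_spaceI prob_stdN)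
  note [measurable] = f
  show ?thesis
  proof (rule S.PiM_eqI[OF I])
    show "sets ?D = sets (PiM I ?S)" unfolding sets_distr by (intro sets_PiM_cong) auto
    fix A assume A: "\<And>i. i \<in> I \<Longrightarrow> A i \<in> sets (?S i)"
    then have [measurable]: "\<And>i. i \<in> I \<Longrightarrow> A i \<in> sets borel" by simp
    have "emeasure ?D (Pi\<^sub>E I A) = emeasure (std_gauss I) ((\<lambda>z. \<lambda>i\<in>I. f i (z i)) -` Pi\<^sub>E I A \<inter> space (std_gauss I))"
      using I by (intro emeasure_distr) (auto intro!: sets_PiM_I_finite)
    also have "(\<lambda>z. \<lambda>i\<in>I. f i (z i)) -` Pi\<^sub>E I A \<inter> space (std_gauss I) = Pi\<^sub>E I (\<lambda>i. f i -` A i)"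
      by (auto simp: space_std_gauss PiE_iff extensional_def)
    also have "emeasure (std_gauss I) \<dots> = (\<Prod>i\<in>I. emeasure stdN (f i -` A i))"
      using I f by (intro N.emeasure_PiM) (auto intro!: measurable_sets_borel[where M=borel])
    also have "\<dots> = (\<Prod>i\<in>I. emeasure (?S i) (A i))"
      by (intro prod.cong refl) (simp add: emeasure_distr f)
    finally show "emeasure ?D (Pi\<^sub>E I A) = (\<Prod>i\<in>I. emeasure (?S i) (A i))" .
  qed
qed

text \<open>
  The Cameron--Martin formula: translating a Gaussian measure multiplies it by an explicit density.
  It lets a shift of the argument of an averaged function be moved onto the density, and so makes the
  average differentiable without any smoothness of the function.
\<close>

lemma std_gauss_shift:
  assumes I: "finite I"
  shows "distr (std_gauss I) (\<Pi>\<^sub>M i\<in>I. borel) (\<lambda>z. \<lambda>i\<in>I. z i + h i)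
    = density (std_gauss I) (\<lambda>z. exp ((\<Sum>i\<in>I. h i * z i) - (L2_set h I)\<^sup>2 / 2))"
proof -
  let ?E = "density (std_gauss I) (\<lambda>z. exp ((\<Sum>i\<in>I. h i * z i) - (L2_set h I)\<^sup>2 / 2))"
  let ?S = "\<lambda>i. distr stdN borel (\<lambda>x. x + h i)"
  interpret S: product_prob_space ?S
    by (intro product_prob_spaceI prob_space.prob_space_distr prob_stdN) simp
  interpret N: product_prob_space "\<lambda>_::'a. stdN"
    by (intro product_prob_spaceI prob_stdN)
  have setsS: "sets (PiM I ?S) = sets (\<Pi>\<^sub>M i\<in>I. borel)" by (intro sets_PiM_cong) auto
  have "distr (std_gauss I) (\<Pi>\<^sub>M i\<in>I. borel) (\<lambda>z. \<lambda>i\<in>I. z i + h i) = PiM I ?S"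
    by (rule std_gauss_map[OF I]) simp
  also have "\<dots> = ?E"
  proof (rule S.PiM_eqI[OF I, symmetric])
    fix A assume A: "\<And>i. i \<in> I \<Longrightarrow> A i \<in> sets (?S i)"
    then have mA [measurable]: "\<And>i. i \<in> I \<Longrightarrow> A i \<in> sets borel" by simp
    have ex: "ennreal (exp ((\<Sum>i\<in>I. h i * z i) - (L2_set h I)\<^sup>2 / 2)) = (\<Prod>i\<in>I. ennreal (exp (h i * z i - (h i)\<^sup>2 / 2)))" for z
      by (simp add: prod_ennreal exp_sum[OF I, symmetric] L2_set_def sum_nonneg sum_subtractf sum_divide_distrib)
    have ind: "indicator (Pi\<^sub>E I A) z = (\<Prod>i\<in>I. indicator (A i) (z i) :: ennreal)" if "z \<in> space (std_gauss I)" for z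
      using that I by (auto simp: space_std_gauss PiE_iff indicator_def prod_zero_iff)
    have "emeasure (?E) (Pi\<^sub>E I A)
       = (\<integral>\<^sup>+z. ennreal (exp ((\<Sum>i\<in>I. h i * z i) - (L2_set h I)\<^sup>2 / 2)) * indicator (Pi\<^sub>E I A) z \<partial>std_gauss I)"
      using I by (intro emeasure_density) (auto intro!: sets_PiM_I_finite)
    also have "\<dots> = (\<integral>\<^sup>+z. (\<Prod>i\<in>I. ennreal (exp (h i * z i - (h i)\<^sup>2 / 2)) * indicator (A i) (z i)) \<partial>std_gauss I)"
      by (intro nn_integral_cong) (simp add: ex ind prod.distrib)
    also have "\<dots> = (\<Prod>i\<in>I. \<integral>\<^sup>+x. ennreal (exp (h i * x - (h i)\<^sup>2 / 2)) * indicator (A i) x \<partial>stdN)"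
      by (rule N.product_nn_integral_prod[OF I]) measurable
    also have "\<dots> = (\<Prod>i\<in>I. emeasure (?S i) (A i))"
      by (intro prod.cong refl) (simp add: stdN_shift emeasure_density)
    finally show "emeasure (?E) (Pi\<^sub>E I A)
      = (\<Prod>i\<in>I. emeasure (?S i) (A i))" .
  qed (simp add: setsS sets_std_gauss)
  finally show ?thesis .
qed

text \<open>
  Independent Gaussian vectors add up to a Gaussian vector; hence consecutive Gaussian averages are
  one Gaussian average with the variances added.
\<close>

lemma std_gauss_rotate:
  assumes I: "finite I"
  shows "distr (std_gauss I \<Otimes>\<^sub>M std_gauss I) (\<Pi>\<^sub>M i\<in>I. borel) (\<lambda>(z, w). \<lambda>i\<in>I. c * z i + d * w i)
    = distr (std_gauss I) (\<Pi>\<^sub>M i\<in>I. borel) (\<lambda>z. \<lambda>i\<in>I. sqrt (c\<^sup>2 + d\<^sup>2) * z i)"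
proof -
  let ?\<Gamma>2 = "std_gauss I \<Otimes>\<^sub>M std_gauss I"
  let ?D = "distr ?\<Gamma>2 (\<Pi>\<^sub>M i\<in>I. borel) (\<lambda>(z, w). \<lambda>i\<in>I. c * z i + d * w i)"
  let ?S = "\<lambda>i::'a. distr stdN borel (\<lambda>x. sqrt (c\<^sup>2 + d\<^sup>2) * x)"
  interpret S: product_prob_space ?S
    by (intro product_prob_spaceI prob_space.prob_space_distr prob_stdN) simp
  interpret N: product_prob_space "\<lambda>_::'a. stdN"
    by (intro product_prob_spaceI prob_stdN)
  interpret N1: prob_space stdN by (rule prob_stdN)
  interpret P: prob_space "std_gauss I" by (rule prob_std_gauss)
  have setsS: "sets (PiM I ?S) = sets (\<Pi>\<^sub>M i\<in>I. borel)" by (intro sets_PiM_cong) auto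
  have "distr (std_gauss I) (\<Pi>\<^sub>M i\<in>I. borel) (\<lambda>z. \<lambda>i\<in>I. sqrt (c\<^sup>2 + d\<^sup>2) * z i) = PiM I ?S"
    by (rule std_gauss_map[OF I]) simp
  also have "PiM I ?S = ?D"
  proof (rule S.PiM_eqI[OF I, symmetric])
    fix A assume A: "\<And>i. i \<in> I \<Longrightarrow> A i \<in> sets (?S i)"
    then have mA [measurable]: "\<And>i. i \<in> I \<Longrightarrow> A i \<in> sets borel" by simp
    have box [measurable]: "Pi\<^sub>E I A \<in> sets (\<Pi>\<^sub>M i\<in>I. borel)" using I by (auto intro!: sets_PiM_I_finite)
    have "emeasure (?D) (Pi\<^sub>E I A)
       = (\<integral>\<^sup>+p. indicator (Pi\<^sub>E I A) ((\<lambda>(z, w). \<lambda>i\<in>I. c * z i + d * w i) p) \<partial>?\<Gamma>2)"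
      by (subst nn_integral_indicator[symmetric], simp, subst nn_integral_distr) auto
    also have "\<dots> = (\<integral>\<^sup>+p. (\<Prod>i\<in>I. indicator (A i) (c * fst p i + d * snd p i)) \<partial>?\<Gamma>2)"
      using I by (intro nn_integral_cong) (auto simp: split_beta PiE_iff indicator_def prod_zero_iff)
    also have "\<dots> = (\<integral>\<^sup>+z. \<integral>\<^sup>+w. (\<Prod>i\<in>I. indicator (A i) (c * z i + d * w i)) \<partial>std_gauss I \<partial>std_gauss I)"
      by (subst sigma_finite_measure.nn_integral_fst[OF prob_space_imp_sigma_finite[OF prob_std_gauss], symmetric]) auto
    also have "\<dots> = (\<integral>\<^sup>+z. (\<Prod>i\<in>I. \<integral>\<^sup>+y. indicator (A i) (c * z i + d * y) \<partial>stdN) \<partial>std_gauss I)"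
      by (intro nn_integral_cong N.product_nn_integral_prod[OF I]) measurable
    also have "\<dots> = (\<Prod>i\<in>I. \<integral>\<^sup>+x. \<integral>\<^sup>+y. indicator (A i) (c * x + d * y) \<partial>stdN \<partial>stdN)"
      by (rule N.product_nn_integral_prod[OF I]) measurable
    also have "\<dots> = (\<Prod>i\<in>I. emeasure (?S i) (A i))"
    proof (intro prod.cong refl)
      fix i assume i: "i \<in> I"
      then have [measurable]: "A i \<in> sets borel" by simp
      have "emeasure (?S i) (A i) = (\<integral>\<^sup>+p. indicator (A i) ((\<lambda>(x, y). c * x + d * y) p) \<partial>(stdN \<Otimes>\<^sub>M stdN))"
        unfolding stdN_rotate[symmetric]
        by (subst nn_integral_indicator[symmetric], simp, subst nn_integral_distr) auto
      also have "\<dots> = (\<integral>\<^sup>+x. \<integral>\<^sup>+y. indicator (A i) (c * x + d * y) \<partial>stdN \<partial>stdN)"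
        by (subst sigma_finite_measure.nn_integral_fst[OF prob_space_imp_sigma_finite[OF prob_stdN], symmetric]) auto
      finally show "(\<integral>\<^sup>+x. \<integral>\<^sup>+y. indicator (A i) (c * x + d * y) \<partial>stdN \<partial>stdN) = emeasure (?S i) (A i)" ..
    qed
    finally show "emeasure (?D) (Pi\<^sub>E I A)
      = (\<Prod>i\<in>I. emeasure (?S i) (A i))" .
  qed (simp add: setsS)
  finally show ?thesis by simp
qed

section \<open>Gaussian averages of Lipschitz functions\<close>

lemma stdN_tilted_mean:
  shows "integrable stdN (\<lambda>x. x * exp (r * x - r\<^sup>2 / 2))"
    "(\<integral>x. x * exp (r * x - r\<^sup>2 / 2) \<partial>stdN) = r"
proof -
  interpret N: prob_space stdN by (rule prob_stdN)
  have 1: "integrable (distr stdN borel (\<lambda>x. x + r)) (\<lambda>x. x)"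
    by (subst integrable_distr_eq) (auto intro: stdN_moments)
  have 2: "(\<integral>x. x \<partial>distr stdN borel (\<lambda>x. x + r)) = r"
    using N.prob_space by (subst integral_distr) (auto simp: stdN_moments)
  have "integrable stdN (\<lambda>x. exp (r * x - r\<^sup>2 / 2) *\<^sub>R x)"
    using 1 unfolding stdN_shift by (subst (asm) integrable_density) auto
  then show "integrable stdN (\<lambda>x. x * exp (r * x - r\<^sup>2 / 2))"
    by (simp only: real_scaleR_def mult.commute[of "exp _"])
  have "(\<integral>x. exp (r * x - r\<^sup>2 / 2) *\<^sub>R x \<partial>stdN) = r"
    using 2 unfolding stdN_shift by (subst (asm) integral_density) auto
  then show "(\<integral>x. x * exp (r * x - r\<^sup>2 / 2) \<partial>stdN) = r"
    by (simp only: real_scaleR_def mult.commute[of "exp _"])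
qed

lemma stdN_exp_shifted:
  shows "integrable stdN (\<lambda>x. exp (r * x - c))" "(\<integral>x. exp (r * x - c) \<partial>stdN) = exp (r\<^sup>2 / 2 - c)"
proof -
  have eq: "exp (r * x - c) = exp (- c) * exp (r * x)" for x by (simp add: exp_add[symmetric])
  show "integrable stdN (\<lambda>x. exp (r * x - c))" unfolding eq by (intro integrable_mult_right stdN_exp)
  have "(\<integral>x. exp (r * x - c) \<partial>stdN) = exp (- c) * exp (r\<^sup>2 / 2)"
    unfolding eq by (subst integral_mult_right_zero) (simp add: stdN_exp)
  then show "(\<integral>x. exp (r * x - c) \<partial>stdN) = exp (r\<^sup>2 / 2 - c)" by (simp add: exp_add[symmetric])
qed

text \<open>
  What is squared is the Cameron--Martin density without its terms of order zero and one in \<open>r\<close>. By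
  orthogonality of the Hermite polynomials its second moment is the exponential series in \<open>r\<^sup>2\<close> without
  the first two terms, which is \<open>O(r ^ 4)\<close> for small \<open>r\<close>.
\<close>

lemma stdN_remainder_square:
  shows "integrable stdN (\<lambda>x. (exp (r * x - r\<^sup>2 / 2) - 1 - r * x)\<^sup>2)"
    "(\<integral>x. (exp (r * x - r\<^sup>2 / 2) - 1 - r * x)\<^sup>2 \<partial>stdN) = exp (r\<^sup>2) - 1 - r\<^sup>2"
proof -
  interpret N: prob_space stdN by (rule prob_stdN)
  have eq: "(exp (r * x - r\<^sup>2 / 2) - 1 - r * x)\<^sup>2
    = exp (2 * r * x - r\<^sup>2) + (1 + (r\<^sup>2 * x\<^sup>2 + (2 * r * x - (2 * exp (r * x - r\<^sup>2 / 2) + 2 * r * (x * exp (r * x - r\<^sup>2 / 2))))))" for x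
  proof -
    have "exp (2 * r * x - r\<^sup>2) = (exp (r * x - r\<^sup>2 / 2))\<^sup>2"
      by (simp add: exp_double[symmetric] field_simps)
    then show ?thesis by (simp add: power2_eq_square algebra_simps)
  qed
  have "has_bochner_integral stdN (\<lambda>x. exp (2 * r * x - r\<^sup>2) + (1 + (r\<^sup>2 * x\<^sup>2 + (2 * r * x - (2 * exp (r * x - r\<^sup>2 / 2) + 2 * r * (x * exp (r * x - r\<^sup>2 / 2)))))))
     (exp ((2 * r)\<^sup>2 / 2 - r\<^sup>2) + (1 + (r\<^sup>2 * 1 + (2 * r * 0 - (2 * exp (r\<^sup>2 / 2 - r\<^sup>2 / 2) + 2 * r * r)))))"
    using N.prob_space stdN_exp_shifted[of "2 * r" "r\<^sup>2"] stdN_exp_shifted[of r "r\<^sup>2 / 2"] stdN_tilted_mean[of r] stdN_moments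
    by (intro has_bochner_integral_add has_bochner_integral_diff has_bochner_integral_mult_right)
       (auto simp: has_bochner_integral_iff)
  then show "integrable stdN (\<lambda>x. (exp (r * x - r\<^sup>2 / 2) - 1 - r * x)\<^sup>2)"
    "(\<integral>x. (exp (r * x - r\<^sup>2 / 2) - 1 - r * x)\<^sup>2 \<partial>stdN) = exp (r\<^sup>2) - 1 - r\<^sup>2"
    unfolding eq by (auto simp: has_bochner_integral_iff power2_eq_square)
qed

lemma exp_remainder_le:
  fixes x :: real
  assumes "0 \<le> x" "x \<le> 1"
  shows "exp x - 1 - x \<le> x\<^sup>2"
  using exp_bound[OF assms] by simp

definition gauss_smooth :: "'i set \<Rightarrow> real \<Rightarrow> (('i \<Rightarrow> real) \<Rightarrow> real) \<Rightarrow> ('i \<Rightarrow> real) \<Rightarrow> real" where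
  "gauss_smooth I \<tau> F s = (\<integral>z. F (\<lambda>i. s i + \<tau> * z i) \<partial>std_gauss I)"

text \<open>
  The congruence assumption lets the argument of \<open>f\<close> be a total function, although the measure only
  sees the coordinates in \<open>I\<close>.
\<close>

lemma std_gauss_semigroup:
  fixes f :: "('i \<Rightarrow> real) \<Rightarrow> real"
  assumes I: "finite I" and f: "f \<in> borel_measurable (\<Pi>\<^sub>M i\<in>I. borel)"
    and cong: "\<And>x y. (\<And>i. i \<in> I \<Longrightarrow> x i = y i) \<Longrightarrow> f x = f y"
    and int: "integrable (std_gauss I) (\<lambda>z. f (\<lambda>i. s i + sqrt (c\<^sup>2 + d\<^sup>2) * z i))"
  shows "integrable (std_gauss I) (\<lambda>z. \<integral>w. f (\<lambda>i. s i + c * z i + d * w i) \<partial>std_gauss I)"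
    "(\<integral>z. (\<integral>w. f (\<lambda>i. s i + c * z i + d * w i) \<partial>std_gauss I) \<partial>std_gauss I)
      = (\<integral>z. f (\<lambda>i. s i + sqrt (c\<^sup>2 + d\<^sup>2) * z i) \<partial>std_gauss I)"
proof -
  interpret P: prob_space "std_gauss I" by (rule prob_std_gauss)
  interpret PP: pair_prob_space "std_gauss I" "std_gauss I" ..
  define g where "g v = f (\<lambda>i\<in>I. s i + v i)" for v
  have g [measurable]: "g \<in> borel_measurable (\<Pi>\<^sub>M i\<in>I. borel)"
    unfolding g_def by (intro measurable_compose[OF _ f]) measurable
  have g1: "g (\<lambda>i\<in>I. sqrt (c\<^sup>2 + d\<^sup>2) * z i) = f (\<lambda>i. s i + sqrt (c\<^sup>2 + d\<^sup>2) * z i)" for z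
    unfolding g_def by (rule cong) auto
  have g2: "g ((\<lambda>(z, w). \<lambda>i\<in>I. c * z i + d * w i) (z, w)) = f (\<lambda>i. s i + c * z i + d * w i)" for z w
    unfolding g_def by (rule cong) auto
  have "integrable (distr (std_gauss I) (\<Pi>\<^sub>M i\<in>I. borel) (\<lambda>z. \<lambda>i\<in>I. sqrt (c\<^sup>2 + d\<^sup>2) * z i)) g"
    using int by (subst integrable_distr_eq) (auto simp: g1)
  then have int2: "integrable (std_gauss I \<Otimes>\<^sub>M std_gauss I) (\<lambda>p. g ((\<lambda>(z, w). \<lambda>i\<in>I. c * z i + d * w i) p))"
    unfolding std_gauss_rotate[OF I, symmetric]
    by (rule integrable_distr[rotated]) measurable
  show "integrable (std_gauss I) (\<lambda>z. \<integral>w. f (\<lambda>i. s i + c * z i + d * w i) \<partial>std_gauss I)"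
    using PP.integrable_fst'[OF int2] by (simp only: g2)
  have "(\<integral>z. (\<integral>w. f (\<lambda>i. s i + c * z i + d * w i) \<partial>std_gauss I) \<partial>std_gauss I)
      = (\<integral>p. g ((\<lambda>(z, w). \<lambda>i\<in>I. c * z i + d * w i) p) \<partial>(std_gauss I \<Otimes>\<^sub>M std_gauss I))"
    using PP.integral_fst'[OF int2] by (simp only: g2)
  also have "\<dots> = (\<integral>v. g v \<partial>distr (std_gauss I) (\<Pi>\<^sub>M i\<in>I. borel) (\<lambda>z. \<lambda>i\<in>I. sqrt (c\<^sup>2 + d\<^sup>2) * z i))"
    unfolding std_gauss_rotate[OF I, symmetric] by (rule integral_distr[symmetric]) measurable
  also have "\<dots> = (\<integral>z. f (\<lambda>i. s i + sqrt (c\<^sup>2 + d\<^sup>2) * z i) \<partial>std_gauss I)"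
    by (subst integral_distr) (auto simp: g1)
  finally show "(\<integral>z. (\<integral>w. f (\<lambda>i. s i + c * z i + d * w i) \<partial>std_gauss I) \<partial>std_gauss I)
      = (\<integral>z. f (\<lambda>i. s i + sqrt (c\<^sup>2 + d\<^sup>2) * z i) \<partial>std_gauss I)" .
qed

locale l2_lipschitz =
  fixes I :: "'i set" and F :: "('i \<Rightarrow> real) \<Rightarrow> real" and L :: real
  assumes finite_I: "finite I"
    and measurable_F: "F \<in> borel_measurable (\<Pi>\<^sub>M i\<in>I. borel)"
    and lipschitz: "\<bar>F x - F y\<bar> \<le> L * L2_set (\<lambda>i. x i - y i) I"
    and L_pos: "0 < L"
begin

lemma F_cong: "(\<And>i. i \<in> I \<Longrightarrow> x i = y i) \<Longrightarrow> F x = F y"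
  using lipschitz[of x y] by (simp add: L2_set_def cong: sum.cong)

lemma measurable_compose_F:
  assumes "\<And>i. i \<in> I \<Longrightarrow> (\<lambda>z. g z i) \<in> borel_measurable M"
  shows "(\<lambda>z. F (g z)) \<in> borel_measurable M"
proof -
  have "(\<lambda>z. F (\<lambda>i\<in>I. g z i)) \<in> borel_measurable M"
    using assms by (intro measurable_compose[OF _ measurable_F] measurable_restrict) auto
  moreover have "F (\<lambda>i\<in>I. g z i) = F (g z)" for z by (rule F_cong) auto
  ultimately show ?thesis by simp
qed

lemma lipschitz_scaled: "\<bar>F (\<lambda>i. s i + \<tau> * z i) - F s\<bar> \<le> L * \<bar>\<tau>\<bar> * L2_set z I"
proof -
  have "L2_set (\<lambda>i. \<tau> * z i) I = \<bar>\<tau>\<bar> * L2_set z I"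
    by (simp add: L2_set_def power_mult_distrib sum_distrib_left[symmetric] real_sqrt_mult)
  then show ?thesis using lipschitz[of "\<lambda>i. s i + \<tau> * z i" s] by simp
qed

lemma integrable_dist: "integrable (std_gauss I) (\<lambda>z. F (\<lambda>i. s i + \<tau> * z i) - F s)"
proof (rule Bochner_Integration.integrable_bound)
  show "integrable (std_gauss I) (\<lambda>z. L * \<bar>\<tau>\<bar> * L2_set z I)"
    by (intro integrable_mult_right std_gauss_norm_integrable finite_I)
  show "(\<lambda>z. F (\<lambda>i. s i + \<tau> * z i) - F s) \<in> borel_measurable (std_gauss I)"
    by (intro borel_measurable_diff measurable_compose_F) auto
  show "AE z in std_gauss I. norm (F (\<lambda>i. s i + \<tau> * z i) - F s) \<le> norm (L * \<bar>\<tau>\<bar> * L2_set z I)"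
    using lipschitz_scaled L_pos by (auto intro!: AE_I2 simp: L2_set_nonneg)
qed

lemma integrable_F: "integrable (std_gauss I) (\<lambda>z. F (\<lambda>i. s i + \<tau> * z i))"
proof -
  interpret P: prob_space "std_gauss I" by (rule prob_std_gauss)
  have "integrable (std_gauss I) (\<lambda>z. (F (\<lambda>i. s i + \<tau> * z i) - F s) + F s)"
    by (intro Bochner_Integration.integrable_add integrable_dist) simp
  then show ?thesis by simp
qed

lemma l2_lipschitz_smooth: "l2_lipschitz I (gauss_smooth I \<tau> F) L"
proof
  interpret P: prob_space "std_gauss I" by (rule prob_std_gauss)
  show "gauss_smooth I \<tau> F \<in> borel_measurable (\<Pi>\<^sub>M i\<in>I. borel)"
    unfolding gauss_smooth_def
    by (intro sigma_finite_measure.borel_measurable_lebesgue_integral[OF prob_space_imp_sigma_finite[OF prob_std_gauss]])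
       (unfold split_beta', intro measurable_compose_F, measurable)
  fix x y
  have "\<bar>gauss_smooth I \<tau> F x - gauss_smooth I \<tau> F y\<bar>
      = \<bar>\<integral>z. F (\<lambda>i. x i + \<tau> * z i) - F (\<lambda>i. y i + \<tau> * z i) \<partial>std_gauss I\<bar>"
    unfolding gauss_smooth_def by (simp add: integrable_F)
  also have "\<dots> \<le> (\<integral>z. \<bar>F (\<lambda>i. x i + \<tau> * z i) - F (\<lambda>i. y i + \<tau> * z i)\<bar> \<partial>std_gauss I)"
    by (rule integral_abs_bound)
  also have "\<dots> \<le> (\<integral>z. L * L2_set (\<lambda>i. x i - y i) I \<partial>std_gauss I)"
  proof (rule integral_mono)
    fix z show "\<bar>F (\<lambda>i. x i + \<tau> * z i) - F (\<lambda>i. y i + \<tau> * z i)\<bar> \<le> L * L2_set (\<lambda>i. x i - y i) I"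
      using lipschitz[of "\<lambda>i. x i + \<tau> * z i" "\<lambda>i. y i + \<tau> * z i"] by simp
  qed (auto intro!: Bochner_Integration.integrable_diff integrable_F)
  finally show "\<bar>gauss_smooth I \<tau> F x - gauss_smooth I \<tau> F y\<bar> \<le> L * L2_set (\<lambda>i. x i - y i) I"
    using P.prob_space by simp
qed (auto simp: finite_I L_pos)

lemma smooth_semigroup:
  "(\<integral>z. gauss_smooth I d F (\<lambda>i. s i + c * z i) \<partial>std_gauss I) = gauss_smooth I (sqrt (c\<^sup>2 + d\<^sup>2)) F s"
  unfolding gauss_smooth_def
  by (rule std_gauss_semigroup(2)[OF finite_I measurable_F F_cong integrable_F])

definition second_moment :: real where
  "second_moment = (\<integral>z. (L2_set z I)\<^sup>2 \<partial>std_gauss I)"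

lemma second_moment_nonneg: "0 \<le> second_moment"
  unfolding second_moment_def by (intro Bochner_Integration.integral_nonneg) auto

text \<open>
  \<open>std_gauss_shift\<close> in the form in which integrals use it.
\<close>

lemma shift_density:
  fixes f :: "('i \<Rightarrow> real) \<Rightarrow> real"
  assumes f: "f \<in> borel_measurable (\<Pi>\<^sub>M i\<in>I. borel)"
    and int: "integrable (std_gauss I) (\<lambda>z. f (\<lambda>i\<in>I. z i + h i))"
  shows "integrable (std_gauss I) (\<lambda>z. exp ((\<Sum>i\<in>I. h i * z i) - (L2_set h I)\<^sup>2 / 2) * f z)"
    "(\<integral>z. exp ((\<Sum>i\<in>I. h i * z i) - (L2_set h I)\<^sup>2 / 2) * f z \<partial>std_gauss I) = (\<integral>z. f (\<lambda>i\<in>I. z i + h i) \<partial>std_gauss I)"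
proof -
  have [measurable]: "f \<in> borel_measurable (std_gauss I)"
    using f by (simp cong: measurable_cong_sets add: measurable_cong_sets[OF sets_std_gauss refl])
  let ?D = "\<lambda>z. exp ((\<Sum>i\<in>I. h i * z i) - (L2_set h I)\<^sup>2 / 2)"
  have "integrable (distr (std_gauss I) (\<Pi>\<^sub>M i\<in>I. borel) (\<lambda>z. \<lambda>i\<in>I. z i + h i)) f"
    using int f by (subst integrable_distr_eq) auto
  then show "integrable (std_gauss I) (\<lambda>z. ?D z * f z)"
    unfolding std_gauss_shift[OF finite_I] by (subst (asm) integrable_density) auto
  have "(\<integral>z. f (\<lambda>i\<in>I. z i + h i) \<partial>std_gauss I) = (\<integral>z. f z \<partial>density (std_gauss I) (\<lambda>z. ennreal (?D z)))"
    unfolding std_gauss_shift[OF finite_I, symmetric] using f by (subst integral_distr) auto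
  also have "\<dots> = (\<integral>z. ?D z * f z \<partial>std_gauss I)"
    by (subst integral_density) auto
  finally show "(\<integral>z. ?D z * f z \<partial>std_gauss I) = (\<integral>z. f (\<lambda>i\<in>I. z i + h i) \<partial>std_gauss I)" ..
qed


text \<open>
  By the Cameron--Martin formula the increment of the average is the mean of \<open>F (s + \<tau> z) - F s\<close>
  against \<open>D - 1\<close> with \<open>D\<close> the density of the shift by \<open>h / \<tau>\<close>. The linear part of \<open>D - 1\<close> produces the
  linear term, and the remainder \<open>R\<close> of \<open>D\<close> has second moment \<open>O(r ^ 4)\<close> with \<open>r\<close> the norm of
  \<open>h / \<tau>\<close>.
\<close>

lemma smooth_remainder:
  fixes s :: "'i \<Rightarrow> real"
  assumes \<tau>: "\<tau> > 0" and r: "L2_set h I \<le> \<tau>" "L2_set h I \<noteq> 0"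
  defines "a \<equiv> \<lambda>i. (\<integral>z. (F (\<lambda>i. s i + \<tau> * z i) - F s) * z i \<partial>std_gauss I) / \<tau>"
  shows "\<bar>gauss_smooth I \<tau> F (\<lambda>i. s i + h i) - gauss_smooth I \<tau> F s - (\<Sum>i\<in>I. a i * h i)\<bar>
    \<le> L * (2 + second_moment) / \<tau> * (L2_set h I)\<^sup>2"
proof -
  interpret P: prob_space "std_gauss I" by (rule prob_std_gauss)
  define \<Phi> where "\<Phi> z = F (\<lambda>i. s i + \<tau> * z i) - F s" for z
  define \<eta> where "\<eta> i = h i / \<tau>" for i
  define r where "r = L2_set \<eta> I"
  define D where "D z = exp ((\<Sum>i\<in>I. \<eta> i * z i) - r\<^sup>2 / 2)" for z
  define R where "R z = D z - 1 - (\<Sum>i\<in>I. \<eta> i * z i)" for z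
  have r_eq: "r = L2_set h I / \<tau>"
    using \<tau> by (simp add: r_def \<eta>_def L2_set_def power_divide sum_divide_distrib[symmetric] real_sqrt_divide)
  have r0: "0 < r" "r \<le> 1"
    using r \<tau> less_le[of 0 "L2_set h I"] by (auto simp: r_eq)
  have \<Phi>_m: "\<Phi> \<in> borel_measurable (\<Pi>\<^sub>M i\<in>I. borel)"
    unfolding \<Phi>_def by (intro borel_measurable_diff measurable_compose_F) auto
  have \<Phi>_m' [measurable]: "\<Phi> \<in> borel_measurable (std_gauss I)"
    unfolding \<Phi>_def by (intro borel_measurable_diff measurable_compose_F) auto
  have \<Phi>_le: "\<bar>\<Phi> z\<bar> \<le> L * \<tau> * L2_set z I" for z
    using lipschitz_scaled[of s \<tau> z] \<tau> by (simp add: \<Phi>_def)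
  have \<Phi>_int: "integrable (std_gauss I) \<Phi>"
    unfolding \<Phi>_def by (rule integrable_dist)
  have \<Phi>_shift: "\<Phi> (\<lambda>i\<in>I. z i + \<eta> i) = F (\<lambda>i. (s i + h i) + \<tau> * z i) - F s" for z
    unfolding \<Phi>_def using \<tau> by (auto intro!: F_cong simp: \<eta>_def field_simps)
  have "integrable (std_gauss I) (\<lambda>z. \<Phi> (\<lambda>i\<in>I. z i + \<eta> i))"
    unfolding \<Phi>_shift by (intro Bochner_Integration.integrable_diff integrable_F) simp
  note sd = shift_density[OF \<Phi>_m this, folded r_def, folded D_def]
  have coord: "integrable (std_gauss I) (\<lambda>z. \<Phi> z * z i)" if i: "i \<in> I" for i
  proof (rule Bochner_Integration.integrable_bound)
    show "integrable (std_gauss I) (\<lambda>z. L * \<tau> * (L2_set z I)\<^sup>2)"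
      by (intro integrable_mult_right std_gauss_norm_integrable finite_I)
    show "(\<lambda>z. \<Phi> z * z i) \<in> borel_measurable (std_gauss I)"
      using i by measurable
    have "\<bar>z i\<bar> \<le> L2_set z I" for z
      using member_le_L2_set[OF finite_I i, of "\<lambda>i. \<bar>z i\<bar>"] by (simp add: L2_set_def)
    then have "\<bar>\<Phi> z * z i\<bar> \<le> (L * \<tau> * L2_set z I) * L2_set z I" for z
      unfolding abs_mult using \<Phi>_le[of z] by (intro mult_mono) auto
    then show "AE z in std_gauss I. norm (\<Phi> z * z i) \<le> norm (L * \<tau> * (L2_set z I)\<^sup>2)"
      using L_pos \<tau> by (auto intro!: AE_I2 simp: power2_eq_square mult_ac abs_mult)
  qed
  have a_h: "has_bochner_integral (std_gauss I) (\<lambda>z. \<Phi> z * (\<Sum>i\<in>I. \<eta> i * z i)) (\<Sum>i\<in>I. a i * h i)"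
  proof -
    have "has_bochner_integral (std_gauss I) (\<lambda>z. \<Sum>i\<in>I. \<eta> i * (\<Phi> z * z i)) (\<Sum>i\<in>I. \<eta> i * (\<integral>z. \<Phi> z * z i \<partial>std_gauss I))"
      by (intro has_bochner_integral_sum has_bochner_integral_mult_right has_bochner_integral_integrable coord)
    moreover have "(\<Sum>i\<in>I. \<eta> i * (\<integral>z. \<Phi> z * z i \<partial>std_gauss I)) = (\<Sum>i\<in>I. a i * h i)"
      by (simp add: \<eta>_def a_def \<Phi>_def mult_ac)
    moreover have "(\<Sum>i\<in>I. \<eta> i * (\<Phi> z * z i)) = \<Phi> z * (\<Sum>i\<in>I. \<eta> i * z i)" for z
      by (simp add: sum_distrib_left mult_ac)
    ultimately show ?thesis by simp
  qed
  have D\<Phi>: "has_bochner_integral (std_gauss I) (\<lambda>z. D z * \<Phi> z) (gauss_smooth I \<tau> F (\<lambda>i. s i + h i) - F s)"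
    using sd P.prob_space unfolding D_def \<Phi>_shift gauss_smooth_def has_bochner_integral_iff by (simp add: integrable_F)
  have \<Phi>1: "has_bochner_integral (std_gauss I) \<Phi> (gauss_smooth I \<tau> F s - F s)"
    using \<Phi>_int P.prob_space unfolding \<Phi>_def gauss_smooth_def has_bochner_integral_iff by (simp add: integrable_F)
  have "has_bochner_integral (std_gauss I) (\<lambda>z. (D z * \<Phi> z - \<Phi> z) - \<Phi> z * (\<Sum>i\<in>I. \<eta> i * z i))
     (((gauss_smooth I \<tau> F (\<lambda>i. s i + h i) - F s) - (gauss_smooth I \<tau> F s - F s)) - (\<Sum>i\<in>I. a i * h i))"
    by (intro has_bochner_integral_diff D\<Phi> \<Phi>1 a_h)
  then have \<Phi>R: "has_bochner_integral (std_gauss I) (\<lambda>z. \<Phi> z * R z)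
      (gauss_smooth I \<tau> F (\<lambda>i. s i + h i) - gauss_smooth I \<tau> F s - (\<Sum>i\<in>I. a i * h i))"
    by (simp add: R_def algebra_simps)
  have R2: "integrable (std_gauss I) (\<lambda>z. (R z)\<^sup>2)" "(\<integral>z. (R z)\<^sup>2 \<partial>std_gauss I) = exp (r\<^sup>2) - 1 - r\<^sup>2"
    unfolding R_def D_def r_def
    by (subst std_gauss_linear_integrable[OF finite_I, where f="\<lambda>x. (exp (x - (L2_set \<eta> I)\<^sup>2 / 2) - 1 - x)\<^sup>2"],
        simp, rule stdN_remainder_square)
       (subst std_gauss_linear_integral[OF finite_I, where f="\<lambda>x. (exp (x - (L2_set \<eta> I)\<^sup>2 / 2) - 1 - x)\<^sup>2"],
        simp, rule stdN_remainder_square)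
  \<comment> \<open>The arithmetic-geometric mean inequality, weighted by \<open>r\<close> so that both terms integrate to \<open>O(r\<^sup>2)\<close>.\<close>
  have pointwise: "\<bar>\<Phi> z * R z\<bar> \<le> L * \<tau> * (r\<^sup>2 / 2 * (L2_set z I)\<^sup>2 + (R z)\<^sup>2 / (2 * r\<^sup>2))" for z
  proof -
    have "L2_set z I * \<bar>R z\<bar> \<le> r\<^sup>2 / 2 * (L2_set z I)\<^sup>2 + (R z)\<^sup>2 / (2 * r\<^sup>2)"
    proof -
      have "(r * L2_set z I - \<bar>R z\<bar> / r)\<^sup>2 = r\<^sup>2 * (L2_set z I)\<^sup>2 - 2 * (L2_set z I * \<bar>R z\<bar>) + (R z)\<^sup>2 / r\<^sup>2"
        using r0 by (simp add: power2_diff power_mult_distrib power_divide)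
      moreover have "(R z)\<^sup>2 / (2 * r\<^sup>2) = (R z)\<^sup>2 / r\<^sup>2 / 2" by simp
      ultimately show ?thesis using zero_le_power2[of "r * L2_set z I - \<bar>R z\<bar> / r"] by linarith
    qed
    then have "L * \<tau> * (L2_set z I * \<bar>R z\<bar>) \<le> L * \<tau> * (r\<^sup>2 / 2 * (L2_set z I)\<^sup>2 + (R z)\<^sup>2 / (2 * r\<^sup>2))"
      using L_pos \<tau> by (intro mult_left_mono) auto
    moreover have "\<bar>\<Phi> z * R z\<bar> \<le> (L * \<tau> * L2_set z I) * \<bar>R z\<bar>"
      unfolding abs_mult by (intro mult_right_mono \<Phi>_le) auto
    ultimately show ?thesis by (simp add: mult_ac)
  qed
  have "\<bar>\<integral>z. \<Phi> z * R z \<partial>std_gauss I\<bar> \<le> (\<integral>z. \<bar>\<Phi> z * R z\<bar> \<partial>std_gauss I)"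
    by (rule integral_abs_bound)
  also have "\<dots> \<le> (\<integral>z. L * \<tau> * (r\<^sup>2 / 2 * (L2_set z I)\<^sup>2 + (R z)\<^sup>2 / (2 * r\<^sup>2)) \<partial>std_gauss I)"
    using \<Phi>R by (intro integral_mono pointwise integrable_abs integrable_mult_right Bochner_Integration.integrable_add
      integrable_divide_zero R2 std_gauss_norm_integrable finite_I) (auto simp: has_bochner_integral_iff)
  also have "\<dots> = L * \<tau> * (r\<^sup>2 / 2 * second_moment + (exp (r\<^sup>2) - 1 - r\<^sup>2) / (2 * r\<^sup>2))"
    using R2 by (simp add: second_moment_def std_gauss_norm_integrable finite_I)
  also have "\<dots> \<le> L * \<tau> * (r\<^sup>2 / 2 * second_moment + r\<^sup>2 / 2)"
  proof -
    have "exp (r\<^sup>2) - 1 - r\<^sup>2 \<le> (r\<^sup>2)\<^sup>2"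
      using r0 by (intro exp_remainder_le) (auto simp: power_le_one)
    then have "(exp (r\<^sup>2) - 1 - r\<^sup>2) / (2 * r\<^sup>2) \<le> r\<^sup>2 / 2"
      using r0 by (simp add: field_simps power2_eq_square)
    then show ?thesis using L_pos \<tau> by (intro mult_left_mono) auto
  qed
  also have "\<dots> \<le> L * \<tau> * (r\<^sup>2 * (2 + second_moment))"
  proof -
    have "0 \<le> second_moment * r\<^sup>2" using second_moment_nonneg by simp
    then have "r\<^sup>2 / 2 * second_moment + r\<^sup>2 / 2 \<le> r\<^sup>2 * (2 + second_moment)"
      using zero_le_power2[of r] unfolding distrib_left mult.commute[of _ second_moment] by linarith
    then show ?thesis using L_pos \<tau> by (intro mult_left_mono) auto
  qed
  also have "\<dots> = L * (2 + second_moment) / \<tau> * (L2_set h I)\<^sup>2"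
    using \<tau> by (simp add: r_eq power_divide power2_eq_square)
  finally show ?thesis using \<Phi>R by (simp add: has_bochner_integral_iff)
qed

text \<open>
  The local expansion becomes global, because for large increments the Lipschitz bound is better
  than a quadratic one. A Lipschitz function with a first-order expansion has a gradient bounded by
  its Lipschitz constant.
\<close>

lemma smooth_taylor:
  assumes \<tau>: "\<tau> > 0"
  obtains a where "L2_set a I \<le> L"
    "\<And>h. \<bar>gauss_smooth I \<tau> F (\<lambda>i. s i + h i) - gauss_smooth I \<tau> F s - (\<Sum>i\<in>I. a i * h i)\<bar>
      \<le> L * (2 + second_moment) / \<tau> * (L2_set h I)\<^sup>2"
proof -
  define a where "a = (\<lambda>i. (\<integral>z. (F (\<lambda>i. s i + \<tau> * z i) - F s) * z i \<partial>std_gauss I) / \<tau>)"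
  define K where "K = L * (2 + second_moment) / \<tau>"
  let ?G = "gauss_smooth I \<tau> F"
  interpret G: l2_lipschitz I ?G L by (rule l2_lipschitz_smooth)
  have K: "K \<ge> 0" using \<tau> L_pos second_moment_nonneg by (simp add: K_def)
  have loc: "\<bar>?G (\<lambda>i. s i + h i) - ?G s - (\<Sum>i\<in>I. a i * h i)\<bar> \<le> K * (L2_set h I)\<^sup>2"
    if "L2_set h I \<le> \<tau>" for h
  proof (cases "L2_set h I = 0")
    case True
    then have "\<forall>i\<in>I. h i = 0" by (simp add: L2_set_eq_0_iff finite_I)
    then show ?thesis using K G.F_cong[of "\<lambda>i. s i + h i" s] by simp
  next
    case False
    then show ?thesis unfolding a_def K_def using smooth_remainder[OF \<tau> that False, of s] by simp
  qed
  \<comment> \<open>Along \<open>t h\<close> with \<open>t\<close> tending to \<open>0\<close> the quadratic error is negligible against the Lipschitz bound.\<close>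
  have dir: "(\<Sum>i\<in>I. a i * h i) \<le> L * L2_set h I" for h
  proof (rule tendsto_lowerbound)
    show "((\<lambda>t. L * L2_set h I + K * t * (L2_set h I)\<^sup>2) \<longlongrightarrow> L * L2_set h I) (at_right 0)"
      by (auto intro!: tendsto_eq_intros)
    have "eventually (\<lambda>t. t > 0 \<and> t * L2_set h I < \<tau>) (at_right (0::real))"
    proof -
      have "((\<lambda>t. t * L2_set h I) \<longlongrightarrow> 0) (at_right (0::real))" by (auto intro!: tendsto_eq_intros)
      from order_tendstoD(2)[OF this \<tau>] show ?thesis
        using eventually_at_right_less[of "0::real"] by (auto elim: eventually_elim2)
    qed
    then show "eventually (\<lambda>t. (\<Sum>i\<in>I. a i * h i) \<le> L * L2_set h I + K * t * (L2_set h I)\<^sup>2) (at_right 0)"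
    proof eventually_elim
      case (elim t)
      have th: "L2_set (\<lambda>i. t * h i) I = t * L2_set h I"
        using elim by (simp add: L2_set_def power_mult_distrib sum_distrib_left[symmetric] real_sqrt_mult)
      have "(\<Sum>i\<in>I. a i * (t * h i)) = t * (\<Sum>i\<in>I. a i * h i)" by (simp add: sum_distrib_left mult_ac)
      then have "t * (\<Sum>i\<in>I. a i * h i) \<le> K * (t * L2_set h I)\<^sup>2 + \<bar>?G (\<lambda>i. s i + t * h i) - ?G s\<bar>"
        using loc[of "\<lambda>i. t * h i"] elim unfolding th by linarith
      also have "\<bar>?G (\<lambda>i. s i + t * h i) - ?G s\<bar> \<le> L * (t * L2_set h I)"
        using G.lipschitz_scaled[of s t h] elim by simp
      finally have "t * (\<Sum>i\<in>I. a i * h i) \<le> t * (L * L2_set h I + K * t * (L2_set h I)\<^sup>2)"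
        by (simp add: algebra_simps power2_eq_square)
      then show ?case using elim by simp
    qed
  qed simp
  have aL: "L2_set a I \<le> L"
  proof -
    have "(L2_set a I)\<^sup>2 \<le> L * L2_set a I"
      using dir[of a] by (simp add: L2_set_def sum_nonneg power2_eq_square)
    then show ?thesis
      using L_pos L2_set_nonneg[of a I] by (cases "L2_set a I = 0") (auto simp: power2_eq_square)
  qed
  have "\<bar>?G (\<lambda>i. s i + h i) - ?G s - (\<Sum>i\<in>I. a i * h i)\<bar> \<le> K * (L2_set h I)\<^sup>2" for h
  proof (cases "L2_set h I \<le> \<tau>")
    case False
    have "\<bar>\<Sum>i\<in>I. a i * h i\<bar> \<le> L * L2_set h I"
    proof -
      have "\<bar>\<Sum>i\<in>I. a i * h i\<bar> \<le> (\<Sum>i\<in>I. \<bar>a i\<bar> * \<bar>h i\<bar>)" by (simp add: abs_mult[symmetric])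
      also have "\<dots> \<le> L2_set a I * L2_set h I" by (rule L2_set_mult_ineq)
      also have "\<dots> \<le> L * L2_set h I" by (intro mult_right_mono aL) simp
      finally show ?thesis .
    qed
    moreover have "\<bar>?G (\<lambda>i. s i + h i) - ?G s\<bar> \<le> L * L2_set h I"
      using G.lipschitz_scaled[of s 1 h] by simp
    ultimately have "\<bar>?G (\<lambda>i. s i + h i) - ?G s - (\<Sum>i\<in>I. a i * h i)\<bar> \<le> 2 * L * L2_set h I" by linarith
    also have "\<dots> \<le> 2 * L * (L2_set h I * (L2_set h I / \<tau>))"
      using False \<tau> L_pos mult_left_mono[of 1 "L2_set h I / \<tau>" "2 * L * L2_set h I"] by (simp add: mult_ac)
    also have "\<dots> \<le> K * (L2_set h I)\<^sup>2"
      using \<tau> L_pos second_moment_nonneg by (simp add: K_def power2_eq_square field_simps)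
    finally show ?thesis .
  qed (rule loc)
  with aL show ?thesis unfolding K_def by (intro that) auto
qed

end

section \<open>Concentration of Lipschitz functions about their mean\<close>

text \<open>
  The probability that a normal variable with mean \<open>y\<close> and standard deviation \<open>b\<close> is at least
  \<open>x\<close>.
\<close>

definition exceed :: "real \<Rightarrow> real \<Rightarrow> real \<Rightarrow> real" where
  "exceed x b y = (\<integral>z. indicator {x..} (y + b * z) \<partial>stdN)"

text \<open>
  By the reflection principle, the probability that a Brownian motion started at \<open>y\<close> reaches level
  \<open>x\<close> within time \<open>b\<^sup>2\<close>.
\<close>

definition reach :: "real \<Rightarrow> real \<Rightarrow> real \<Rightarrow> real" where
  "reach x b y = min 1 (2 * exceed x b y)"

lemma stdN_integrable_bounded:
  "g \<in> borel_measurable borel \<Longrightarrow> (\<And>z. \<bar>g z\<bar> \<le> B) \<Longrightarrow> integrable stdN (g :: real \<Rightarrow> real)"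
  using prob_space.finite_measure[OF prob_stdN]
  by (intro finite_measure.integrable_const_bound[where B=B] AE_I2) auto

lemma exceed_measurable [measurable]: "exceed x b \<in> borel_measurable borel"
  unfolding exceed_def[abs_def]
  by (intro sigma_finite_measure.borel_measurable_lebesgue_integral[OF prob_space_imp_sigma_finite[OF prob_stdN]]) measurable

lemma reach_measurable [measurable]: "reach x b \<in> borel_measurable borel"
  unfolding reach_def[abs_def] by measurable

lemma exceed_nonneg: "0 \<le> exceed x b y"
  unfolding exceed_def by (intro Bochner_Integration.integral_nonneg) auto

lemma exceed_le_1: "exceed x b y \<le> 1"
proof -
  have "exceed x b y \<le> (\<integral>z. 1 \<partial>stdN)"
    unfolding exceed_def
    by (intro integral_mono stdN_integrable_bounded[where B=1]) (auto simp: indicator_def)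
  then show ?thesis using prob_space.prob_space[OF prob_stdN] by simp
qed

lemma reach_bounds: "0 \<le> reach x b y" "reach x b y \<le> 1"
  using exceed_nonneg[of x b y] by (auto simp: reach_def)

lemma exceed_semigroup: "(\<integral>z. exceed x d (y + c * z) \<partial>stdN) = exceed x (sqrt (c\<^sup>2 + d\<^sup>2)) y"
proof -
  interpret N: prob_space stdN by (rule prob_stdN)
  interpret P: pair_prob_space stdN stdN ..
  let ?g = "\<lambda>v. indicator {x..} (y + v) :: real"
  have int: "integrable (stdN \<Otimes>\<^sub>M stdN) (\<lambda>p. ?g ((\<lambda>(z, w). c * z + d * w) p))"
    by (intro P.integrable_const_bound[where B=1]) auto
  have "(\<integral>z. exceed x d (y + c * z) \<partial>stdN) = (\<integral>p. ?g ((\<lambda>(z, w). c * z + d * w) p) \<partial>(stdN \<Otimes>\<^sub>M stdN))"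
    using P.integral_fst'[OF int] by (simp add: exceed_def add.assoc)
  also have "\<dots> = (\<integral>v. ?g v \<partial>distr (stdN \<Otimes>\<^sub>M stdN) borel (\<lambda>(z, w). c * z + d * w))"
    by (rule integral_distr[symmetric]) auto
  also have "\<dots> = exceed x (sqrt (c\<^sup>2 + d\<^sup>2)) y"
    unfolding stdN_rotate exceed_def by (subst integral_distr) auto
  finally show ?thesis .
qed

lemma exceed_ge_half:
  assumes "x \<le> y" "0 \<le> b"
  shows "1 / 2 \<le> exceed x b y"
proof -
  have "normal_tail 0 = (\<integral>z. indicator {0..} z \<partial>stdN)"
    by (simp add: normal_tail_def)
  also have "\<dots> \<le> exceed x b y"
    unfolding exceed_def using assms mult_nonneg_nonneg[of b]
    by (intro integral_mono stdN_integrable_bounded[where B=1]) (auto simp: indicator_def intro: add_increasing2)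
  finally show ?thesis by (simp add: normal_tail_0)
qed

text \<open>
  More time makes it easier to reach a level. For \<open>exceed\<close> itself this fails when \<open>y \<ge> x\<close>; there
  \<open>exceed\<close> is at least one half and the cut-off at \<open>1\<close> takes over.
\<close>

lemma reach_mono:
  assumes "0 \<le> b" "b \<le> b'"
  shows "reach x b y \<le> reach x b' y"
proof (cases "x \<le> y")
  case True
  then show ?thesis using exceed_ge_half[of x y b] exceed_ge_half[of x y b'] assms by (simp add: reach_def)
next
  case False
  have "exceed x b y \<le> exceed x b' y"
    unfolding exceed_def
  proof (intro integral_mono stdN_integrable_bounded[where B=1])
    fix z :: real
    have "x \<le> y + b' * z" if "x \<le> y + b * z"
    proof -
      have "0 < b * z" using that False by linarith
      then have "0 < z" using assms zero_less_mult_pos[of b z] by (cases "b = 0") auto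
      then have "b * z \<le> b' * z" using assms by (intro mult_right_mono) auto
      then show ?thesis using that by linarith
    qed
    then show "indicator {x..} (y + b * z) \<le> (indicator {x..} (y + b' * z) :: real)"
      by (auto simp: indicator_def)
  qed auto
  then show ?thesis by (simp add: reach_def)
qed

text \<open>
  Both bounds in the minimum survive averaging: the constant trivially, and \<open>exceed\<close> because normal
  increments add up.
\<close>

lemma reach_supermartingale:
  "(\<integral>z. reach x d (y + c * z) \<partial>stdN) \<le> reach x (sqrt (c\<^sup>2 + d\<^sup>2)) y"
proof -
  interpret N: prob_space stdN by (rule prob_stdN)
  have int: "integrable stdN (\<lambda>z. reach x d (y + c * z))" "integrable stdN (\<lambda>z. exceed x d (y + c * z))"
    using reach_bounds exceed_nonneg exceed_le_1 by (auto intro!: stdN_integrable_bounded[where B=1])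
  have "(\<integral>z. reach x d (y + c * z) \<partial>stdN) \<le> (\<integral>z. 1 \<partial>stdN)"
    by (intro integral_mono int) (auto simp: reach_bounds)
  moreover have "(\<integral>z. reach x d (y + c * z) \<partial>stdN) \<le> (\<integral>z. 2 * exceed x d (y + c * z) \<partial>stdN)"
    by (intro integral_mono int integrable_mult_right) (auto simp: reach_def)
  ultimately show ?thesis
    using N.prob_space by (simp add: exceed_semigroup reach_def)
qed

text \<open>
  Needed because the error of the first-order expansion is quadratic in the step, and its square
  has to be integrated.
\<close>

lemma std_gauss_fourth_moment:
  assumes I: "finite I"
  shows "integrable (std_gauss I) (\<lambda>z. (L2_set z I) ^ 4)"
proof (rule Bochner_Integration.integrable_bound)
  have coord: "integrable (std_gauss I) (\<lambda>z. (z j) ^ 4)" if j: "j \<in> I" for j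
  proof -
    have "(\<Sum>i\<in>I. (if i = j then 1 else 0) * z i) = z j" for z :: "'a \<Rightarrow> real"
      using I j by (simp add: if_distrib[of "\<lambda>x. x * _"] cong: if_cong)
    then show ?thesis
      using std_gauss_linear_integrable[OF I, of "\<lambda>x. x ^ 4" "\<lambda>i. if i = j then 1 else 0"]
        integrable_mult_right[OF integrable_std_normal_distribution_moment[of 4]]
      by (simp add: power_mult_distrib)
  qed
  then show "integrable (std_gauss I) (\<lambda>z. card I * (\<Sum>i\<in>I. (z i) ^ 4))"
    by (intro integrable_mult_right Bochner_Integration.integrable_sum)
  show "(\<lambda>z. (L2_set z I) ^ 4) \<in> borel_measurable (std_gauss I)"
    unfolding L2_set_def by measurable
  show "AE z in std_gauss I. norm ((L2_set z I) ^ 4) \<le> norm (card I * (\<Sum>i\<in>I. (z i) ^ 4))"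
  proof (rule AE_I2)
    fix z :: "'a \<Rightarrow> real"
    have "(L2_set z I) ^ 4 = (\<Sum>i\<in>I. 1 * (z i)\<^sup>2)\<^sup>2"
      using power_mult[of "L2_set z I" 2 2] by (simp add: L2_set_def sum_nonneg)
    also have "\<dots> \<le> (L2_set (\<lambda>i. 1) I * L2_set (\<lambda>i. (z i)\<^sup>2) I)\<^sup>2"
      using L2_set_mult_ineq[of "\<lambda>i. 1" "\<lambda>i. (z i)\<^sup>2" I] by (intro power_mono) (auto intro: sum_nonneg)
    also have "\<dots> = card I * (\<Sum>i\<in>I. (z i) ^ 4)"
      by (simp add: L2_set_def power_mult_distrib sum_nonneg)
    finally show "norm ((L2_set z I) ^ 4) \<le> norm (card I * (\<Sum>i\<in>I. (z i) ^ 4))"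
      by (simp add: sum_nonneg)
  qed
qed

context l2_lipschitz
begin

definition fourth_moment :: real where
  "fourth_moment = (\<integral>z. (L2_set z I) ^ 4 \<partial>std_gauss I)"

text \<open>
  One step of the walk. The average at scale \<open>\<tau>\<close>, evaluated after a step of size \<open>\<delta>\<close>, is its mean
  over the step plus a linear, hence normal, term of standard deviation at most \<open>L * \<delta>\<close> plus a centred
  error of second moment \<open>O(\<delta> ^ 4)\<close>.
\<close>

lemma walk_step:
  fixes s :: "'i \<Rightarrow> real" and \<tau> \<delta> :: real
  assumes \<tau>: "\<tau> > 0" and \<delta>: "\<delta> \<ge> 0" and K: "L * (2 + second_moment) / \<tau> \<le> K"
  obtains a \<rho> where "L2_set a I \<le> L"
    "\<And>z. gauss_smooth I \<tau> F (\<lambda>i. s i + \<delta> * z i)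
      = gauss_smooth I (sqrt (\<delta>\<^sup>2 + \<tau>\<^sup>2)) F s + \<delta> * (\<Sum>i\<in>I. a i * z i) + \<rho> z"
    "integrable (std_gauss I) \<rho>" "(\<integral>z. \<rho> z \<partial>std_gauss I) = 0"
    "integrable (std_gauss I) (\<lambda>z. (\<rho> z)\<^sup>2)" "(\<integral>z. (\<rho> z)\<^sup>2 \<partial>std_gauss I) \<le> K\<^sup>2 * fourth_moment * \<delta> ^ 4"
proof -
  interpret P: prob_space "std_gauss I" by (rule prob_std_gauss)
  let ?U = "gauss_smooth I \<tau> F" and ?U' = "gauss_smooth I (sqrt (\<delta>\<^sup>2 + \<tau>\<^sup>2)) F"
  interpret U: l2_lipschitz I ?U L by (rule l2_lipschitz_smooth)
  obtain a where aL: "L2_set a I \<le> L"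
    and a: "\<And>h. \<bar>?U (\<lambda>i. s i + h i) - ?U s - (\<Sum>i\<in>I. a i * h i)\<bar> \<le> L * (2 + second_moment) / \<tau> * (L2_set h I)\<^sup>2"
    by (rule smooth_taylor[OF \<tau>, of s]) (rule that)
  define R where "R z = ?U (\<lambda>i. s i + \<delta> * z i) - ?U s - \<delta> * (\<Sum>i\<in>I. a i * z i)" for z
  have R_le: "\<bar>R z\<bar> \<le> K * \<delta>\<^sup>2 * (L2_set z I)\<^sup>2" for z
  proof -
    have "(\<Sum>i\<in>I. a i * (\<delta> * z i)) = \<delta> * (\<Sum>i\<in>I. a i * z i)"
      by (simp add: sum_distrib_left mult_ac)
    moreover have "(L2_set (\<lambda>i. \<delta> * z i) I)\<^sup>2 = \<delta>\<^sup>2 * (L2_set z I)\<^sup>2"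
      by (simp add: L2_set_def sum_nonneg power_mult_distrib sum_distrib_left[symmetric])
    ultimately have "\<bar>R z\<bar> \<le> L * (2 + second_moment) / \<tau> * (\<delta>\<^sup>2 * (L2_set z I)\<^sup>2)"
      using a[of "\<lambda>i. \<delta> * z i"] by (simp add: R_def)
    also have "\<dots> \<le> K * (\<delta>\<^sup>2 * (L2_set z I)\<^sup>2)"
      by (intro mult_right_mono K) auto
    finally show ?thesis by (simp add: mult_ac)
  qed
  have R_m [measurable]: "R \<in> borel_measurable (std_gauss I)"
    unfolding R_def by (intro borel_measurable_diff U.measurable_compose_F) auto
  have R_int: "integrable (std_gauss I) R"
    unfolding R_def
    by (intro Bochner_Integration.integrable_diff U.integrable_F integrable_mult_right std_gauss_linear_moments finite_I) simp
  have R_mean: "(\<integral>z. R z \<partial>std_gauss I) = ?U' s - ?U s"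
    using P.prob_space unfolding R_def
    by (simp add: U.integrable_F std_gauss_linear_moments[OF finite_I] smooth_semigroup)
  have R4: "(R z)\<^sup>2 \<le> K\<^sup>2 * \<delta> ^ 4 * (L2_set z I) ^ 4" for z
  proof -
    have "(R z)\<^sup>2 \<le> (K * \<delta>\<^sup>2 * (L2_set z I)\<^sup>2)\<^sup>2"
      using R_le[of z] by (subst power2_abs[symmetric]) (intro power_mono, auto)
    then show ?thesis by (simp add: power_mult_distrib flip: power_mult)
  qed
  have int4: "integrable (std_gauss I) (\<lambda>z. K\<^sup>2 * \<delta> ^ 4 * (L2_set z I) ^ 4)"
    by (intro integrable_mult_right std_gauss_fourth_moment finite_I)
  have R2_int: "integrable (std_gauss I) (\<lambda>z. (R z)\<^sup>2)"
  proof (rule Bochner_Integration.integrable_bound[OF int4])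
    show "AE z in std_gauss I. norm ((R z)\<^sup>2) \<le> norm (K\<^sup>2 * \<delta> ^ 4 * (L2_set z I) ^ 4)"
      using R4 order_trans[OF zero_le_power2 R4] by (intro AE_I2) auto
  qed measurable
  \<comment> \<open>The linear term is centred, so the mean of \<open>R\<close> is the change of the average over the step.\<close>
  define m where "m = ?U' s - ?U s"
  have R2: "(\<integral>z. (R z)\<^sup>2 \<partial>std_gauss I) \<le> K\<^sup>2 * fourth_moment * \<delta> ^ 4"
    using integral_mono[OF R2_int int4 R4] by (simp add: fourth_moment_def mult_ac)
  have sq: "(R z - m)\<^sup>2 = (R z)\<^sup>2 - 2 * m * R z + m\<^sup>2" for z
    by (simp add: power2_diff)
  show ?thesis
  proof (rule that[OF aL, of "\<lambda>z. R z - m"])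
    show "?U (\<lambda>i. s i + \<delta> * z i) = ?U' s + \<delta> * (\<Sum>i\<in>I. a i * z i) + (R z - m)" for z
      by (simp add: R_def m_def)
    show "integrable (std_gauss I) (\<lambda>z. R z - m)" using R_int by simp
    show "(\<integral>z. R z - m \<partial>std_gauss I) = 0" using R_int R_mean P.prob_space by (simp add: m_def)
    show "integrable (std_gauss I) (\<lambda>z. (R z - m)\<^sup>2)"
      unfolding sq using R_int R2_int by simp
    have "(\<integral>z. (R z - m)\<^sup>2 \<partial>std_gauss I) = (\<integral>z. (R z)\<^sup>2 \<partial>std_gauss I) - m\<^sup>2"
      unfolding sq using R_int R2_int R_mean P.prob_space by (simp add: m_def power2_eq_square)
    then show "(\<integral>z. (R z - m)\<^sup>2 \<partial>std_gauss I) \<le> K\<^sup>2 * fourth_moment * \<delta> ^ 4"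
      using R2 zero_le_power2[of m] by linarith
  qed
qed

text \<open>
  Backward induction on the number \<open>j\<close> of remaining steps. The current value of the averaged function
  is split as \<open>c + y + r\<close>, where \<open>y\<close> collects the normal parts and \<open>r\<close> the errors of the earlier steps.
  If the final value is to exceed \<open>c + x + \<eta>\<close>, then either the normal parts reach \<open>x\<close>, which costs
  \<open>reach\<close>, or the errors exceed \<open>\<eta>\<close>, which costs their second moment over \<open>\<eta>\<^sup>2\<close>. The errors are centred,
  so their second moments add. The average at the small scale \<open>\<epsilon>\<close> replaces \<open>F\<close> at the end of the
  walk, so that the expansion is uniform in \<open>j\<close>.
\<close>

lemma walk_bound:
  fixes \<epsilon> \<delta> \<eta> c x :: real
  assumes \<epsilon>: "\<epsilon> > 0" and \<delta>: "\<delta> \<ge> 0" and \<eta>: "\<eta> > 0"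
  defines "C \<equiv> (L * (2 + second_moment) / \<epsilon>)\<^sup>2 * fourth_moment"
  assumes "gauss_smooth I (sqrt (\<epsilon>\<^sup>2 + real j * \<delta>\<^sup>2)) F s = c + y + r"
  shows "(\<integral>z. indicator {c + x + \<eta>..} (gauss_smooth I \<epsilon> F (\<lambda>i. s i + \<delta> * sqrt (real j) * z i)) \<partial>std_gauss I)
    \<le> reach x (L * \<delta> * sqrt (real j)) y + (r\<^sup>2 + real j * C * \<delta> ^ 4) / \<eta>\<^sup>2"
  using assms(5)
proof (induction j arbitrary: s y r)
  case 0
  interpret P: prob_space "std_gauss I" by (rule prob_std_gauss)
  have U: "gauss_smooth I \<epsilon> F s = c + y + r" using 0 \<epsilon> by simp
  have "indicator {c + x + \<eta>..} (gauss_smooth I \<epsilon> F s) \<le> reach x 0 y + r\<^sup>2 / \<eta>\<^sup>2"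
  proof (cases "x \<le> y")
    case True
    then show ?thesis using exceed_ge_half[of x y 0] by (auto simp: reach_def indicator_def)
  next
    case False
    show ?thesis
    proof (cases "c + x + \<eta> \<le> c + y + r")
      case True
      \<comment> \<open>The normal parts stay below \<open>x\<close>, so the errors account for the rest.\<close>
      then have "\<eta> \<le> r" using False by linarith
      then have "1 \<le> r\<^sup>2 / \<eta>\<^sup>2" using \<eta> by (simp add: power_mono)
      then show ?thesis using reach_bounds(1)[of x 0 y] by (auto simp: indicator_def)
    qed (auto simp: U reach_bounds)
  qed
  then show ?case using P.prob_space by simp
next
  case (Suc j)
  interpret P: prob_space "std_gauss I" by (rule prob_std_gauss)
  let ?U0 = "gauss_smooth I \<epsilon> F"
  interpret U0: l2_lipschitz I ?U0 L by (rule l2_lipschitz_smooth)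
  let ?\<tau> = "sqrt (\<epsilon>\<^sup>2 + real j * \<delta>\<^sup>2)"
  have \<tau>: "?\<tau> \<ge> \<epsilon>" using \<epsilon> by (intro real_le_rsqrt) simp
  then have \<tau>0: "?\<tau> > 0" using \<epsilon> by linarith
  have "L * (2 + second_moment) / ?\<tau> \<le> L * (2 + second_moment) / \<epsilon>"
    using \<tau> \<epsilon> \<tau>0 L_pos second_moment_nonneg by (intro divide_left_mono mult_pos_pos) auto
  then obtain a \<rho> where aL: "L2_set a I \<le> L"
    and U: "\<And>z. gauss_smooth I ?\<tau> F (\<lambda>i. s i + \<delta> * z i)
      = gauss_smooth I (sqrt (\<delta>\<^sup>2 + ?\<tau>\<^sup>2)) F s + \<delta> * (\<Sum>i\<in>I. a i * z i) + \<rho> z"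
    and \<rho>: "integrable (std_gauss I) \<rho>" "(\<integral>z. \<rho> z \<partial>std_gauss I) = 0"
      "integrable (std_gauss I) (\<lambda>z. (\<rho> z)\<^sup>2)" "(\<integral>z. (\<rho> z)\<^sup>2 \<partial>std_gauss I) \<le> C * \<delta> ^ 4"
    by (rule walk_step[OF \<tau>0 \<delta>, of _ s]) (rule that, assumption+, simp only: C_def)
  have "\<delta>\<^sup>2 + ?\<tau>\<^sup>2 = \<epsilon>\<^sup>2 + real (Suc j) * \<delta>\<^sup>2" by (simp add: algebra_simps)
  then have "gauss_smooth I (sqrt (\<delta>\<^sup>2 + ?\<tau>\<^sup>2)) F s = c + y + r" by (simp only: Suc.prems)
  then have U': "gauss_smooth I ?\<tau> F (\<lambda>i. s i + \<delta> * z i) = c + (y + \<delta> * (\<Sum>i\<in>I. a i * z i)) + (r + \<rho> z)" for z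
    using U[of z] by linarith
  let ?f = "\<lambda>v. indicator {c + x + \<eta>..} (?U0 v) :: real"
  have f_m: "?f \<in> borel_measurable (\<Pi>\<^sub>M i\<in>I. borel)"
    using U0.measurable_F by measurable
  have f_cong: "\<And>u v. (\<And>i. i \<in> I \<Longrightarrow> u i = v i) \<Longrightarrow> ?f u = ?f v"
    using U0.F_cong by metis
  have f_int: "integrable (std_gauss I) (\<lambda>z. ?f (\<lambda>i. s i + e * z i))" for e
    by (intro P.integrable_const_bound[where B=1] measurable_compose[OF U0.measurable_compose_F]) auto
  have e: "sqrt (\<delta>\<^sup>2 + (\<delta> * sqrt (real j))\<^sup>2) = \<delta> * sqrt (real (Suc j))"
  proof -
    have "\<delta>\<^sup>2 + (\<delta> * sqrt (real j))\<^sup>2 = \<delta>\<^sup>2 * real (Suc j)"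
      by (simp add: power_mult_distrib algebra_simps)
    then show ?thesis using \<delta> by (simp add: real_sqrt_mult del: of_nat_Suc)
  qed
  note sg = std_gauss_semigroup[OF finite_I f_m f_cong f_int, where c=\<delta> and d="\<delta> * sqrt (real j)", unfolded e]
  let ?v = "\<lambda>z. reach x (L * \<delta> * sqrt (real j)) (y + \<delta> * (\<Sum>i\<in>I. a i * z i))"
  have v_int: "integrable (std_gauss I) ?v"
    using reach_bounds by (intro P.integrable_const_bound[where B=1]) auto
  have sq: "(r + \<rho> z)\<^sup>2 = r\<^sup>2 + 2 * r * \<rho> z + (\<rho> z)\<^sup>2" for z by (simp add: power2_sum)
  have sq_int: "integrable (std_gauss I) (\<lambda>z. (r + \<rho> z)\<^sup>2)" unfolding sq using \<rho> by simp
  have "(\<integral>z. ?f (\<lambda>i. s i + \<delta> * sqrt (real (Suc j)) * z i) \<partial>std_gauss I)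
     = (\<integral>z. (\<integral>w. ?f (\<lambda>i. s i + \<delta> * z i + \<delta> * sqrt (real j) * w i) \<partial>std_gauss I) \<partial>std_gauss I)"
    using sg(2) by simp
  also have "\<dots> \<le> (\<integral>z. ?v z + ((r + \<rho> z)\<^sup>2 + real j * C * \<delta> ^ 4) / \<eta>\<^sup>2 \<partial>std_gauss I)"
    using Suc.IH[OF U'] sg(1) v_int sq_int by (intro integral_mono) auto
  also have "\<dots> = (\<integral>z. ?v z \<partial>std_gauss I) + ((\<integral>z. (r + \<rho> z)\<^sup>2 \<partial>std_gauss I) + real j * C * \<delta> ^ 4) / \<eta>\<^sup>2"
    using v_int sq_int P.prob_space by simp
  also have "(\<integral>z. (r + \<rho> z)\<^sup>2 \<partial>std_gauss I) = r\<^sup>2 + (\<integral>z. (\<rho> z)\<^sup>2 \<partial>std_gauss I)"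
    unfolding sq using \<rho> P.prob_space by simp
  also have "(\<integral>z. ?v z \<partial>std_gauss I) = (\<integral>z. reach x (L * \<delta> * sqrt (real j)) (y + \<delta> * L2_set a I * z) \<partial>stdN)"
    by (subst std_gauss_linear_integral[OF finite_I, where f="\<lambda>u. reach x (L * \<delta> * sqrt (real j)) (y + \<delta> * u)"])
       (auto simp: mult.assoc)
  also have "\<dots> \<le> reach x (sqrt ((\<delta> * L2_set a I)\<^sup>2 + (L * \<delta> * sqrt (real j))\<^sup>2)) y"
    by (rule reach_supermartingale)
  also have "\<dots> \<le> reach x (L * \<delta> * sqrt (real (Suc j))) y"
  proof (rule reach_mono)
    have "(\<delta> * L2_set a I)\<^sup>2 \<le> (\<delta> * L)\<^sup>2" using aL \<delta> by (intro power_mono mult_left_mono) auto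
    then have "(\<delta> * L2_set a I)\<^sup>2 + (L * \<delta> * sqrt (real j))\<^sup>2 \<le> (L * \<delta> * sqrt (real (Suc j)))\<^sup>2"
      by (simp add: power_mult_distrib algebra_simps)
    then show "sqrt ((\<delta> * L2_set a I)\<^sup>2 + (L * \<delta> * sqrt (real j))\<^sup>2) \<le> L * \<delta> * sqrt (real (Suc j))"
      using \<delta> L_pos by (intro real_le_lsqrt) auto
  qed auto
  finally have "(\<integral>z. ?f (\<lambda>i. s i + \<delta> * sqrt (real (Suc j)) * z i) \<partial>std_gauss I)
    \<le> reach x (L * \<delta> * sqrt (real (Suc j))) y + (r\<^sup>2 + (\<integral>z. (\<rho> z)\<^sup>2 \<partial>std_gauss I) + real j * C * \<delta> ^ 4) / \<eta>\<^sup>2"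
    by simp
  also have "(r\<^sup>2 + (\<integral>z. (\<rho> z)\<^sup>2 \<partial>std_gauss I) + real j * C * \<delta> ^ 4) / \<eta>\<^sup>2 \<le> (r\<^sup>2 + real (Suc j) * C * \<delta> ^ 4) / \<eta>\<^sup>2"
    using \<rho>(4) by (intro divide_right_mono) (auto simp: algebra_simps)
  finally show ?case by simp
qed


definition first_moment :: real where
  "first_moment = (\<integral>z. L2_set z I \<partial>std_gauss I)"

lemma first_moment_nonneg: "0 \<le> first_moment"
  unfolding first_moment_def by (intro Bochner_Integration.integral_nonneg) auto

lemma smooth_close: "\<bar>gauss_smooth I \<tau> F s - gauss_smooth I \<tau>' F s\<bar> \<le> L * \<bar>\<tau> - \<tau>'\<bar> * first_moment"
proof -
  have scaled: "L2_set (\<lambda>i. \<tau> * z i - \<tau>' * z i) I = \<bar>\<tau> - \<tau>'\<bar> * L2_set z I" for z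
    by (simp add: L2_set_def left_diff_distrib[symmetric] power_mult_distrib sum_distrib_left[symmetric] real_sqrt_mult)
  have "\<bar>gauss_smooth I \<tau> F s - gauss_smooth I \<tau>' F s\<bar>
      = \<bar>\<integral>z. F (\<lambda>i. s i + \<tau> * z i) - F (\<lambda>i. s i + \<tau>' * z i) \<partial>std_gauss I\<bar>"
    unfolding gauss_smooth_def by (simp add: integrable_F)
  also have "\<dots> \<le> (\<integral>z. \<bar>F (\<lambda>i. s i + \<tau> * z i) - F (\<lambda>i. s i + \<tau>' * z i)\<bar> \<partial>std_gauss I)"
    by (rule integral_abs_bound)
  also have "\<dots> \<le> (\<integral>z. L * \<bar>\<tau> - \<tau>'\<bar> * L2_set z I \<partial>std_gauss I)"
  proof (rule integral_mono)
    fix z show "\<bar>F (\<lambda>i. s i + \<tau> * z i) - F (\<lambda>i. s i + \<tau>' * z i)\<bar> \<le> L * \<bar>\<tau> - \<tau>'\<bar> * L2_set z I"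
      using lipschitz[of "\<lambda>i. s i + \<tau> * z i" "\<lambda>i. s i + \<tau>' * z i"] by (simp add: scaled)
  qed (auto intro!: Bochner_Integration.integrable_diff integrable_F integrable_mult_right std_gauss_norm_integrable finite_I)
  finally show ?thesis by (simp add: first_moment_def)
qed

text \<open>
  The inequality of Cirel'son, Ibragimov and Sudakov. It follows from \<open>walk_bound\<close> with \<open>N\<close> steps of
  size \<open>1 / sqrt N\<close>, first for \<open>N \<rightarrow> \<infinity>\<close>, then for vanishing \<open>\<epsilon>\<close> and \<open>\<eta>\<close>; since \<open>\<epsilon>\<close> and \<open>\<eta>\<close> can be
  absorbed in any loss from \<open>t\<close> to \<open>x < t\<close>, continuity of the tail gives the bound at \<open>t\<close>.
\<close>

theorem gaussian_concentration:
  assumes t: "t > 0"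
  shows "measure (std_gauss I) {z \<in> space (std_gauss I). (\<integral>z. F z \<partial>std_gauss I) + t \<le> F z} \<le> 2 * normal_tail (t / L)"
proof -
  interpret P: prob_space "std_gauss I" by (rule prob_std_gauss)
  define A where "A = {z \<in> space (std_gauss I). (\<integral>z. F z \<partial>std_gauss I) + t \<le> F z}"
  have F_m [measurable]: "F \<in> borel_measurable (std_gauss I)"
    using measurable_compose_F[of "\<lambda>z. z" "std_gauss I"] by simp
  have A_m: "A \<in> sets (std_gauss I)" unfolding A_def by measurable
  have EF: "gauss_smooth I 1 F (\<lambda>_. 0) = (\<integral>z. F z \<partial>std_gauss I)" by (simp add: gauss_smooth_def)
  have F0: "gauss_smooth I 0 F z = F z" for z using P.prob_space by (simp add: gauss_smooth_def)
  have below: "measure (std_gauss I) A \<le> 2 * normal_tail (x / L)" if x: "0 < x" "x < t" for x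
  proof -
    \<comment> \<open>Half of the loss \<open>t - x\<close> pays for replacing \<open>F\<close> and its mean by averages, the other half is \<open>\<eta>\<close>.\<close>
    define \<epsilon> where "\<epsilon> = (t - x) / (4 * L * (first_moment + 1))"
    define \<eta> where "\<eta> = (t - x) / 2"
    define c where "c = gauss_smooth I (sqrt (\<epsilon>\<^sup>2 + 1)) F (\<lambda>_. 0)"
    define C where "C = (L * (2 + second_moment) / \<epsilon>)\<^sup>2 * fourth_moment"
    let ?U = "gauss_smooth I \<epsilon> F"
    interpret U: l2_lipschitz I ?U L by (rule l2_lipschitz_smooth)
    have \<epsilon>: "\<epsilon> > 0" and \<eta>: "\<eta> > 0"
      using x L_pos first_moment_nonneg by (auto simp: \<epsilon>_def \<eta>_def)
    have small: "2 * (L * \<epsilon> * first_moment) \<le> (t - x) / 2"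
    proof -
      have "2 * (L * \<epsilon> * first_moment) \<le> 2 * (L * \<epsilon> * (first_moment + 1))"
        using L_pos \<epsilon> by (intro mult_left_mono) auto
      also have "\<dots> = (t - x) / 2"
      proof -
        have "4 * L * (first_moment + 1) \<noteq> 0" using L_pos first_moment_nonneg by simp
        then have "\<epsilon> * (4 * L * (first_moment + 1)) = t - x" unfolding \<epsilon>_def by (rule nonzero_eq_divide_eq[THEN iffD1]) simp
        then show ?thesis by (simp add: algebra_simps)
      qed
      finally show ?thesis .
    qed
    have "sqrt (\<epsilon>\<^sup>2 + 1) \<ge> 1" "sqrt (\<epsilon>\<^sup>2 + 1) \<le> \<epsilon> + 1"
      using \<epsilon> by (auto intro!: real_le_lsqrt real_le_rsqrt simp: power2_eq_square algebra_simps)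
    then have "L * \<bar>sqrt (\<epsilon>\<^sup>2 + 1) - 1\<bar> * first_moment \<le> L * \<epsilon> * first_moment"
      using L_pos first_moment_nonneg by (intro mult_right_mono mult_left_mono) auto
    then have c_EF: "c \<le> (\<integral>z. F z \<partial>std_gauss I) + L * \<epsilon> * first_moment"
      using smooth_close[of "sqrt (\<epsilon>\<^sup>2 + 1)" "\<lambda>_. 0" 1] by (simp add: c_def EF)
    have incl: "indicator A z \<le> (indicator {c + x + \<eta>..} (?U z) :: real)" for z
    proof (cases "z \<in> A")
      case True
      then have "(\<integral>z. F z \<partial>std_gauss I) + t \<le> F z" by (simp add: A_def)
      moreover have "F z - ?U z \<le> L * \<epsilon> * first_moment"
        using smooth_close[of \<epsilon> z 0] \<epsilon> by (simp add: F0)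
      ultimately have "c + x + \<eta> \<le> ?U z" using c_EF small by (simp add: \<eta>_def field_simps)
      then show ?thesis by simp
    qed simp
    have fin: "measure (std_gauss I) A \<le> 2 * normal_tail (x / L) + C / \<eta>\<^sup>2 * inverse (real N)" if N: "N \<ge> 1" for N
    proof -
      define \<delta> where "\<delta> = 1 / sqrt (real N)"
      have \<delta>: "\<delta> \<ge> 0" "\<delta> * sqrt (real N) = 1" "\<delta>\<^sup>2 = 1 / real N"
        using N by (auto simp: \<delta>_def power_divide)
      have \<delta>4: "real N * C * \<delta> ^ 4 = C * inverse (real N)"
      proof -
        have "\<delta> ^ 4 = (\<delta>\<^sup>2)\<^sup>2" by (simp flip: power_mult)
        then have "\<delta> ^ 4 = (1 / real N)\<^sup>2" by (simp only: \<delta>(3))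
        then show ?thesis using N by (simp add: power2_eq_square field_simps)
      qed
      have "measure (std_gauss I) A = (\<integral>z. indicator A z \<partial>std_gauss I)"
        using A_m by simp
      also have "\<dots> \<le> (\<integral>z. indicator {c + x + \<eta>..} (?U z) \<partial>std_gauss I)"
        using A_m by (intro integral_mono incl P.integrable_const_bound[where B=1] measurable_compose[OF U.measurable_compose_F])
          auto
      also have "\<dots> = (\<integral>z. indicator {c + x + \<eta>..} (?U (\<lambda>i. 0 + \<delta> * sqrt (real N) * z i)) \<partial>std_gauss I)"
        by (simp add: \<delta>(2))
      also have "\<dots> \<le> reach x (L * \<delta> * sqrt (real N)) 0 + (0\<^sup>2 + real N * C * \<delta> ^ 4) / \<eta>\<^sup>2"
        unfolding C_def
        by (rule walk_bound[OF \<epsilon> \<delta>(1) \<eta>]) (use N in \<open>simp add: c_def \<delta>(3)\<close>)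
      also have "L * \<delta> * sqrt (real N) = L" using \<delta>(2) by (simp add: mult.assoc)
      also have "reach x L 0 \<le> 2 * exceed x L 0" by (simp add: reach_def)
      also have "exceed x L 0 = normal_tail (x / L)"
      proof -
        have "exceed x L 0 = (\<integral>z. indicator {x / L..} z \<partial>stdN)"
          unfolding exceed_def using L_pos
          by (intro Bochner_Integration.integral_cong) (auto simp: indicator_def field_simps)
        then show ?thesis by (simp add: normal_tail_def)
      qed
      finally have "measure (std_gauss I) A \<le> 2 * normal_tail (x / L) + (C * inverse (real N)) / \<eta>\<^sup>2"
        unfolding \<delta>4 by simp
      then show ?thesis by simp
    qed
    have "(\<lambda>N. 2 * normal_tail (x / L) + C / \<eta>\<^sup>2 * inverse (real N)) \<longlonglongrightarrow> 2 * normal_tail (x / L) + C / \<eta>\<^sup>2 * 0"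
      by (intro tendsto_intros lim_inverse_n)
    then show ?thesis
      using fin by (intro LIMSEQ_le_const[where x="2 * normal_tail (x / L)"]) auto
  qed
  have "((\<lambda>x. 2 * normal_tail (x / L)) \<longlongrightarrow> 2 * normal_tail (t / L)) (at_left t)"
    using L_pos by (intro tendsto_intros isCont_tendsto_compose[OF isCont_normal_tail]) auto
  moreover have "eventually (\<lambda>x. measure (std_gauss I) A \<le> 2 * normal_tail (x / L)) (at_left t)"
    using below t by (auto simp: eventually_at_left_field intro!: exI[of _ 0])
  ultimately show ?thesis
    unfolding A_def[symmetric] by (intro tendsto_lowerbound) auto
qed

end

section \<open>One-dimensional projections determine a law\<close>

text \<open>
  Uniqueness of characteristic functions for the law of \<open>X\<close> under the measure with density \<open>w\<close>. The
  weight is normalized to a probability density; if its total mass is zero, both sides vanish.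
\<close>

lemma weighted_law_unique:
  fixes P Q :: "'a measure" and w X :: "'a \<Rightarrow> real"
  assumes P: "prob_space P" and Q: "prob_space Q"
    and wP: "w \<in> borel_measurable P" and wQ: "w \<in> borel_measurable Q"
    and XP: "X \<in> borel_measurable P" and XQ: "X \<in> borel_measurable Q"
    and w: "\<And>x. 0 \<le> w x" "\<And>x. w x \<le> C"
    and eq: "\<And>s. (CLINT x|P. w x *\<^sub>R iexp (s * X x)) = (CLINT x|Q. w x *\<^sub>R iexp (s * X x))"
    and A: "A \<in> sets borel"
  shows "(\<integral>x. w x * indicator A (X x) \<partial>P) = (\<integral>x. w x * indicator A (X x) \<partial>Q)"
proof -
  define c where "c = (\<integral>x. w x \<partial>P)"
  have cw: "integrable N w" if "prob_space N" "w \<in> borel_measurable N" for N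
  proof -
    interpret prob_space N by fact
    show ?thesis using w that by (intro integrable_const_bound[where B=C]) auto
  qed
  have c0: "c \<ge> 0" unfolding c_def using w by (intro Bochner_Integration.integral_nonneg) auto
  have "complex_of_real (\<integral>x. w x \<partial>P) = complex_of_real (\<integral>x. w x \<partial>Q)"
    using eq[of 0] by (simp add: scaleR_conv_of_real integral_complex_of_real)
  then have cQ: "c = (\<integral>x. w x \<partial>Q)" by (simp add: c_def)
  have main: "real_distribution (distr (density N (\<lambda>x. w x / c)) borel X)
      \<and> (\<forall>s. char (distr (density N (\<lambda>x. w x / c)) borel X) s = (CLINT x|N. w x *\<^sub>R iexp (s * X x)) /\<^sub>R c)
      \<and> (\<integral>x. w x * indicator A (X x) \<partial>N) = c * measure (distr (density N (\<lambda>x. w x / c)) borel X) A"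
    if N: "prob_space N" and [measurable]: "w \<in> borel_measurable N" "X \<in> borel_measurable N"
      and cN: "c = (\<integral>x. w x \<partial>N)" and pos: "c > 0" for N
  proof (intro conjI allI)
    interpret N: prob_space N by (rule N)
    let ?D = "density N (\<lambda>x. w x / c)"
    have "emeasure ?D (space ?D) = (\<integral>\<^sup>+x. ennreal (w x / c) \<partial>N)"
      by (simp add: emeasure_density cong: nn_integral_cong)
    also have "\<dots> = ennreal (\<integral>x. w x / c \<partial>N)"
      using w pos cw[OF N] by (intro nn_integral_eq_integral) auto
    finally have "prob_space ?D" using pos by (intro prob_spaceI) (simp add: cN[symmetric])
    then show "real_distribution (distr ?D borel X)"
      by (intro prob_space.real_distribution_distr) simp_all
    show "char (distr ?D borel X) s = (CLINT x|N. w x *\<^sub>R iexp (s * X x)) /\<^sub>R c" for s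
    proof -
      have "char (distr ?D borel X) s = (CLINT x|?D. iexp (s * X x))"
        unfolding char_def by (subst integral_distr) auto
      also have "\<dots> = (CLINT x|N. (w x / c) *\<^sub>R iexp (s * X x))"
        using w pos by (subst integral_density) auto
      also have "\<dots> = (CLINT x|N. (w x *\<^sub>R iexp (s * X x)) /\<^sub>R c)"
        by (intro Bochner_Integration.integral_cong) (auto simp: divide_inverse mult.commute)
      also have "\<dots> = (CLINT x|N. w x *\<^sub>R iexp (s * X x)) /\<^sub>R c"
        by (rule integral_scaleR_right)
      finally show ?thesis .
    qed
    have "measure (distr ?D borel X) A = measure ?D (X -` A \<inter> space N)"
      using A by (subst measure_distr) auto
    also have "\<dots> = (\<integral>x. indicator (X -` A \<inter> space N) x \<partial>?D)"
      using A by simp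
    also have "\<dots> = (\<integral>x. (w x / c) *\<^sub>R indicator (X -` A \<inter> space N) x \<partial>N)"
      using A w pos by (subst integral_density) auto
    also have "\<dots> = (\<integral>x. (w x * indicator A (X x)) / c \<partial>N)"
      by (intro Bochner_Integration.integral_cong) (auto simp: indicator_def)
    finally show "(\<integral>x. w x * indicator A (X x) \<partial>N) = c * measure (distr ?D borel X) A"
      using pos by simp
  qed
  show ?thesis
  proof (cases "c = 0")
    case True
    have "(\<integral>x. w x * indicator A (X x) \<partial>N) = 0"
      if N: "prob_space N" and [measurable]: "w \<in> borel_measurable N" "X \<in> borel_measurable N"
      and cN: "c = (\<integral>x. w x \<partial>N)" for N
    proof -
      have "AE x in N. w x = 0"
        using integral_nonneg_eq_0_iff_AE[OF cw[OF N]] w cN True by auto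
      then have "(\<integral>x. w x * indicator A (X x) \<partial>N) = (\<integral>x. 0 \<partial>N)"
        using A by (intro integral_cong_AE) auto
      then show ?thesis by simp
    qed
    then show ?thesis using P Q wP wQ XP XQ c_def cQ by simp
  next
    case False
    with c0 have pos: "c > 0" by simp
    note mP = main[OF P wP XP c_def pos] and mQ = main[OF Q wQ XQ cQ pos]
    have "distr (density P (\<lambda>x. w x / c)) borel X = distr (density Q (\<lambda>x. w x / c)) borel X"
    proof (rule Levy_uniqueness)
      show "char (distr (density P (\<lambda>x. w x / c)) borel X) = char (distr (density Q (\<lambda>x. w x / c)) borel X)"
        using mP mQ eq by (simp only: fun_eq_iff) metis
    qed (use mP mQ in auto)
    then show ?thesis using mP mQ by simp
  qed
qed

text \<open>
  The coordinates are treated one after another. For a box in the coordinates \<open>J\<close>, the integrals of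
  its indicator against all characters \<open>iexp (t \<bullet> x)\<close> are shown to agree. For a further coordinate
  \<open>k\<close>, the box indicator times \<open>1 + cos (t \<bullet> x)\<close> is a nonnegative weight under which the characteristic
  function of the \<open>k\<close>-th coordinate is a combination of integrals that are already known, so
  one-dimensional uniqueness allows the indicator of a set of values of that coordinate to be
  inserted; likewise with the sine.
\<close>

theorem cramer_wold:
  fixes P Q :: "(real ^ 'k) measure"
  assumes P: "prob_space P" and Q: "prob_space Q"
    and sets [measurable_cong]: "sets P = sets borel" "sets Q = sets borel"
    and proj: "\<And>a. distr P borel (\<lambda>x. a \<bullet> x) = distr Q borel (\<lambda>x. a \<bullet> x)"
  shows "P = Q"
proof -
  interpret P: prob_space P by (rule P)
  interpret Q: prob_space Q by (rule Q)
  define box :: "'k set \<Rightarrow> ('k \<Rightarrow> real set) \<Rightarrow> real ^ 'k \<Rightarrow> real"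
    where "box J A x = (\<Prod>j\<in>J. indicator (A j) (x $ j))" for J A x
  have box01: "0 \<le> box J A x" "box J A x \<le> 1" for J A x
    by (auto simp: box_def intro!: prod_nonneg prod_le_1)
  have box_m: "box J A \<in> borel_measurable borel" if "\<And>j. j \<in> J \<Longrightarrow> A j \<in> sets borel" for J A
  proof -
    note [measurable] = that
    show ?thesis unfolding box_def by measurable
  qed
  have boxes: "(CLINT x|P. box J A x *\<^sub>R iexp (t \<bullet> x)) = (CLINT x|Q. box J A x *\<^sub>R iexp (t \<bullet> x))"
    if "\<And>j. j \<in> J \<Longrightarrow> A j \<in> sets borel" for J A t
  proof -
    have "finite J" by simp
    from this that show ?thesis
    proof (induction J arbitrary: t rule: finite_induct)
      case empty
      have "(CLINT x|N. iexp (t \<bullet> x)) = char (distr N borel (\<lambda>x. t \<bullet> x)) 1"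
        if [measurable_cong]: "sets N = sets borel" for N :: "(real ^ 'k) measure"
        unfolding char_def by (subst integral_distr) auto
      then show ?case by (simp add: box_def proj sets)
    next
      case (insert k J)
      have Ak: "A k \<in> sets borel" and AJ: "\<And>j. j \<in> J \<Longrightarrow> A j \<in> sets borel" using insert.prems by auto
      note [measurable] = box_m[OF AJ]
      have ins: "box (insert k J) A x = box J A x * indicator (A k) (x $ k)" for x
        using insert.hyps by (simp add: box_def mult.commute)
      have IH: "(CLINT x|P. box J A x *\<^sub>R iexp (u \<bullet> x)) = (CLINT x|Q. box J A x *\<^sub>R iexp (u \<bullet> x))" for u
        by (rule insert.IH[OF AJ])
      have int: "integrable N (\<lambda>x. c * box J A x *\<^sub>R iexp (u \<bullet> x))" if "N = P \<or> N = Q" for N c u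
      proof -
        have "box J A x * norm c \<le> norm c" for x
          using box01[of J A x] by (intro mult_left_le_one_le) auto
        then show ?thesis
          using that box01
          by (auto intro!: P.integrable_const_bound[where B="norm c"] Q.integrable_const_bound[where B="norm c"]
            AE_I2 simp: norm_mult)
      qed
      \<comment> \<open>For the cosine and the sine, the two exponentials only shift the frequency \<open>t\<close>.\<close>
      have weighted: "(\<integral>x. (box J A x * (1 + g (t \<bullet> x))) * indicator (A k) (x $ k) \<partial>P)
          = (\<integral>x. (box J A x * (1 + g (t \<bullet> x))) * indicator (A k) (x $ k) \<partial>Q)"
        if g: "g \<in> borel_measurable borel" "\<And>v. -1 \<le> g v" "\<And>v. g v \<le> 1"
          and gc: "\<And>v. complex_of_real (g v) = \<gamma> * iexp v + \<gamma>' * iexp (- v)" for g :: "real \<Rightarrow> real" and \<gamma> \<gamma>'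
      proof (rule weighted_law_unique[OF P Q _ _ _ _ _ _ _ Ak])
        show "(\<lambda>x. box J A x * (1 + g (t \<bullet> x))) \<in> borel_measurable P" using g(1) by measurable
        show "(\<lambda>x. box J A x * (1 + g (t \<bullet> x))) \<in> borel_measurable Q" using g(1) by measurable
        show "0 \<le> box J A x * (1 + g (t \<bullet> x))" for x
          using box01(1)[of J A x] g(2)[of "t \<bullet> x"] by (intro mult_nonneg_nonneg) auto
        show "box J A x * (1 + g (t \<bullet> x)) \<le> 1 * 2" for x
          using box01[of J A x] g(2)[of "t \<bullet> x"] g(3)[of "t \<bullet> x"] by (intro mult_mono) auto
        fix s
        have split: "(box J A x * (1 + g (t \<bullet> x))) *\<^sub>R iexp (s * x $ k)
          = box J A x *\<^sub>R iexp (axis k s \<bullet> x) + (\<gamma> * box J A x *\<^sub>R iexp ((axis k s + t) \<bullet> x)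
            + \<gamma>' * box J A x *\<^sub>R iexp ((axis k s - t) \<bullet> x))" for x
          by (simp add: scaleR_conv_of_real gc inner_add_left inner_diff_left inner_axis' distrib_left distrib_right exp_add[symmetric] mult_ac)
             (simp add: exp_add[symmetric] algebra_simps)
        have "(CLINT x|N. (box J A x * (1 + g (t \<bullet> x))) *\<^sub>R iexp (s * x $ k))
          = (CLINT x|N. box J A x *\<^sub>R iexp (axis k s \<bullet> x)) + (\<gamma> * (CLINT x|N. box J A x *\<^sub>R iexp ((axis k s + t) \<bullet> x))
            + \<gamma>' * (CLINT x|N. box J A x *\<^sub>R iexp ((axis k s - t) \<bullet> x)))" if N: "N = P \<or> N = Q" for N
        proof -
          have h: "has_bochner_integral N (\<lambda>x. box J A x *\<^sub>R iexp (u \<bullet> x)) (CLINT x|N. box J A x *\<^sub>R iexp (u \<bullet> x))" for u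
            using int[OF N, of 1] by (simp add: has_bochner_integral_iff)
          show ?thesis
            unfolding split
            by (intro has_bochner_integral_integral_eq has_bochner_integral_add has_bochner_integral_mult_right h)
        qed
        then show "(CLINT x|P. (box J A x * (1 + g (t \<bullet> x))) *\<^sub>R iexp (s * x $ k))
          = (CLINT x|Q. (box J A x * (1 + g (t \<bullet> x))) *\<^sub>R iexp (s * x $ k))"
          by (simp only: IH refl disj_not1 simp_thms)
      qed auto
      have rint: "integrable N (\<lambda>x. box (insert k J) A x * h (t \<bullet> x))"
        if "N = P \<or> N = Q" "h \<in> borel_measurable borel" "\<And>v. \<bar>h v\<bar> \<le> 1" for N and h :: "real \<Rightarrow> real"
      proof -
        have m [measurable]: "box (insert k J) A \<in> borel_measurable borel" "h \<in> borel_measurable borel"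
          using box_m[OF insert.prems] that(2) by auto
        have "\<bar>box (insert k J) A x * h (t \<bullet> x)\<bar> \<le> 1" for x
          unfolding abs_mult using box01[of "insert k J" A x] that(3) by (intro mult_le_one) auto
        then show ?thesis
          using that(1) by (auto intro!: P.integrable_const_bound[where B=1] Q.integrable_const_bound[where B=1])
      qed
      have base: "(\<integral>x. box (insert k J) A x \<partial>P) = (\<integral>x. box (insert k J) A x \<partial>Q)"
        using weighted[of "\<lambda>_. 0" 0 0] by (simp add: ins)
      have part: "(\<integral>x. box (insert k J) A x * g (t \<bullet> x) \<partial>P) = (\<integral>x. box (insert k J) A x * g (t \<bullet> x) \<partial>Q)"
        if g: "g \<in> borel_measurable borel" "\<And>v. -1 \<le> g v" "\<And>v. g v \<le> 1"
          and gc: "\<And>v. complex_of_real (g v) = \<gamma> * iexp v + \<gamma>' * iexp (- v)" for g :: "real \<Rightarrow> real" and \<gamma> \<gamma>'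
      proof -
        have ga: "\<bar>g v\<bar> \<le> 1" for v using g by (simp add: abs_le_iff minus_le_iff)
        have eqs: "(box J A x * (1 + g (t \<bullet> x))) * indicator (A k) (x $ k)
            = box (insert k J) A x * 1 + box (insert k J) A x * g (t \<bullet> x)" for x
          by (simp add: ins algebra_simps)
        have "(\<integral>x. (box J A x * (1 + g (t \<bullet> x))) * indicator (A k) (x $ k) \<partial>N)
          = (\<integral>x. box (insert k J) A x \<partial>N) + (\<integral>x. box (insert k J) A x * g (t \<bullet> x) \<partial>N)" if "N = P \<or> N = Q" for N
          unfolding eqs using rint[OF that, of "\<lambda>_. 1"] rint[OF that g(1) ga]
          by (subst Bochner_Integration.integral_add) auto
        then show ?thesis using weighted[OF g gc] base by simp
      qed
      have iexp_plus: "iexp v = complex_of_real (cos v) + \<i> * complex_of_real (sin v)" for v :: real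
        using exp_Euler[of "complex_of_real v"] by (simp only: cos_of_real sin_of_real)
      have iexp_minus: "iexp (- v) = complex_of_real (cos v) - \<i> * complex_of_real (sin v)" for v :: real
        unfolding iexp_plus[of "- v"] by simp
      have cos: "(\<integral>x. box (insert k J) A x * cos (t \<bullet> x) \<partial>P) = (\<integral>x. box (insert k J) A x * cos (t \<bullet> x) \<partial>Q)"
        by (rule part[of cos "1/2" "1/2"]) (simp, simp, simp, simp only: iexp_plus iexp_minus, simp add: field_simps)
      have sin: "(\<integral>x. box (insert k J) A x * sin (t \<bullet> x) \<partial>P) = (\<integral>x. box (insert k J) A x * sin (t \<bullet> x) \<partial>Q)"
        by (rule part[of sin "-\<i>/2" "\<i>/2"]) (simp, simp, simp, simp only: iexp_plus iexp_minus, simp add: field_simps)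
      have "(CLINT x|N. box (insert k J) A x *\<^sub>R iexp (t \<bullet> x))
          = complex_of_real (\<integral>x. box (insert k J) A x * cos (t \<bullet> x) \<partial>N)
            + \<i> * complex_of_real (\<integral>x. box (insert k J) A x * sin (t \<bullet> x) \<partial>N)" if N: "N = P \<or> N = Q" for N
      proof -
        have "(CLINT x|N. box (insert k J) A x *\<^sub>R iexp (t \<bullet> x))
          = (CLINT x|N. complex_of_real (box (insert k J) A x * cos (t \<bullet> x)) + \<i> * complex_of_real (box (insert k J) A x * sin (t \<bullet> x)))"
          by (intro Bochner_Integration.integral_cong)
             (auto simp: exp_Euler cos_of_real sin_of_real scaleR_conv_of_real algebra_simps)
        also have "\<dots> = (CLINT x|N. complex_of_real (box (insert k J) A x * cos (t \<bullet> x)))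
            + (CLINT x|N. \<i> * complex_of_real (box (insert k J) A x * sin (t \<bullet> x)))"
          using rint[OF N, of cos] rint[OF N, of sin]
          by (intro Bochner_Integration.integral_add integrable_mult_right integrable_of_real) auto
        finally show ?thesis by (simp only: integral_complex_of_real integral_mult_right_zero)
      qed
      then show ?case by (simp only: cos sin refl disj_not1 simp_thms)
    qed
  qed
  let ?e = "\<lambda>x::real ^ 'k. \<lambda>i. x $ i"
  have e_m: "?e \<in> measurable N (\<Pi>\<^sub>M i\<in>UNIV. borel)" if [measurable_cong]: "sets N = sets borel" for N :: "(real ^ 'k) measure"
    by (rule measurable_PiM_single') auto
  have v_m: "(\<lambda>f. \<chi> i. f i) \<in> measurable (\<Pi>\<^sub>M i\<in>(UNIV::'k set). borel) (borel :: (real ^ 'k) measure)"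
    by (subst borel_measurable_euclidean_space) (auto simp: Basis_vec_def inner_axis)
  have "distr P (\<Pi>\<^sub>M i\<in>UNIV. borel) ?e = distr Q (\<Pi>\<^sub>M i\<in>UNIV. borel) ?e"
  proof (rule measure_eqI_PiM_finite[where I=UNIV and M="\<lambda>_. borel" and A="\<lambda>_. UNIV"])
    fix A :: "'k \<Rightarrow> real set" assume A: "\<And>i. i \<in> UNIV \<Longrightarrow> A i \<in> sets borel"
    have S: "Pi\<^sub>E UNIV A \<in> sets (\<Pi>\<^sub>M i\<in>UNIV. borel)" using A by (intro sets_PiM_I_finite) auto
    have emb: "emeasure (distr N (\<Pi>\<^sub>M i\<in>UNIV. borel) ?e) (Pi\<^sub>E UNIV A) = ennreal (Re (CLINT x|N. box UNIV A x *\<^sub>R iexp (0 \<bullet> x)))"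
      if N: "prob_space N" "sets N = sets borel" for N
    proof -
      interpret N: prob_space N by (rule N(1))
      let ?B = "?e -` Pi\<^sub>E UNIV A \<inter> space N"
      have B: "?B \<in> sets N" by (rule measurable_sets[OF e_m[OF N(2)] S])
      have "(\<integral>x. box UNIV A x \<partial>N) = (\<integral>x. indicator ?B x \<partial>N)"
        by (intro Bochner_Integration.integral_cong)
           (auto simp: box_def indicator_def PiE_iff prod_zero_iff)
      then have "(\<integral>x. box UNIV A x \<partial>N) = measure N ?B" using B by simp
      moreover have "(CLINT x|N. box UNIV A x *\<^sub>R iexp (0 \<bullet> x)) = complex_of_real (\<integral>x. box UNIV A x \<partial>N)"
        by (simp add: scaleR_conv_of_real integral_complex_of_real)
      ultimately show ?thesis
        using S by (simp add: emeasure_distr e_m[OF N(2)] N.emeasure_eq_measure)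
    qed
    show "emeasure (distr P (\<Pi>\<^sub>M i\<in>UNIV. borel) ?e) (Pi\<^sub>E UNIV A) = emeasure (distr Q (\<Pi>\<^sub>M i\<in>UNIV. borel) ?e) (Pi\<^sub>E UNIV A)"
      unfolding emb[OF P sets(1)] emb[OF Q sets(2)] by (subst boxes) (use A in auto)
  next
    interpret DP: prob_space "distr P (\<Pi>\<^sub>M i\<in>UNIV. borel) ?e" by (rule P.prob_space_distr[OF e_m[OF sets(1)]])
    show "emeasure (distr P (\<Pi>\<^sub>M i\<in>UNIV. borel) ?e) UNIV \<noteq> \<infinity>" by (simp add: DP.emeasure_eq_measure)
    show "range (\<lambda>_::nat. UNIV) \<subseteq> prod_algebra (UNIV::'k set) (\<lambda>_. borel :: real measure)"
      using space_in_prod_algebra[of "UNIV::'k set" "\<lambda>_. borel :: real measure"] by (auto simp: PiE_UNIV_domain)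
  qed (auto simp: space_PiM PiE_UNIV_domain)
  then have "distr (distr P (\<Pi>\<^sub>M i\<in>UNIV. borel) ?e) borel (\<lambda>f. \<chi> i. f i) = distr (distr Q (\<Pi>\<^sub>M i\<in>UNIV. borel) ?e) borel (\<lambda>f. \<chi> i. f i)"
    by simp
  then have "distr P borel (\<lambda>x. x) = distr Q borel (\<lambda>x. x)"
    using e_m[OF sets(1)] e_m[OF sets(2)] v_m by (simp add: distr_distr comp_def)
  moreover have "distr P borel (\<lambda>x. x) = P" "distr Q borel (\<lambda>x. x) = Q"
    using sets by (auto intro!: distr_id2)
  ultimately show ?thesis by simp
qed

section \<open>Gaussian vectors and Gram factorizations of their covariance\<close>

text \<open>
  Cholesky factorization by Schur complements, with singular matrices allowed. If the pivot \<open>d\<close> is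
  zero, then semidefiniteness forces its whole row to vanish, and the convention \<open>x / 0 = 0\<close> makes the
  formulas below cover this case as well.
\<close>

lemma psd_gram:
  fixes S :: "'k \<Rightarrow> 'k \<Rightarrow> real"
  assumes "finite K" and sym: "\<And>i j. S i j = S j i"
    and psd: "\<And>c. 0 \<le> (\<Sum>i\<in>K. \<Sum>j\<in>K. c i * c j * S i j)"
  shows "\<exists>B. \<forall>i\<in>K. \<forall>j\<in>K. S i j = (\<Sum>l\<in>K. B i l * B j l :: real)"
  using assms
proof (induction K arbitrary: S rule: finite_induct)
  case (insert k K)
  define d where "d = S k k"
  have form: "(\<Sum>i\<in>insert k K. \<Sum>j\<in>insert k K. c i * c j * S i j)
      = (\<Sum>i\<in>K. \<Sum>j\<in>K. c i * c j * S i j) + 2 * c k * (\<Sum>i\<in>K. c i * S i k) + (c k)\<^sup>2 * d" for c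
  proof -
    have row: "(\<Sum>j\<in>K. c k * c j * S k j) = c k * (\<Sum>i\<in>K. c i * S i k)"
      unfolding sum_distrib_left using insert.prems(1)[of k] by (intro sum.cong) auto
    have col: "(\<Sum>i\<in>K. c i * c k * S i k) = c k * (\<Sum>i\<in>K. c i * S i k)"
      unfolding sum_distrib_left by (intro sum.cong) auto
    show ?thesis
      using insert.hyps by (simp add: sum.distrib row col d_def[symmetric] power2_eq_square)
  qed
  have form_upd: "(\<Sum>i\<in>K. \<Sum>j\<in>K. (c(k := e)) i * (c(k := e)) j * S i j) = (\<Sum>i\<in>K. \<Sum>j\<in>K. c i * c j * S i j)"
      "(\<Sum>i\<in>K. (c(k := e)) i * S i k) = (\<Sum>i\<in>K. c i * S i k)" for c e
    using insert.hyps by (auto intro!: sum.cong)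
  have quad: "0 \<le> (\<Sum>i\<in>K. \<Sum>j\<in>K. c i * c j * S i j) + 2 * e * (\<Sum>i\<in>K. c i * S i k) + e\<^sup>2 * d" for c e
    using insert.prems(2)[of "c(k := e)"] unfolding form form_upd by simp
  have d0: "0 \<le> d" using quad[of "\<lambda>_. 0" 1] by simp
  have degenerate: "S i k = 0" if "d = 0" "i \<in> K" for i
  proof (rule ccontr)
    assume nz: "S i k \<noteq> 0"
    define c where "c = (\<lambda>j. if j = i then 1 else 0 :: real)"
    have "(\<Sum>j\<in>K. c j * S j k) = S i k"
      using insert.hyps(1) that(2) by (simp add: c_def if_distrib[of "\<lambda>x. x * _"] cong: if_cong)
    moreover define Q where "Q = (\<Sum>i\<in>K. \<Sum>j\<in>K. c i * c j * S i j)"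
    ultimately have "0 \<le> Q + 2 * e * S i k" for e
      using quad[of c e] \<open>d = 0\<close> by simp
    moreover have "2 * (- (1 + Q) / (2 * S i k)) * S i k = - (1 + Q)" using nz by simp
    ultimately have "0 \<le> Q + - (1 + Q)" by metis
    then show False by simp
  qed
  \<comment> \<open>The Schur complement: the quadratic form minimized over its \<open>k\<close>-th variable.\<close>
  define S' where "S' i j = S i j - S i k * S j k / d" for i j
  have "0 \<le> (\<Sum>i\<in>K. \<Sum>j\<in>K. c i * c j * S' i j)" for c
  proof -
    define m where "m = (\<Sum>i\<in>K. c i * S i k)"
    have "(\<Sum>i\<in>K. \<Sum>j\<in>K. c i * c j * (S i k * S j k / d)) = m * m / d"
      unfolding m_def sum_product by (simp add: sum_divide_distrib mult_ac)
    then have "(\<Sum>i\<in>K. \<Sum>j\<in>K. c i * c j * S' i j) = (\<Sum>i\<in>K. \<Sum>j\<in>K. c i * c j * S i j) - m * m / d"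
      by (simp add: S'_def right_diff_distrib sum_subtractf)
    moreover have "0 \<le> (\<Sum>i\<in>K. \<Sum>j\<in>K. c i * c j * S i j) - m * m / d"
    proof (cases "d = 0")
      case True then show ?thesis using quad[of c 0] by simp
    next
      case False
      have "2 * (- m / d) * m + (- m / d)\<^sup>2 * d = - (m * m / d)"
        using False by (simp add: field_simps power2_eq_square)
      then show ?thesis using quad[of c "- m / d"] by (simp add: m_def[symmetric])
    qed
    ultimately show ?thesis by simp
  qed
  moreover have "S' i j = S' j i" for i j using insert.prems(1)[of i j] by (simp add: S'_def mult.commute)
  ultimately obtain B where B: "\<And>i j. i \<in> K \<Longrightarrow> j \<in> K \<Longrightarrow> S' i j = (\<Sum>l\<in>K. B i l * B j l)"
    using insert.IH[of S'] by blast
  define C where "C i l = (if l = k then S i k / sqrt d else if i = k then 0 else B i l)" for i l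
  have "S i j = (\<Sum>l\<in>insert k K. C i l * C j l)" if "i \<in> insert k K" "j \<in> insert k K" for i j
  proof -
    have head: "(\<Sum>l\<in>insert k K. C i l * C j l) = S i k * S j k / d + (\<Sum>l\<in>K. C i l * C j l)"
      using insert.hyps d0 by (simp add: C_def)
    have Skk: "S k k = d" by (simp add: d_def)
    show ?thesis
    proof (cases "i = k \<or> j = k")
      case True
      then have "(\<Sum>l\<in>K. C i l * C j l) = 0"
        using insert.hyps(2) by (intro sum.neutral) (auto simp: C_def)
      moreover have "S i j = S i k * S j k / d"
        using True that degenerate insert.prems(1) Skk by (cases "d = 0") auto
      ultimately show ?thesis using head by simp
    next
      case False
      then have "(\<Sum>l\<in>K. C i l * C j l) = (\<Sum>l\<in>K. B i l * B j l)"
        using insert.hyps(2) by (intro sum.cong) (auto simp: C_def)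
      then show ?thesis using head B[of i j] False that by (simp add: S'_def)
    qed
  qed
  then show ?case by blast
qed simp

lemma normal_law_moments:
  assumes s: "s \<ge> 0" and X [measurable]: "X \<in> borel_measurable M" and law: "distr M borel X = normal_law m s"
  shows "integrable M X" "integrable M (\<lambda>\<omega>. (X \<omega>)\<^sup>2)" "(\<integral>\<omega>. X \<omega> \<partial>M) = m" "(\<integral>\<omega>. (X \<omega> - m)\<^sup>2 \<partial>M) = s\<^sup>2"
proof -
  interpret N: prob_space stdN by (rule prob_stdN)
  have law': "distr M borel X = distr stdN borel (\<lambda>z. m + s * z)"
    using law normal_law_affine[OF s] by simp
  have tr: "integrable M (\<lambda>\<omega>. f (X \<omega>)) \<longleftrightarrow> integrable stdN (\<lambda>z. f (m + s * z))"
      "(\<integral>\<omega>. f (X \<omega>) \<partial>M) = (\<integral>z. f (m + s * z) \<partial>stdN)" if [measurable]: "f \<in> borel_measurable borel" for f :: "real \<Rightarrow> real"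
  proof -
    have "integrable M (\<lambda>\<omega>. f (X \<omega>)) \<longleftrightarrow> integrable (distr M borel X) f" by (subst integrable_distr_eq) auto
    then show "integrable M (\<lambda>\<omega>. f (X \<omega>)) \<longleftrightarrow> integrable stdN (\<lambda>z. f (m + s * z))"
      unfolding law' by (subst (asm) integrable_distr_eq) auto
    have "(\<integral>\<omega>. f (X \<omega>) \<partial>M) = (\<integral>x. f x \<partial>distr M borel X)" by (subst integral_distr) auto
    then show "(\<integral>\<omega>. f (X \<omega>) \<partial>M) = (\<integral>z. f (m + s * z) \<partial>stdN)"
      unfolding law' by (subst (asm) integral_distr) auto
  qed
  show "integrable M X" using tr(1)[of "\<lambda>x. x"] by (simp add: stdN_moments)
  have sq: "(m + s * z)\<^sup>2 = m\<^sup>2 + 2 * m * s * z + s\<^sup>2 * z\<^sup>2" for z by (simp add: power2_eq_square algebra_simps)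
  show "integrable M (\<lambda>\<omega>. (X \<omega>)\<^sup>2)" using tr(1)[of "\<lambda>x. x\<^sup>2"] by (simp add: sq stdN_moments)
  show "(\<integral>\<omega>. X \<omega> \<partial>M) = m" using tr(2)[of "\<lambda>x. x"] N.prob_space by (simp add: stdN_moments)
  show "(\<integral>\<omega>. (X \<omega> - m)\<^sup>2 \<partial>M) = s\<^sup>2" using tr(2)[of "\<lambda>x. (x - m)\<^sup>2"] by (simp add: power_mult_distrib stdN_moments)
qed

text \<open>
  The projections are square integrable, so the covariance matrix exists; it is positive
  semidefinite as a matrix of second moments, and a Gram factor \<open>B\<close> of it expresses the variances of all
  projections.
\<close>

lemma gaussian_vector_factor:
  fixes X :: "'a \<Rightarrow> real ^ 'k"
  assumes M: "prob_space M" and X: "gaussian_vector M X"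
  obtains B :: "'k \<Rightarrow> 'k \<Rightarrow> real" where
    "\<And>a. distr M borel (\<lambda>\<omega>. a \<bullet> X \<omega>) = normal_law (a \<bullet> (\<integral>\<omega>. X \<omega> \<partial>M)) (L2_set (\<lambda>l. \<Sum>k\<in>UNIV. a $ k * B k l) UNIV)"
    "\<And>k. std_dev M X $ k = L2_set (B k) UNIV"
proof -
  interpret prob_space M by (rule M)
  define \<mu> where "\<mu> = (\<integral>\<omega>. X \<omega> \<partial>M)"
  have X_m [measurable]: "X \<in> borel_measurable M" using X by (simp add: gaussian_vector_def)
  have proj: "\<exists>m s. s \<ge> 0 \<and> distr M borel (\<lambda>\<omega>. a \<bullet> X \<omega>) = normal_law m s" for a
    using X by (auto simp: gaussian_vector_def)
  have int: "integrable M (\<lambda>\<omega>. a \<bullet> X \<omega>)" "integrable M (\<lambda>\<omega>. (a \<bullet> X \<omega>)\<^sup>2)" for a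
    using proj[of a] normal_law_moments[of _ "\<lambda>\<omega>. a \<bullet> X \<omega>" M] by auto
  have "integrable M (\<lambda>\<omega>. \<Sum>b\<in>Basis. (b \<bullet> X \<omega>) *\<^sub>R b)" using int by auto
  moreover have "(\<Sum>b\<in>Basis. (b \<bullet> X \<omega>) *\<^sub>R b) = X \<omega>" for \<omega>
    by (subst inner_commute) (rule euclidean_representation)
  ultimately have X_int: "integrable M X" by simp
  have mean: "(\<integral>\<omega>. a \<bullet> X \<omega> \<partial>M) = a \<bullet> \<mu>" for a
    unfolding \<mu>_def by (rule integral_inner_right) (rule X_int)
  have coord_int: "integrable M (\<lambda>\<omega>. X \<omega> $ k)" "integrable M (\<lambda>\<omega>. (X \<omega> $ k)\<^sup>2)"
    and coord_mean: "(\<integral>\<omega>. X \<omega> $ k \<partial>M) = \<mu> $ k" for k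
    using int[of "axis k 1"] mean[of "axis k 1"] by (simp_all add: inner_axis')
  define D where "D k \<omega> = X \<omega> $ k - \<mu> $ k" for k \<omega>
  define S where "S i j = (\<integral>\<omega>. D i \<omega> * D j \<omega> \<partial>M)" for i j
  have DD: "integrable M (\<lambda>\<omega>. D i \<omega> * D j \<omega>)" for i j
  proof (rule Bochner_Integration.integrable_bound)
    show "integrable M (\<lambda>\<omega>. (D i \<omega>)\<^sup>2 + (D j \<omega>)\<^sup>2)"
      unfolding D_def power2_diff using coord_int by (intro Bochner_Integration.integrable_add Bochner_Integration.integrable_diff) auto
    show "(\<lambda>\<omega>. D i \<omega> * D j \<omega>) \<in> borel_measurable M"
      unfolding D_def using coord_int by (intro borel_measurable_times borel_measurable_diff borel_measurable_integrable) auto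
    show "AE \<omega> in M. norm (D i \<omega> * D j \<omega>) \<le> norm ((D i \<omega>)\<^sup>2 + (D j \<omega>)\<^sup>2)"
    proof (rule AE_I2)
      fix \<omega>
      have "2 * (\<bar>D i \<omega>\<bar> * \<bar>D j \<omega>\<bar>) \<le> (D i \<omega>)\<^sup>2 + (D j \<omega>)\<^sup>2"
        using sum_squares_bound[of "\<bar>D i \<omega>\<bar>" "\<bar>D j \<omega>\<bar>"] by simp
      moreover have "0 \<le> \<bar>D i \<omega>\<bar> * \<bar>D j \<omega>\<bar>" by simp
      ultimately have "\<bar>D i \<omega>\<bar> * \<bar>D j \<omega>\<bar> \<le> (D i \<omega>)\<^sup>2 + (D j \<omega>)\<^sup>2" by linarith
      then show "norm (D i \<omega> * D j \<omega>) \<le> norm ((D i \<omega>)\<^sup>2 + (D j \<omega>)\<^sup>2)"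
        by (simp add: abs_mult)
    qed
  qed
  have quad: "(\<integral>\<omega>. (\<Sum>k\<in>UNIV. c k * D k \<omega>)\<^sup>2 \<partial>M) = (\<Sum>i\<in>UNIV. \<Sum>j\<in>UNIV. c i * c j * S i j)" for c
  proof -
    have "(\<Sum>k\<in>UNIV. c k * D k \<omega>)\<^sup>2 = (\<Sum>i\<in>UNIV. \<Sum>j\<in>UNIV. c i * c j * (D i \<omega> * D j \<omega>))" for \<omega>
      by (simp add: power2_eq_square sum_product mult_ac)
    then show ?thesis by (simp add: DD S_def)
  qed
  have "\<exists>B. \<forall>i\<in>UNIV. \<forall>j\<in>UNIV. S i j = (\<Sum>l\<in>(UNIV::'k set). B i l * B j l :: real)"
  proof (rule psd_gram)
    show "0 \<le> (\<Sum>i\<in>UNIV. \<Sum>j\<in>UNIV. c i * c j * S i j)" for c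
      unfolding quad[symmetric] by (intro Bochner_Integration.integral_nonneg) auto
  qed (auto simp: S_def mult.commute)
  then obtain B where B: "\<And>i j. S i j = (\<Sum>l\<in>(UNIV::'k set). B i l * B j l)" by auto
  show ?thesis
  proof (rule that[of B])
    fix a :: "real ^ 'k"
    obtain m s where s: "s \<ge> 0" and law: "distr M borel (\<lambda>\<omega>. a \<bullet> X \<omega>) = normal_law m s" using proj by blast
    have am: "(\<lambda>\<omega>. a \<bullet> X \<omega>) \<in> borel_measurable M" by measurable
    note mom = normal_law_moments[OF s am law]
    have m: "m = a \<bullet> \<mu>" using mom(3) mean by simp
    have "s\<^sup>2 = (\<integral>\<omega>. (a \<bullet> X \<omega> - a \<bullet> \<mu>)\<^sup>2 \<partial>M)" using mom(4) m by simp
    also have "\<dots> = (\<integral>\<omega>. (\<Sum>k\<in>UNIV. a $ k * D k \<omega>)\<^sup>2 \<partial>M)"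
      by (simp add: D_def inner_vec_def sum_subtractf right_diff_distrib)
    also have "\<dots> = (\<Sum>i\<in>UNIV. \<Sum>j\<in>UNIV. a $ i * a $ j * (\<Sum>l\<in>UNIV. B i l * B j l))"
      by (simp add: quad B)
    also have "\<dots> = (\<Sum>i\<in>UNIV. \<Sum>j\<in>UNIV. \<Sum>l\<in>UNIV. (a $ i * B i l) * (a $ j * B j l))"
      by (simp add: sum_distrib_left mult_ac)
    also have "\<dots> = (\<Sum>l\<in>UNIV. \<Sum>i\<in>UNIV. \<Sum>j\<in>UNIV. (a $ i * B i l) * (a $ j * B j l))"
      by (subst (2) sum.swap, subst sum.swap) (rule refl)
    also have "\<dots> = (L2_set (\<lambda>l. \<Sum>k\<in>UNIV. a $ k * B k l) UNIV)\<^sup>2"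
    proof -
      have "(\<Sum>l\<in>UNIV. \<Sum>i\<in>UNIV. \<Sum>j\<in>UNIV. (a $ i * B i l) * (a $ j * B j l)) = (\<Sum>l\<in>UNIV. (\<Sum>k\<in>UNIV. a $ k * B k l)\<^sup>2)"
        by (simp add: power2_eq_square sum_product)
      then show ?thesis by (simp add: L2_set_def sum_nonneg)
    qed
    finally have "s = L2_set (\<lambda>l. \<Sum>k\<in>UNIV. a $ k * B k l) UNIV"
      by (rule power2_eq_imp_eq[OF _ s L2_set_nonneg])
    then show "distr M borel (\<lambda>\<omega>. a \<bullet> X \<omega>) = normal_law (a \<bullet> (\<integral>\<omega>. X \<omega> \<partial>M)) (L2_set (\<lambda>l. \<Sum>k\<in>UNIV. a $ k * B k l) UNIV)"
      using law m by (simp add: \<mu>_def)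
  next
    fix k
    have "(\<integral>\<omega>. (D k \<omega>)\<^sup>2 \<partial>M) = (\<Sum>l\<in>UNIV. (B k l)\<^sup>2)"
      using B[of k k] by (simp add: S_def power2_eq_square)
    then show "std_dev M X $ k = L2_set (B k) UNIV"
      by (simp add: std_dev_def L2_set_def coord_mean D_def)
  qed
qed

section \<open>The law of a Gaussian sample\<close>

text \<open>
  The affine image \<open>\<mu> + B g\<^sub>i\<close> of the \<open>i\<close>-th block \<open>g\<^sub>i = g (i, \<cdot>)\<close> of a family of standard normal
  coordinates.
\<close>

definition gauss_block :: "('k \<Rightarrow> 'k \<Rightarrow> real) \<Rightarrow> real ^ 'k \<Rightarrow> nat \<Rightarrow> (nat \<times> 'k \<Rightarrow> real) \<Rightarrow> real ^ 'k" where
  "gauss_block B \<mu> i g = \<mu> + (\<chi> k. \<Sum>l\<in>UNIV. B k l * g (i, l))"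

abbreviation block_index :: "nat \<Rightarrow> (nat \<times> 'k) set" where
  "block_index n \<equiv> {1..n} \<times> UNIV"

lemma gauss_block_measurable:
  assumes "{i} \<times> UNIV \<subseteq> I"
  shows "gauss_block B \<mu> i \<in> borel_measurable (\<Pi>\<^sub>M j\<in>I. borel)"
proof -
  have "(\<lambda>g. gauss_block B \<mu> i g \<bullet> b) \<in> borel_measurable (\<Pi>\<^sub>M j\<in>I. borel)" if "b \<in> Basis" for b
  proof -
    obtain k where b: "b = axis k 1" using \<open>b \<in> Basis\<close> by (auto simp: Basis_vec_def)
    have "(\<lambda>g. \<mu> $ k + (\<Sum>l\<in>UNIV. B k l * g (i, l))) \<in> borel_measurable (\<Pi>\<^sub>M j\<in>I. borel)"
      using assms by (intro borel_measurable_add borel_measurable_const borel_measurable_sum borel_measurable_times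
          measurable_component_singleton) auto
    then show ?thesis by (simp add: b inner_axis gauss_block_def)
  qed
  then show ?thesis by (subst borel_measurable_euclidean_space) blast
qed

lemma gauss_block_law:
  fixes B :: "'k::finite \<Rightarrow> 'k \<Rightarrow> real"
  assumes i: "i \<in> {1..n}"
  shows "distr (std_gauss (block_index n)) borel (\<lambda>g. a \<bullet> gauss_block B \<mu> i g)
    = normal_law (a \<bullet> \<mu>) (L2_set (\<lambda>l. \<Sum>k\<in>UNIV. a $ k * B k l) UNIV)"
proof -
  let ?I = "block_index n :: (nat \<times> 'k) set"
  define c :: "nat \<times> 'k \<Rightarrow> real" where "c p = (if fst p = i then \<Sum>k\<in>UNIV. a $ k * B k (snd p) else 0)" for p
  have only_i: "(\<Sum>p\<in>?I. if fst p = i then f (snd p) else 0) = (\<Sum>l\<in>UNIV. f l)" for f :: "'k \<Rightarrow> real"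
  proof -
    have "(\<Sum>p\<in>?I. if fst p = i then f (snd p) else 0) = (\<Sum>j\<in>{1..n}. \<Sum>l\<in>UNIV. if j = i then f l else 0)"
      by (simp add: sum.cartesian_product split_beta)
    also have "\<dots> = (\<Sum>j\<in>{1..n}. if j = i then (\<Sum>l\<in>UNIV. f l) else 0)"
      by (intro sum.cong) auto
    also have "\<dots> = (\<Sum>l\<in>UNIV. f l)" using i by simp
    finally show ?thesis .
  qed
  have "a \<bullet> gauss_block B \<mu> i g = a \<bullet> \<mu> + (\<Sum>p\<in>?I. c p * g p)" for g
  proof -
    have "(\<Sum>p\<in>?I. c p * g p) = (\<Sum>p\<in>?I. if fst p = i then (\<Sum>k\<in>UNIV. a $ k * B k (snd p)) * g (i, snd p) else 0)"
      by (intro sum.cong) (auto simp: c_def)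
    also have "\<dots> = (\<Sum>l\<in>UNIV. (\<Sum>k\<in>UNIV. a $ k * B k l) * g (i, l))" by (rule only_i)
    also have "\<dots> = (\<Sum>k\<in>UNIV. \<Sum>l\<in>UNIV. a $ k * B k l * g (i, l))"
      by (subst sum.swap) (simp add: sum_distrib_right)
    also have "\<dots> = a \<bullet> (\<chi> k. \<Sum>l\<in>UNIV. B k l * g (i, l))"
      by (simp add: inner_vec_def sum_distrib_left mult.assoc)
    finally show ?thesis by (simp add: gauss_block_def inner_add_right)
  qed
  then have "distr (std_gauss ?I) borel (\<lambda>g. a \<bullet> gauss_block B \<mu> i g)
     = distr (std_gauss ?I) borel (\<lambda>g. a \<bullet> \<mu> + (\<Sum>p\<in>?I. c p * g p))" by simp
  also have "\<dots> = distr stdN borel (\<lambda>x. a \<bullet> \<mu> + L2_set c ?I * x)"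
    by (rule std_gauss_linear_distr[where f="\<lambda>x. a \<bullet> \<mu> + x"]) auto
  also have "\<dots> = normal_law (a \<bullet> \<mu>) (L2_set c ?I)"
    by (simp add: normal_law_affine L2_set_nonneg)
  also have "L2_set c ?I = L2_set (\<lambda>l. \<Sum>k\<in>UNIV. a $ k * B k l) UNIV"
  proof -
    have "(\<Sum>p\<in>?I. (c p)\<^sup>2) = (\<Sum>p\<in>?I. if fst p = i then (\<Sum>k\<in>UNIV. a $ k * B k (snd p))\<^sup>2 else 0)"
      by (intro sum.cong) (auto simp: c_def)
    then show ?thesis unfolding L2_set_def using only_i[of "\<lambda>l. (\<Sum>k\<in>UNIV. a $ k * B k l)\<^sup>2"] by (simp only:)
  qed
  finally show ?thesis .
qed

lemma gauss_block_indep: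
  fixes B :: "'k::finite \<Rightarrow> 'k \<Rightarrow> real"
  shows "prob_space.indep_vars (std_gauss (block_index n)) (\<lambda>_. borel) (gauss_block B \<mu>) {1..n}"
proof -
  let ?I = "block_index n :: (nat \<times> 'k) set"
  interpret P: prob_space "std_gauss ?I" by (rule prob_std_gauss)
  have "P.indep_vars (\<lambda>i. \<Pi>\<^sub>M p\<in>{i} \<times> UNIV. stdN) (\<lambda>i g. restrict (\<lambda>p. g p) ({i} \<times> UNIV)) {1..n}"
    by (rule P.indep_vars_restrict[OF std_gauss_indep_coords]) (auto simp: disjoint_family_on_def)
  then have "P.indep_vars (\<lambda>_. borel) (\<lambda>i g. gauss_block B \<mu> i (restrict g ({i} \<times> UNIV))) {1..n}"
    by (rule P.indep_vars_compose2)
       (simp add: measurable_cong_sets[OF sets_std_gauss refl] gauss_block_measurable)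
  moreover have "gauss_block B \<mu> i (restrict g ({i} \<times> UNIV)) = gauss_block B \<mu> i g" for i g
    by (simp add: gauss_block_def)
  ultimately show ?thesis by (simp only:)
qed

text \<open>
  Both sides are product measures, and their factors agree because all their projections do.
\<close>

theorem iid_gaussian_sample_law:
  fixes \<mu> :: "real ^ 'k"
  assumes M: "prob_space M" and n: "n \<ge> 1" and Y: "iid_gaussian_sample M n \<mu> Y"
  obtains B :: "'k \<Rightarrow> 'k \<Rightarrow> real" where
    "\<And>k. std_dev M (Y 1) $ k = L2_set (B k) UNIV"
    "distr M (\<Pi>\<^sub>M i\<in>{1..n}. borel) (joint n Y)
      = distr (std_gauss (block_index n)) (\<Pi>\<^sub>M i\<in>{1..n}. borel) (joint n (gauss_block B \<mu>))"
proof -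
  interpret M: prob_space M by (rule M)
  let ?\<Gamma> = "std_gauss (block_index n) :: (nat \<times> 'k \<Rightarrow> real) measure"
  interpret P: prob_space ?\<Gamma> by (rule prob_std_gauss)
  have ne: "{1..n} \<noteq> {}" and one: "1 \<in> {1..n}" using n by auto
  note Y' = Y[unfolded iid_gaussian_sample_def]
  have ind: "M.indep_vars (\<lambda>_. borel) Y {1..n}" using Y' by blast
  have same: "distr M borel (Y i) = distr M borel (Y 1)" if "i \<in> {1..n}" for i
    using Y' one that by blast
  have gv: "gaussian_vector M (Y i)" and mean: "(\<integral>\<omega>. Y i \<omega> \<partial>M) = \<mu>" if "i \<in> {1..n}" for i
    using Y' that by blast+
  have Y_m: "Y i \<in> borel_measurable M" if "i \<in> {1..n}" for i
    using gv[OF that] by (simp add: gaussian_vector_def)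
  obtain B :: "'k \<Rightarrow> 'k \<Rightarrow> real" where law: "\<And>a. distr M borel (\<lambda>\<omega>. a \<bullet> Y 1 \<omega>) = normal_law (a \<bullet> (\<integral>\<omega>. Y 1 \<omega> \<partial>M)) (L2_set (\<lambda>l. \<Sum>k\<in>UNIV. a $ k * B k l) UNIV)"
    and sd: "\<And>k. std_dev M (Y 1) $ k = L2_set (B k) UNIV"
    by (rule gaussian_vector_factor[OF M gv[OF one]]) (rule that)
  have block_m: "gauss_block B \<mu> i \<in> borel_measurable ?\<Gamma>" if "i \<in> {1..n}" for i
    using that by (subst measurable_cong_sets[OF sets_std_gauss refl]) (rule gauss_block_measurable, auto)
  have marg: "distr M borel (Y i) = distr ?\<Gamma> borel (gauss_block B \<mu> i)" if i: "i \<in> {1..n}" for i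
  proof (rule cramer_wold)
    show "prob_space (distr M borel (Y i))" by (rule M.prob_space_distr[OF Y_m[OF i]])
    show "prob_space (distr ?\<Gamma> borel (gauss_block B \<mu> i))" by (rule P.prob_space_distr[OF block_m[OF i]])
    fix a :: "real ^ 'k"
    have "distr (distr M borel (Y i)) borel (\<lambda>x. a \<bullet> x) = distr (distr M borel (Y 1)) borel (\<lambda>x. a \<bullet> x)"
      using same[OF i] by simp
    also have "\<dots> = distr M borel (\<lambda>\<omega>. a \<bullet> Y 1 \<omega>)"
      using Y_m[OF one] by (subst distr_distr) (auto simp: comp_def)
    also have "\<dots> = distr ?\<Gamma> borel (\<lambda>g. a \<bullet> gauss_block B \<mu> i g)"
      by (simp only: law mean[OF one] gauss_block_law[OF i])
    also have "\<dots> = distr (distr ?\<Gamma> borel (gauss_block B \<mu> i)) borel (\<lambda>x. a \<bullet> x)"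
      using block_m[OF i] by (subst distr_distr) (auto simp: comp_def)
    finally show "distr (distr M borel (Y i)) borel (\<lambda>x. a \<bullet> x) = distr (distr ?\<Gamma> borel (gauss_block B \<mu> i)) borel (\<lambda>x. a \<bullet> x)" .
  qed auto
  have "distr M (\<Pi>\<^sub>M i\<in>{1..n}. borel) (joint n Y) = (\<Pi>\<^sub>M i\<in>{1..n}. distr M borel (Y i))"
    unfolding joint_def[abs_def] by (rule iffD1[OF M.indep_vars_iff_distr_eq_PiM'[OF ne Y_m] ind])
  also have "\<dots> = (\<Pi>\<^sub>M i\<in>{1..n}. distr ?\<Gamma> borel (gauss_block B \<mu> i))"
    by (intro PiM_cong refl marg)
  also have "\<dots> = distr ?\<Gamma> (\<Pi>\<^sub>M i\<in>{1..n}. borel) (joint n (gauss_block B \<mu>))"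
    unfolding joint_def[abs_def]
    by (rule iffD1[OF P.indep_vars_iff_distr_eq_PiM'[OF ne block_m] gauss_block_indep, symmetric])
  finally show ?thesis using sd by (intro that[of B])
qed

section \<open>Subadditive functionals and functions of the sample\<close>

lemma enn2real_ge_1: "1 \<le> p \<Longrightarrow> p \<noteq> \<infinity> \<Longrightarrow> 1 \<le> enn2real p"
  using enn2real_mono[of 1 p] by (simp add: top.not_eq_extremum)

lemma lp_norm_nonneg: "0 \<le> lp_norm p (x :: real ^ 'k)"
  by (simp add: lp_norm_def infnorm_pos_le)

lemma lp_norm_mono:
  fixes x y :: "real ^ 'k"
  assumes p: "1 \<le> p" and le: "\<And>k. \<bar>x $ k\<bar> \<le> \<bar>y $ k\<bar>"
  shows "lp_norm p x \<le> lp_norm p y"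
proof (cases "p = \<infinity>")
  case True
  have "infnorm x \<le> infnorm y"
    unfolding infnorm_cart[of x] using le component_le_infnorm_cart[of y]
    by (intro cSup_least) (auto intro: order_trans)
  then show ?thesis using True by (simp add: lp_norm_def)
next
  case False
  then have "1 \<le> enn2real p" using p by (rule enn2real_ge_1[rotated])
  then show ?thesis using False le
    by (auto simp: lp_norm_def intro!: powr_mono2 sum_mono sum_nonneg)
qed

lemma lp_norm_scaleR:
  fixes x :: "real ^ 'k"
  assumes p: "1 \<le> p"
  shows "lp_norm p (c *\<^sub>R x) = \<bar>c\<bar> * lp_norm p x"
proof (cases "p = \<infinity>")
  case False
  then have r: "1 \<le> enn2real p" using p by (rule enn2real_ge_1[rotated])
  have "(\<Sum>k\<in>UNIV. \<bar>(c *\<^sub>R x) $ k\<bar> powr enn2real p) = \<bar>c\<bar> powr enn2real p * (\<Sum>k\<in>UNIV. \<bar>x $ k\<bar> powr enn2real p)"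
    by (simp add: abs_mult powr_mult sum_distrib_left)
  then show ?thesis using False r
    by (simp add: lp_norm_def powr_mult sum_nonneg powr_powr)
qed (simp add: lp_norm_def infnorm_mul)

lemma lp_norm_pos:
  fixes x :: "real ^ 'k"
  assumes p: "1 \<le> p" and x: "x \<noteq> 0"
  shows "0 < lp_norm p x"
proof (cases "p = \<infinity>")
  case True
  then show ?thesis using x by (simp add: lp_norm_def infnorm_pos_lt)
next
  case False
  obtain k where "x $ k \<noteq> 0" using x by (auto simp: vec_eq_iff)
  then have "0 < (\<Sum>k\<in>UNIV. \<bar>x $ k\<bar> powr enn2real p)"
    by (intro sum_pos2[where i=k]) auto
  then show ?thesis using False by (simp add: lp_norm_def)
qed

lemma lp_norm_zero: "1 \<le> p \<Longrightarrow> lp_norm p (0 :: real ^ 'k) = 0"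
  using lp_norm_scaleR[of p 0 0] by simp

lemma lp_norm_le_norm:
  fixes x :: "real ^ 'k"
  assumes p: "1 \<le> p"
  shows "lp_norm p x \<le> norm x * lp_norm p (1 :: real ^ 'k)"
proof -
  have "lp_norm p x \<le> lp_norm p (norm x *\<^sub>R (1 :: real ^ 'k))"
    using component_le_norm_cart[of x] by (intro lp_norm_mono[OF p]) auto
  then show ?thesis by (simp add: lp_norm_scaleR[OF p])
qed

locale subadditive_functional =
  fixes p :: ennreal and \<phi> :: "real ^ 'k \<Rightarrow> real"
  assumes p: "1 \<le> p"
    and subadd: "\<phi> (x + y) \<le> \<phi> x + \<phi> y"
    and bound: "\<bar>\<phi> x\<bar> \<le> lp_norm p x"
begin

lemma lipschitz: "\<bar>\<phi> x - \<phi> y\<bar> \<le> lp_norm p (x - y)"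
proof -
  have "\<phi> x - \<phi> y \<le> \<phi> (x - y)" using subadd[of "x - y" y] by simp
  moreover have "\<phi> y - \<phi> x \<le> \<phi> (y - x)" using subadd[of "y - x" x] by simp
  moreover have "lp_norm p (y - x) = lp_norm p (x - y)"
    using lp_norm_scaleR[OF p, of "-1" "x - y"] by simp
  ultimately show ?thesis using bound[of "x - y"] bound[of "y - x"] by linarith
qed

lemma bound_norm: "\<bar>\<phi> x\<bar> \<le> norm x * lp_norm p (1 :: real ^ 'k)"
  using bound lp_norm_le_norm[OF p] by (rule order_trans)

lemma borel_measurable [measurable]: "\<phi> \<in> borel_measurable borel"
proof (intro borel_measurable_continuous_onI continuous_at_imp_continuous_on ballI)
  fix x :: "real ^ 'k"
  have lim: "((\<lambda>y. norm (y - x) * lp_norm p (1 :: real ^ 'k)) \<longlongrightarrow> 0) (at x)"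
    by (auto intro!: tendsto_eq_intros)
  have le: "norm (\<phi> y - \<phi> x) \<le> norm (y - x) * lp_norm p (1 :: real ^ 'k)" for y
    unfolding real_norm_def using lipschitz lp_norm_le_norm[OF p] by (rule order_trans)
  have "((\<lambda>y. \<phi> y - \<phi> x) \<longlongrightarrow> 0) (at x)"
    by (rule Lim_null_comparison[OF _ lim]) (rule always_eventually, rule allI, rule le)
  then show "isCont \<phi> x" by (unfold isCont_def LIM_zero_iff)
qed

end

text \<open>
  The constants \<open>\<mu>\<close> cancel. The \<open>k\<close>-th component of the combination is the inner product of the
  \<open>k\<close>-th row of \<open>B\<close>, of norm \<open>\<sigma> $ k\<close>, with the same combination of the differences of the blocks of
  \<open>g\<close> and \<open>g'\<close>.
\<close>

lemma lp_norm_block_combination: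
  fixes B :: "'k::finite \<Rightarrow> 'k \<Rightarrow> real" and \<sigma> \<mu> :: "real ^ 'k"
  assumes p: "1 \<le> p" and \<sigma>: "\<And>k. \<sigma> $ k = L2_set (B k) UNIV"
  shows "lp_norm p (\<Sum>i=1..n. v i *\<^sub>R gauss_block B \<mu> i g - v i *\<^sub>R gauss_block B \<mu> i g')
    \<le> L2_set (\<lambda>l. \<Sum>i=1..n. v i * (g (i, l) - g' (i, l))) UNIV * lp_norm p \<sigma>"
    (is "lp_norm p ?x \<le> L2_set ?u UNIV * _")
proof -
  have "?x $ k = (\<Sum>l\<in>UNIV. B k l * ?u l)" for k
  proof -
    have "?x $ k = (\<Sum>i=1..n. \<Sum>l\<in>UNIV. B k l * (v i * (g (i, l) - g' (i, l))))"
      by (simp add: gauss_block_def sum_distrib_left right_diff_distrib sum_subtractf algebra_simps)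
    also have "\<dots> = (\<Sum>l\<in>UNIV. B k l * ?u l)"
      by (subst sum.swap) (simp add: sum_distrib_left)
    finally show ?thesis .
  qed
  moreover have "\<bar>\<Sum>l\<in>UNIV. B k l * ?u l\<bar> \<le> L2_set (B k) UNIV * L2_set ?u UNIV" for k
  proof -
    have "\<bar>\<Sum>l\<in>UNIV. B k l * ?u l\<bar> \<le> (\<Sum>l\<in>UNIV. \<bar>B k l\<bar> * \<bar>?u l\<bar>)"
      unfolding abs_mult[symmetric] by (rule sum_abs)
    also have "\<dots> \<le> L2_set (B k) UNIV * L2_set ?u UNIV" by (rule L2_set_mult_ineq)
    finally show ?thesis .
  qed
  ultimately have "lp_norm p ?x \<le> lp_norm p (L2_set ?u UNIV *\<^sub>R \<sigma>)"
    by (intro lp_norm_mono[OF p]) (simp add: \<sigma> abs_mult L2_set_nonneg mult.commute)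
  then show ?thesis by (simp add: lp_norm_scaleR[OF p] L2_set_nonneg)
qed

lemma (in l2_lipschitz) uminus: "l2_lipschitz I (\<lambda>x. - F x) L"
proof
  show "\<bar>- F x - - F y\<bar> \<le> L * L2_set (\<lambda>i. x i - y i) I" for x y
    using lipschitz[of x y] by linarith
qed (auto simp: finite_I L_pos measurable_F)

lemma prob_less_of_ge:
  assumes "prob_space M" and [measurable]: "X \<in> borel_measurable M"
    and "measure M {\<omega> \<in> space M. c \<le> X \<omega>} \<le> \<alpha>"
  shows "1 - \<alpha> \<le> measure M {\<omega> \<in> space M. X \<omega> < (c::real)}"
proof -
  interpret prob_space M by fact
  have "{\<omega> \<in> space M. X \<omega> < c} = space M - {\<omega> \<in> space M. c \<le> X \<omega>}" by auto
  then show ?thesis using assms(3) prob_compl[of "{\<omega> \<in> space M. c \<le> X \<omega>}"] by simp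
qed

text \<open>
  Concentration for functions of the sample, transferred through the equality of laws. The lower
  deviations are upper deviations of the negated function.
\<close>

theorem sample_concentration:
  fixes h :: "(nat \<Rightarrow> real ^ 'k) \<Rightarrow> real" and B :: "'k \<Rightarrow> 'k \<Rightarrow> real"
  assumes M: "prob_space M" and Y: "joint n Y \<in> measurable M (\<Pi>\<^sub>M i\<in>{1..n}. borel)"
    and law: "distr M (\<Pi>\<^sub>M i\<in>{1..n}. borel) (joint n Y)
      = distr (std_gauss (block_index n)) (\<Pi>\<^sub>M i\<in>{1..n}. borel) (joint n (gauss_block B \<mu>))"
    and h [measurable]: "h \<in> borel_measurable (\<Pi>\<^sub>M i\<in>{1..n}. borel)"
    and lip: "\<And>g g'. \<bar>h (joint n (gauss_block B \<mu>) g) - h (joint n (gauss_block B \<mu>) g')\<bar>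
        \<le> L * L2_set (\<lambda>j. g j - g' j) (block_index n)"
    and L: "0 < L" and \<alpha>: "0 < \<alpha>" "\<alpha> < 1"
  shows "measure M {\<omega> \<in> space M. h (joint n Y \<omega>) < (\<integral>\<omega>. h (joint n Y \<omega>) \<partial>M) + L * normal_quantile (\<alpha> / 2)} \<ge> 1 - \<alpha>"
    and "measure M {\<omega> \<in> space M. h (joint n Y \<omega>) > (\<integral>\<omega>. h (joint n Y \<omega>) \<partial>M) - L * normal_quantile (\<alpha> / 2)} \<ge> 1 - \<alpha>"
proof -
  let ?I = "block_index n :: (nat \<times> 'k) set"
  let ?\<Gamma> = "std_gauss ?I"
  let ?T = "joint n (gauss_block B \<mu>)"
  let ?q = "normal_quantile (\<alpha> / 2)"
  have T: "?T \<in> measurable (\<Pi>\<^sub>M j\<in>?I. borel) (\<Pi>\<^sub>M i\<in>{1..n}. borel)"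
    unfolding joint_def[abs_def] by (intro measurable_restrict gauss_block_measurable) auto
  have T' [measurable]: "?T \<in> measurable ?\<Gamma> (\<Pi>\<^sub>M i\<in>{1..n}. borel)"
    using T by (subst measurable_cong_sets[OF sets_std_gauss refl])
  note [measurable] = Y
  interpret H: l2_lipschitz ?I "\<lambda>g. h (?T g)" L
    by unfold_locales (use lip L measurable_compose[OF T h] in auto)
  have q: "?q > 0" "2 * normal_tail ?q = \<alpha>"
    using normal_quantile_pos[of "\<alpha> / 2"] normal_tail_quantile[of "\<alpha> / 2"] \<alpha> by auto
  have mean: "(\<integral>\<omega>. h (joint n Y \<omega>) \<partial>M) = (\<integral>g. h (?T g) \<partial>?\<Gamma>)"
  proof -
    have "(\<integral>\<omega>. h (joint n Y \<omega>) \<partial>M) = (\<integral>y. h y \<partial>distr M (\<Pi>\<^sub>M i\<in>{1..n}. borel) (joint n Y))"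
      by (rule integral_distr[OF Y h, symmetric])
    also have "\<dots> = (\<integral>g. h (?T g) \<partial>?\<Gamma>)"
      unfolding law by (rule integral_distr[OF T' h])
    finally show ?thesis .
  qed
  have transfer: "measure M {\<omega> \<in> space M. c \<le> f (h (joint n Y \<omega>))} = measure ?\<Gamma> {g \<in> space ?\<Gamma>. c \<le> f (h (?T g))}"
    if [measurable]: "f \<in> borel_measurable borel" for c :: real and f :: "real \<Rightarrow> real"
  proof -
    let ?P = "\<Pi>\<^sub>M i\<in>{1..n}. borel :: (real ^ 'k) measure"
    let ?S = "{y \<in> space ?P. c \<le> f (h y)}"
    have S: "?S \<in> sets ?P" by measurable
    have "{\<omega> \<in> space M. c \<le> f (h (joint n Y \<omega>))} = joint n Y -` ?S \<inter> space M"
      using measurable_space[OF Y] by blast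
    then have "measure M {\<omega> \<in> space M. c \<le> f (h (joint n Y \<omega>))} = measure (distr M ?P (joint n Y)) ?S"
      by (simp only: measure_distr[OF Y S])
    also have "\<dots> = measure ?\<Gamma> (?T -` ?S \<inter> space ?\<Gamma>)"
      unfolding law by (rule measure_distr[OF T' S])
    also have "?T -` ?S \<inter> space ?\<Gamma> = {g \<in> space ?\<Gamma>. c \<le> f (h (?T g))}"
      using measurable_space[OF T'] by blast
    finally show ?thesis .
  qed
  have "measure ?\<Gamma> {g \<in> space ?\<Gamma>. (\<integral>g. h (?T g) \<partial>?\<Gamma>) + L * ?q \<le> h (?T g)} \<le> \<alpha>"
    using H.gaussian_concentration[of "L * ?q"] q L by simp
  then have "measure M {\<omega> \<in> space M. (\<integral>\<omega>. h (joint n Y \<omega>) \<partial>M) + L * ?q \<le> h (joint n Y \<omega>)} \<le> \<alpha>"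
    using transfer[of "\<lambda>x. x"] unfolding mean by simp
  then show "measure M {\<omega> \<in> space M. h (joint n Y \<omega>) < (\<integral>\<omega>. h (joint n Y \<omega>) \<partial>M) + L * ?q} \<ge> 1 - \<alpha>"
    by (rule prob_less_of_ge[OF M measurable_compose[OF Y h]])
  interpret U: l2_lipschitz ?I "\<lambda>g. - h (?T g)" L by (rule H.uminus)
  have "measure ?\<Gamma> {g \<in> space ?\<Gamma>. - (\<integral>g. h (?T g) \<partial>?\<Gamma>) + L * ?q \<le> - h (?T g)} \<le> \<alpha>"
    using U.gaussian_concentration[of "L * ?q"] q L by simp
  then have "measure M {\<omega> \<in> space M. - (\<integral>\<omega>. h (joint n Y \<omega>) \<partial>M) + L * ?q \<le> - h (joint n Y \<omega>)} \<le> \<alpha>"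
    using transfer[of uminus] unfolding mean by simp
  then have "1 - \<alpha> \<le> measure M {\<omega> \<in> space M. - h (joint n Y \<omega>) < - (\<integral>\<omega>. h (joint n Y \<omega>) \<partial>M) + L * ?q}"
    by (rule prob_less_of_ge[OF M borel_measurable_uminus[OF measurable_compose[OF Y h]]])
  moreover have "- h (joint n Y \<omega>) < - (\<integral>\<omega>. h (joint n Y \<omega>) \<partial>M) + L * ?q
      \<longleftrightarrow> h (joint n Y \<omega>) > (\<integral>\<omega>. h (joint n Y \<omega>) \<partial>M) - L * ?q" for \<omega> by linarith
  ultimately show "measure M {\<omega> \<in> space M. h (joint n Y \<omega>) > (\<integral>\<omega>. h (joint n Y \<omega>) \<partial>M) - L * ?q} \<ge> 1 - \<alpha>"
    by (simp only:)
qed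

section \<open>Exchangeable weights and conditioning on the sample\<close>

(* Keeps the index set {1..n} in the shape in which hypotheses and definitions mention it. *)
declare One_nat_def [simp del]

locale square_integrable_weights = prob_space M for M :: "'a measure" +
  fixes n :: nat and W :: "nat \<Rightarrow> 'a \<Rightarrow> real"
  assumes n: "n \<ge> 2"
    and W_m: "i \<in> {1..n} \<Longrightarrow> W i \<in> borel_measurable M"
    and W_sq: "i \<in> {1..n} \<Longrightarrow> integrable M (\<lambda>\<omega>. (W i \<omega>)\<^sup>2)"
begin

lemma centered_measurable: "i \<in> {1..n} \<Longrightarrow> centered n W i \<in> borel_measurable M"
  unfolding centered_def[abs_def] average_def using W_m
  by (intro borel_measurable_diff borel_measurable_scaleR borel_measurable_const borel_measurable_sum) auto

lemma centered_square: "i \<in> {1..n} \<Longrightarrow> integrable M (\<lambda>\<omega>. (centered n W i \<omega>)\<^sup>2)"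
proof (rule Bochner_Integration.integrable_bound)
  assume i: "i \<in> {1..n}"
  show "integrable M (\<lambda>\<omega>. 2 * (W i \<omega>)\<^sup>2 + 2 * (\<Sum>j=1..n. (W j \<omega>)\<^sup>2))"
    using i W_sq by (intro Bochner_Integration.integrable_add integrable_mult_right Bochner_Integration.integrable_sum) auto
  show "(\<lambda>\<omega>. (centered n W i \<omega>)\<^sup>2) \<in> borel_measurable M"
    by (intro borel_measurable_power centered_measurable i)
  show "AE \<omega> in M. norm ((centered n W i \<omega>)\<^sup>2) \<le> norm (2 * (W i \<omega>)\<^sup>2 + 2 * (\<Sum>j=1..n. (W j \<omega>)\<^sup>2))"
  proof (rule AE_I2)
    fix \<omega>
    define m where "m = average n (\<lambda>j. W j \<omega>)"
    have "m\<^sup>2 \<le> (\<Sum>j=1..n. (W j \<omega>)\<^sup>2)"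
    proof -
      have "(\<Sum>j=1..n. 1 * W j \<omega>)\<^sup>2 \<le> (\<Sum>j=1..n. 1\<^sup>2) * (\<Sum>j=1..n. (W j \<omega>)\<^sup>2)"
        by (rule Cauchy_Schwarz_ineq_sum)
      then have "(\<Sum>j=1..n. W j \<omega>)\<^sup>2 \<le> real n * (\<Sum>j=1..n. (W j \<omega>)\<^sup>2)" by simp
      also have "\<dots> \<le> (real n)\<^sup>2 * (\<Sum>j=1..n. (W j \<omega>)\<^sup>2)"
        using n by (intro mult_right_mono sum_nonneg) (auto simp: power2_eq_square)
      finally show ?thesis
        using n by (simp add: m_def average_def power_divide field_simps)
    qed
    moreover have "(W i \<omega> - m)\<^sup>2 \<le> 2 * (W i \<omega>)\<^sup>2 + 2 * m\<^sup>2"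
      using zero_le_power2[of "W i \<omega> + m"] unfolding power2_sum power2_diff by linarith
    ultimately show "norm ((centered n W i \<omega>)\<^sup>2) \<le> norm (2 * (W i \<omega>)\<^sup>2 + 2 * (\<Sum>j=1..n. (W j \<omega>)\<^sup>2))"
      by (simp add: centered_def m_def[symmetric])
  qed
qed

lemma centered_integrable: "i \<in> {1..n} \<Longrightarrow> integrable M (centered n W i)"
  by (rule square_integrable_imp_integrable[OF centered_measurable centered_square])

lemma centered_product: 
  assumes "i \<in> {1..n}" "j \<in> {1..n}"
  shows "integrable M (\<lambda>\<omega>. centered n W i \<omega> * centered n W j \<omega>)"
proof (rule Bochner_Integration.integrable_bound)
  show "integrable M (\<lambda>\<omega>. (centered n W i \<omega>)\<^sup>2 + (centered n W j \<omega>)\<^sup>2)"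
    using assms by (intro Bochner_Integration.integrable_add centered_square)
  show "(\<lambda>\<omega>. centered n W i \<omega> * centered n W j \<omega>) \<in> borel_measurable M"
    using assms by (intro borel_measurable_times centered_measurable)
  show "AE \<omega> in M. norm (centered n W i \<omega> * centered n W j \<omega>) \<le> norm ((centered n W i \<omega>)\<^sup>2 + (centered n W j \<omega>)\<^sup>2)"
  proof (rule AE_I2)
    fix \<omega>
    let ?a = "\<bar>centered n W i \<omega>\<bar>" and ?b = "\<bar>centered n W j \<omega>\<bar>"
    have "2 * (?a * ?b) \<le> ?a\<^sup>2 + ?b\<^sup>2" using sum_squares_bound[of ?a ?b] by simp
    moreover have "0 \<le> ?a * ?b" by simp
    ultimately have "?a * ?b \<le> ?a\<^sup>2 + ?b\<^sup>2" by linarith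
    then show "norm (centered n W i \<omega> * centered n W j \<omega>) \<le> norm ((centered n W i \<omega>)\<^sup>2 + (centered n W j \<omega>)\<^sup>2)"
      by (simp add: abs_mult)
  qed
qed

lemma sum_centered: "(\<Sum>j=1..n. centered n W j \<omega>) = 0"
  using n by (simp add: centered_def average_def sum_subtractf)

lemma joint_measurable: "joint n W \<in> measurable M (\<Pi>\<^sub>M i\<in>{1..n}. borel)"
  unfolding joint_def[abs_def] by (intro measurable_restrict W_m)

text \<open>
  Centring commutes with permutations, since the average is invariant under them.
\<close>

lemma exchangeable_products:
  assumes ex: "exchangeable M n W" and \<pi>: "\<pi> permutes {1..n}" and ij: "i \<in> {1..n}" "j \<in> {1..n}"
  shows "(\<integral>\<omega>. centered n W (\<pi> i) \<omega> * centered n W (\<pi> j) \<omega> \<partial>M) = (\<integral>\<omega>. centered n W i \<omega> * centered n W j \<omega> \<partial>M)"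
proof -
  let ?P = "\<Pi>\<^sub>M i\<in>{1..n}. borel :: real measure"
  let ?f = "\<lambda>w. (w i - average n w) * (w j - average n w) :: real"
  have f: "?f \<in> borel_measurable ?P"
    unfolding average_def using ij
    by (intro borel_measurable_times borel_measurable_diff borel_measurable_scaleR borel_measurable_const
        borel_measurable_sum measurable_component_singleton) auto
  have \<pi>_in: "\<pi> k \<in> {1..n}" if "k \<in> {1..n}" for k using permutes_in_image[OF \<pi>] that by simp
  have m: "joint n (\<lambda>i. W (\<pi> i)) \<in> measurable M ?P"
    unfolding joint_def[abs_def] by (intro measurable_restrict W_m \<pi>_in)
  have avg: "average n (joint n (\<lambda>i. W (\<pi> i)) \<omega>) = average n (\<lambda>i. W i \<omega>)" for \<omega>
    using sum.permute[OF \<pi>, of "\<lambda>i. W i \<omega>"] by (simp add: average_def joint_def comp_def)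
  have avg': "average n (joint n W \<omega>) = average n (\<lambda>i. W i \<omega>)" for \<omega>
    by (simp add: average_def joint_def)
  have "(\<integral>\<omega>. centered n W (\<pi> i) \<omega> * centered n W (\<pi> j) \<omega> \<partial>M) = (\<integral>\<omega>. ?f (joint n (\<lambda>i. W (\<pi> i)) \<omega>) \<partial>M)"
    unfolding avg using ij by (simp add: centered_def joint_def)
  also have "\<dots> = (\<integral>w. ?f w \<partial>distr M ?P (joint n (\<lambda>i. W (\<pi> i))))"
    by (rule integral_distr[OF m f, symmetric])
  also have "distr M ?P (joint n (\<lambda>i. W (\<pi> i))) = distr M ?P (joint n W)"
    using ex \<pi> by (simp add: exchangeable_def)
  also have "(\<integral>w. ?f w \<partial>distr M ?P (joint n W)) = (\<integral>\<omega>. ?f (joint n W \<omega>) \<partial>M)"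
    by (rule integral_distr[OF joint_measurable f])
  also have "\<dots> = (\<integral>\<omega>. centered n W i \<omega> * centered n W j \<omega> \<partial>M)"
    unfolding avg' using ij by (simp add: centered_def joint_def)
  finally show ?thesis .
qed

text \<open>
  By exchangeability all variances agree and all covariances of distinct weights agree. The centred
  weights sum to zero, so every row of the covariance matrix does, which determines the common
  covariance.
\<close>

lemma exchangeable_covariance:
  assumes ex: "exchangeable M n W" and ij: "i \<in> {1..n}" "j \<in> {1..n}"
  defines "v \<equiv> (\<integral>\<omega>. (centered n W 1 \<omega>)\<^sup>2 \<partial>M)"
  shows "(\<integral>\<omega>. centered n W i \<omega> * centered n W j \<omega> \<partial>M) = (if i = j then v else - v / (real n - 1))"
proof -
  define e where "e i j = (\<integral>\<omega>. centered n W i \<omega> * centered n W j \<omega> \<partial>M)" for i j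
  have one: "1 \<in> {1..n}" using n by simp
  have diag: "e i i = v" if "i \<in> {1..n}" for i
    using exchangeable_products[OF ex permutes_swap_id[OF one that] one one]
    by (simp add: e_def v_def power2_eq_square)
  have off: "e i k = e i j" if "j \<in> {1..n}" "k \<in> {1..n}" "i \<in> {1..n}" "j \<noteq> i" "k \<noteq> i" for i j k
    using exchangeable_products[OF ex permutes_swap_id[OF that(1,2)] that(3) that(1)] that
    by (simp add: e_def transpose_apply_other)
  have row: "(\<Sum>k=1..n. e i k) = 0" if "i \<in> {1..n}" for i
  proof -
    have "(\<Sum>k=1..n. e i k) = (\<integral>\<omega>. (\<Sum>k=1..n. centered n W i \<omega> * centered n W k \<omega>) \<partial>M)"
      unfolding e_def using centered_product that by (intro Bochner_Integration.integral_sum[symmetric]) auto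
    then show ?thesis by (simp add: sum_distrib_left[symmetric] sum_centered)
  qed
  show ?thesis
  proof (cases "i = j")
    case False
    have "0 = e i i + (\<Sum>k\<in>{1..n} - {i}. e i k)"
      using row[OF ij(1)] ij by (simp add: sum.remove[of _ i])
    also have "(\<Sum>k\<in>{1..n} - {i}. e i k) = (\<Sum>k\<in>{1..n} - {i}. e i j)"
      by (rule sum.cong[OF refl]) (rule off, use ij False in auto)
    also have "\<dots> = (real n - 1) * e i j"
      using ij n by (simp add: of_nat_diff)
    finally have "v + (real n - 1) * e i j = 0" using diag[OF ij(1)] by simp
    then have "e i j = - v / (real n - 1)" using n by (simp add: field_simps)
    then show ?thesis using False by (simp add: e_def)
  qed (use diag ij in \<open>simp add: e_def\<close>)
qed

lemma weight_constant_square: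
  "(weight_constant M n W)\<^sup>2 = real n / (real n - 1) * (\<integral>\<omega>. (centered n W 1 \<omega>)\<^sup>2 \<partial>M)"
  unfolding weight_constant_def using n by (intro real_sqrt_pow2) auto

text \<open>
  The covariance matrix is \<open>C\<^sub>W\<^sup>2\<close> times the orthogonal projection onto the vectors of sum zero, so it
  is dominated by \<open>C\<^sub>W\<^sup>2\<close> times the identity.
\<close>

lemma exchangeable_quadratic_form:
  assumes ex: "exchangeable M n W"
  shows "integrable M (\<lambda>\<omega>. (\<Sum>i=1..n. centered n W i \<omega> * a i)\<^sup>2)"
    "(\<integral>\<omega>. (\<Sum>i=1..n. centered n W i \<omega> * a i)\<^sup>2 \<partial>M) \<le> (weight_constant M n W)\<^sup>2 * (\<Sum>i=1..n. (a i)\<^sup>2)"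
proof -
  define v where "v = (\<integral>\<omega>. (centered n W 1 \<omega>)\<^sup>2 \<partial>M)"
  have v0: "0 \<le> v" unfolding v_def by (intro Bochner_Integration.integral_nonneg) auto
  have sq: "(\<Sum>i=1..n. centered n W i \<omega> * a i)\<^sup>2
    = (\<Sum>i=1..n. \<Sum>j=1..n. a i * a j * (centered n W i \<omega> * centered n W j \<omega>))" for \<omega>
    by (simp add: power2_eq_square sum_product mult_ac)
  show "integrable M (\<lambda>\<omega>. (\<Sum>i=1..n. centered n W i \<omega> * a i)\<^sup>2)"
    unfolding sq by (intro Bochner_Integration.integrable_sum integrable_mult_right centered_product) auto
  have "(\<integral>\<omega>. (\<Sum>i=1..n. centered n W i \<omega> * a i)\<^sup>2 \<partial>M)
     = (\<Sum>i=1..n. \<Sum>j=1..n. a i * a j * (\<integral>\<omega>. centered n W i \<omega> * centered n W j \<omega> \<partial>M))"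
    unfolding sq
    by (intro has_bochner_integral_integral_eq has_bochner_integral_sum has_bochner_integral_mult_right
        has_bochner_integral_integrable centered_product) auto
  also have "\<dots> = (\<Sum>i=1..n. \<Sum>j=1..n. - v / (real n - 1) * (a i * a j) + (if i = j then real n / (real n - 1) * v * (a i)\<^sup>2 else 0))"
  proof (intro sum.cong refl)
    fix i j assume ij: "i \<in> {1..n}" "j \<in> {1..n}"
    define q where "q = v / (real n - 1)"
    have vq: "real n / (real n - 1) * v = v + q" "- v / (real n - 1) = - q"
      using n by (simp_all add: q_def field_simps)
    have cov: "(\<integral>\<omega>. centered n W i \<omega> * centered n W j \<omega> \<partial>M) = (if i = j then v else - q)"
      using exchangeable_covariance[OF ex ij] unfolding v_def[symmetric] vq .
    show "a i * a j * (\<integral>\<omega>. centered n W i \<omega> * centered n W j \<omega> \<partial>M)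
      = - v / (real n - 1) * (a i * a j) + (if i = j then real n / (real n - 1) * v * (a i)\<^sup>2 else 0)"
      unfolding cov vq by (simp add: power2_eq_square algebra_simps)
  qed
  also have "\<dots> = - v / (real n - 1) * (\<Sum>i=1..n. a i)\<^sup>2 + real n / (real n - 1) * v * (\<Sum>i=1..n. (a i)\<^sup>2)"
  proof -
    have "(\<Sum>i=1..n. \<Sum>j=1..n. b * (a i * a j) + (if i = j then c * (a i)\<^sup>2 else 0))
        = b * (\<Sum>i=1..n. a i)\<^sup>2 + c * (\<Sum>i=1..n. (a i)\<^sup>2)" for b c
    proof -
      have "(\<Sum>i=1..n. \<Sum>j=1..n. b * (a i * a j)) = b * (\<Sum>i=1..n. a i)\<^sup>2"
        unfolding power2_eq_square sum_product by (simp add: sum_distrib_left)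
      then show ?thesis by (simp add: sum.distrib sum_distrib_left)
    qed
    then show ?thesis .
  qed
  also have "\<dots> \<le> real n / (real n - 1) * v * (\<Sum>i=1..n. (a i)\<^sup>2)"
    using n v0 by simp
  finally show "(\<integral>\<omega>. (\<Sum>i=1..n. centered n W i \<omega> * a i)\<^sup>2 \<partial>M) \<le> (weight_constant M n W)\<^sup>2 * (\<Sum>i=1..n. (a i)\<^sup>2)"
    by (simp add: weight_constant_square v_def)
qed

lemma weight_constant_pos:
  assumes ex: "exchangeable M n W" and nondeg: "(1 / real n) * (\<Sum>i=1..n. \<integral>\<omega>. \<bar>centered n W i \<omega>\<bar> \<partial>M) > 0"
  shows "0 < weight_constant M n W"
proof -
  define v where "v = (\<integral>\<omega>. (centered n W 1 \<omega>)\<^sup>2 \<partial>M)"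
  have v0: "0 \<le> v" unfolding v_def by (intro Bochner_Integration.integral_nonneg) auto
  have "v \<noteq> 0"
  proof
    assume v: "v = 0"
    have "(\<integral>\<omega>. \<bar>centered n W i \<omega>\<bar> \<partial>M) = 0" if i: "i \<in> {1..n}" for i
    proof -
      have "(\<integral>\<omega>. (centered n W i \<omega>)\<^sup>2 \<partial>M) = 0"
        using exchangeable_covariance[OF ex i i] v by (simp add: v_def power2_eq_square)
      then have "AE \<omega> in M. (centered n W i \<omega>)\<^sup>2 = 0"
        using integral_nonneg_eq_0_iff_AE[OF centered_square[OF i]] by simp
      then have "(\<integral>\<omega>. \<bar>centered n W i \<omega>\<bar> \<partial>M) = (\<integral>\<omega>. 0 \<partial>M)"
        using centered_measurable[OF i] by (intro integral_cong_AE) auto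
      then show ?thesis by simp
    qed
    then show False using nondeg by simp
  qed
  then show ?thesis using v0 n by (simp add: weight_constant_def v_def[symmetric])
qed

text \<open>
  Jensen's inequality turns the first moment of the norm into a second moment, to which
  \<open>exchangeable_quadratic_form\<close> applies for each coordinate.
\<close>

lemma expectation_root_mean_square:
  fixes d :: "nat \<Rightarrow> 'k::finite \<Rightarrow> real"
  assumes ex: "exchangeable M n W"
  shows "integrable M (\<lambda>\<omega>. L2_set (\<lambda>l. \<Sum>i=1..n. centered n W i \<omega> * d i l) UNIV)"
    "(\<integral>\<omega>. L2_set (\<lambda>l. \<Sum>i=1..n. centered n W i \<omega> * d i l) UNIV \<partial>M)
      \<le> weight_constant M n W * sqrt (\<Sum>i=1..n. \<Sum>l\<in>UNIV. (d i l)\<^sup>2)"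
proof -
  define X where "X \<omega> = L2_set (\<lambda>l. \<Sum>i=1..n. centered n W i \<omega> * d i l) UNIV" for \<omega>
  define C where "C = weight_constant M n W"
  have C0: "0 \<le> C" unfolding C_def weight_constant_def using n
    by (intro real_sqrt_ge_zero mult_nonneg_nonneg Bochner_Integration.integral_nonneg) auto
  have X2: "(X \<omega>)\<^sup>2 = (\<Sum>l\<in>UNIV. (\<Sum>i=1..n. centered n W i \<omega> * d i l)\<^sup>2)" for \<omega>
    by (simp add: X_def L2_set_def sum_nonneg)
  have X2_int: "integrable M (\<lambda>\<omega>. (X \<omega>)\<^sup>2)"
    unfolding X2 by (intro Bochner_Integration.integrable_sum exchangeable_quadratic_form ex)
  have X_m: "X \<in> borel_measurable M"
  proof -
    note [measurable] = centered_measurable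
    show ?thesis unfolding X_def[abs_def] L2_set_def by measurable
  qed
  have X_int: "integrable M X" by (rule square_integrable_imp_integrable[OF X_m X2_int])
  then show "integrable M (\<lambda>\<omega>. L2_set (\<lambda>l. \<Sum>i=1..n. centered n W i \<omega> * d i l) UNIV)"
    by (simp add: X_def[abs_def])
  have "0 \<le> variance X" by (rule variance_positive)
  then have "(expectation X)\<^sup>2 \<le> (\<integral>\<omega>. (X \<omega>)\<^sup>2 \<partial>M)"
    using variance_eq[OF X_int X2_int] by simp
  also have "\<dots> = (\<Sum>l\<in>UNIV. \<integral>\<omega>. (\<Sum>i=1..n. centered n W i \<omega> * d i l)\<^sup>2 \<partial>M)"
    unfolding X2 by (intro Bochner_Integration.integral_sum exchangeable_quadratic_form ex)
  also have "\<dots> \<le> (\<Sum>l\<in>UNIV. C\<^sup>2 * (\<Sum>i=1..n. (d i l)\<^sup>2))"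
    unfolding C_def by (intro sum_mono exchangeable_quadratic_form ex)
  also have "\<dots> = C\<^sup>2 * (\<Sum>i=1..n. \<Sum>l\<in>UNIV. (d i l)\<^sup>2)"
    by (subst sum.swap) (simp add: sum_distrib_left)
  also have "\<dots> = (C * sqrt (\<Sum>i=1..n. \<Sum>l\<in>UNIV. (d i l)\<^sup>2))\<^sup>2"
    by (simp add: power_mult_distrib sum_nonneg)
  finally have "expectation X \<le> C * sqrt (\<Sum>i=1..n. \<Sum>l\<in>UNIV. (d i l)\<^sup>2)"
    using C0 by (rule_tac power2_le_imp_le) (auto intro!: mult_nonneg_nonneg sum_nonneg)
  then show "(\<integral>\<omega>. L2_set (\<lambda>l. \<Sum>i=1..n. centered n W i \<omega> * d i l) UNIV \<partial>M)
      \<le> weight_constant M n W * sqrt (\<Sum>i=1..n. \<Sum>l\<in>UNIV. (d i l)\<^sup>2)"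
    by (simp add: X_def[abs_def] C_def)
qed

end

lemma independent_joint_law:
  fixes X :: "nat \<Rightarrow> 'a \<Rightarrow> 'b::topological_space" and Y :: "nat \<Rightarrow> 'a \<Rightarrow> 'c::topological_space"
  assumes M: "prob_space M"
    and X: "joint n X \<in> measurable M (\<Pi>\<^sub>M i\<in>{1..n}. borel)" and Y: "joint n Y \<in> measurable M (\<Pi>\<^sub>M i\<in>{1..n}. borel)"
    and ind: "prob_space.indep_set M (sets (generated_algebra M n X)) (sets (generated_algebra M n Y))"
  shows "distr M ((\<Pi>\<^sub>M i\<in>{1..n}. borel) \<Otimes>\<^sub>M (\<Pi>\<^sub>M i\<in>{1..n}. borel)) (\<lambda>\<omega>. (joint n X \<omega>, joint n Y \<omega>))
    = distr M (\<Pi>\<^sub>M i\<in>{1..n}. borel) (joint n X) \<Otimes>\<^sub>M distr M (\<Pi>\<^sub>M i\<in>{1..n}. borel) (joint n Y)"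
proof (rule pair_measure_eqI[symmetric])
  interpret prob_space M by (rule M)
  let ?P = "\<Pi>\<^sub>M i\<in>{1..n}. borel :: 'b measure" and ?Q = "\<Pi>\<^sub>M i\<in>{1..n}. borel :: 'c measure"
  show "sigma_finite_measure (distr M ?P (joint n X))" "sigma_finite_measure (distr M ?Q (joint n Y))"
    using X Y by (auto intro!: prob_space_imp_sigma_finite prob_space_distr)
  show "sets (distr M ?P (joint n X) \<Otimes>\<^sub>M distr M ?Q (joint n Y)) = sets (distr M (?P \<Otimes>\<^sub>M ?Q) (\<lambda>\<omega>. (joint n X \<omega>, joint n Y \<omega>)))"
    unfolding sets_distr by (rule sets_pair_measure_cong) (simp_all only: sets_distr)
  fix A B assume "A \<in> sets (distr M ?P (joint n X))" "B \<in> sets (distr M ?Q (joint n Y))"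
  then have AB: "A \<in> sets ?P" "B \<in> sets ?Q" by simp_all
  have XY: "(\<lambda>\<omega>. (joint n X \<omega>, joint n Y \<omega>)) \<in> measurable M (?P \<Otimes>\<^sub>M ?Q)"
    using X Y by (rule measurable_Pair)
  let ?A = "joint n X -` A \<inter> space M" and ?B = "joint n Y -` B \<inter> space M"
  have "?A \<in> sets (generated_algebra M n X)" "?B \<in> sets (generated_algebra M n Y)"
    unfolding generated_algebra_def using AB by (auto intro: in_vimage_algebra)
  then have "prob (?A \<inter> ?B) = prob ?A * prob ?B" by (rule indep_setD[OF ind])
  moreover have "(\<lambda>\<omega>. (joint n X \<omega>, joint n Y \<omega>)) -` (A \<times> B) \<inter> space M = ?A \<inter> ?B" by auto
  ultimately show "emeasure (distr M ?P (joint n X)) A * emeasure (distr M ?Q (joint n Y)) B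
      = emeasure (distr M (?P \<Otimes>\<^sub>M ?Q) (\<lambda>\<omega>. (joint n X \<omega>, joint n Y \<omega>))) (A \<times> B)"
    using AB by (simp add: emeasure_distr[OF X] emeasure_distr[OF Y] emeasure_distr[OF XY] emeasure_eq_measure ennreal_mult'')
qed

text \<open>
  The conditional expectation of a function of two independent families given one of them is the
  integral over the other with the given one held fixed: by independence the joint law is a product,
  and Fubini's theorem yields the defining integrals of the conditional expectation.
\<close>

theorem weight_expectation_freeze:
  fixes W :: "nat \<Rightarrow> 'a \<Rightarrow> real" and Y :: "nat \<Rightarrow> 'a \<Rightarrow> real ^ 'k"
    and \<Phi> :: "(nat \<Rightarrow> real) \<Rightarrow> (nat \<Rightarrow> real ^ 'k) \<Rightarrow> real"
  assumes M: "prob_space M"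
    and W: "joint n W \<in> measurable M (\<Pi>\<^sub>M i\<in>{1..n}. borel)" and Y: "joint n Y \<in> measurable M (\<Pi>\<^sub>M i\<in>{1..n}. borel)"
    and ind: "prob_space.indep_set M (sets (generated_algebra M n W)) (sets (generated_algebra M n Y))"
    and \<Phi>: "(\<lambda>(w, y). \<Phi> w y) \<in> borel_measurable ((\<Pi>\<^sub>M i\<in>{1..n}. borel) \<Otimes>\<^sub>M (\<Pi>\<^sub>M i\<in>{1..n}. borel))"
    and int: "integrable M (\<lambda>\<omega>. \<Phi> (joint n W \<omega>) (joint n Y \<omega>))"
  defines "h \<equiv> \<lambda>y. \<integral>\<omega>. \<Phi> (joint n W \<omega>) y \<partial>M"
  shows "h \<in> borel_measurable (\<Pi>\<^sub>M i\<in>{1..n}. borel)"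
    and "AE \<omega> in M. weight_expectation M n Y (\<lambda>\<omega>. \<Phi> (joint n W \<omega>) (joint n Y \<omega>)) \<omega> = h (joint n Y \<omega>)"
    and "(\<integral>\<omega>. h (joint n Y \<omega>) \<partial>M) = (\<integral>\<omega>. \<Phi> (joint n W \<omega>) (joint n Y \<omega>) \<partial>M)"
proof -
  interpret prob_space M by (rule M)
  let ?P = "\<Pi>\<^sub>M i\<in>{1..n}. borel :: real measure" and ?Q = "\<Pi>\<^sub>M i\<in>{1..n}. borel :: (real ^ 'k) measure"
  let ?F = "generated_algebra M n Y"
  have WY: "(\<lambda>\<omega>. (joint n W \<omega>, joint n Y \<omega>)) \<in> measurable M (?P \<Otimes>\<^sub>M ?Q)"
    using W Y by (rule measurable_Pair)
  interpret PW: prob_space "distr M ?P (joint n W)" by (rule prob_space_distr[OF W])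
  interpret PY: prob_space "distr M ?Q (joint n Y)" by (rule prob_space_distr[OF Y])
  interpret PP: pair_prob_space "distr M ?P (joint n W)" "distr M ?Q (joint n Y)" ..
  note law = independent_joint_law[OF M W Y ind]
  have h: "h \<in> borel_measurable ?Q"
  proof -
    have "(\<lambda>(y, \<omega>). \<Phi> (joint n W \<omega>) y) \<in> borel_measurable (?Q \<Otimes>\<^sub>M M)"
      unfolding split_beta' using measurable_compose[OF measurable_Pair[OF measurable_compose[OF measurable_snd W] measurable_fst] \<Phi>]
      by simp
    then show ?thesis unfolding h_def by (rule borel_measurable_lebesgue_integral)
  qed
  then show "h \<in> borel_measurable ?Q" .
  have \<Phi>1: "(\<lambda>w. \<Phi> w y) \<in> borel_measurable ?P" if "y \<in> space ?Q" for y
    using measurable_Pair1[OF \<Phi> that] by simp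
  have h': "h y = (\<integral>w. \<Phi> w y \<partial>distr M ?P (joint n W))" if "y \<in> space ?Q" for y
    unfolding h_def by (rule integral_distr[OF W \<Phi>1[OF that], symmetric])
  have key: "integrable M (\<lambda>\<omega>. indicator S (joint n Y \<omega>) * h (joint n Y \<omega>))
      \<and> (\<integral>\<omega>. indicator S (joint n Y \<omega>) * h (joint n Y \<omega>) \<partial>M) = (\<integral>\<omega>. indicator S (joint n Y \<omega>) * \<Phi> (joint n W \<omega>) (joint n Y \<omega>) \<partial>M)"
    if S [measurable]: "S \<in> sets ?Q" for S
  proof -
    let ?f = "\<lambda>(w, y). indicator S y * \<Phi> w y"
    have f: "?f \<in> borel_measurable (?P \<Otimes>\<^sub>M ?Q)"
      using \<Phi> by (simp add: split_beta')
    have "integrable M (\<lambda>\<omega>. ?f (joint n W \<omega>, joint n Y \<omega>))"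
    proof (rule Bochner_Integration.integrable_bound[OF int])
      show "(\<lambda>\<omega>. ?f (joint n W \<omega>, joint n Y \<omega>)) \<in> borel_measurable M" by (rule measurable_compose[OF WY f])
    qed (auto simp: indicator_def)
    then have f_int: "integrable (distr M ?P (joint n W) \<Otimes>\<^sub>M distr M ?Q (joint n Y)) ?f"
      unfolding law[symmetric] by (subst integrable_distr_eq[OF WY f])
    have inner: "(\<integral>w. indicator S y * \<Phi> w y \<partial>distr M ?P (joint n W)) = indicator S y * h y" if "y \<in> space ?Q" for y
      by (simp add: h'[OF that])
    have h_int: "integrable (distr M ?Q (joint n Y)) (\<lambda>y. indicator S y * h y)"
      using PP.integrable_snd[OF f_int]
      by (rule Bochner_Integration.integrable_cong[THEN iffD1, rotated -1]) (auto simp: h')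
    have hS: "(\<lambda>y. indicator S y * h y) \<in> borel_measurable ?Q" using h by measurable
    have "(\<integral>\<omega>. indicator S (joint n Y \<omega>) * h (joint n Y \<omega>) \<partial>M) = (\<integral>y. indicator S y * h y \<partial>distr M ?Q (joint n Y))"
      by (rule integral_distr[OF Y hS, symmetric])
    also have "\<dots> = (\<integral>y. (\<integral>w. indicator S y * \<Phi> w y \<partial>distr M ?P (joint n W)) \<partial>distr M ?Q (joint n Y))"
      by (intro Bochner_Integration.integral_cong refl) (simp add: h')
    also have "\<dots> = (\<integral>p. ?f p \<partial>(distr M ?P (joint n W) \<Otimes>\<^sub>M distr M ?Q (joint n Y)))"
      by (rule PP.integral_snd[OF f_int])
    also have "\<dots> = (\<integral>\<omega>. ?f (joint n W \<omega>, joint n Y \<omega>) \<partial>M)"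
      unfolding law[symmetric] by (rule integral_distr[OF WY f])
    finally show ?thesis
      using h_int by (simp add: integrable_distr_eq[OF Y hS])
  qed
  have one: "indicator (space ?Q) (joint n Y \<omega>) = (1::real)" if "\<omega> \<in> space M" for \<omega>
    using measurable_space[OF Y that] by simp
  have h_int: "integrable M (\<lambda>\<omega>. h (joint n Y \<omega>))"
    using key[OF sets.top] by (simp add: one cong: Bochner_Integration.integrable_cong)
  show "(\<integral>\<omega>. h (joint n Y \<omega>) \<partial>M) = (\<integral>\<omega>. \<Phi> (joint n W \<omega>) (joint n Y \<omega>) \<partial>M)"
    using key[OF sets.top] by (simp add: one cong: Bochner_Integration.integral_cong)
  have YF: "joint n Y \<in> measurable ?F ?Q"
    unfolding generated_algebra_def using measurable_space[OF Y] by (intro measurable_vimage_algebra1) auto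
  have sub: "subalgebra M ?F"
    unfolding subalgebra_def generated_algebra_def
    using measurable_sets[OF Y] measurable_space[OF Y] by (auto simp: sets_vimage_algebra2)
  interpret F: finite_measure_subalgebra M ?F by unfold_locales (rule sub)
  show "AE \<omega> in M. weight_expectation M n Y (\<lambda>\<omega>. \<Phi> (joint n W \<omega>) (joint n Y \<omega>)) \<omega> = h (joint n Y \<omega>)"
    unfolding weight_expectation_def
  proof (rule F.real_cond_exp_charact[OF _ int h_int measurable_compose[OF YF h]])
    fix A assume "A \<in> sets ?F"
    then obtain S where S: "S \<in> sets ?Q" and A: "A = joint n Y -` S \<inter> space M"
      unfolding generated_algebra_def using measurable_space[OF Y] by (auto simp: sets_vimage_algebra2)
    have "indicator A \<omega> = (indicator S (joint n Y \<omega>) :: real)" if "\<omega> \<in> space M" for \<omega>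
      using that by (simp add: A indicator_def)
    then show "(\<integral>\<omega>\<in>A. \<Phi> (joint n W \<omega>) (joint n Y \<omega>) \<partial>M) = (\<integral>\<omega>\<in>A. h (joint n Y \<omega>) \<partial>M)"
      using key[OF S] by (simp add: set_lebesgue_integral_def cong: Bochner_Integration.integral_cong)
  qed
qed

section \<open>Deviations of the average and of the resampled average\<close>

lemma average_joint: "average n (joint n X \<omega>) = average n (\<lambda>i. X i \<omega>)"
  by (simp add: average_def joint_def)

lemma L2_set_block_index:
  "L2_set d (block_index n) = sqrt (\<Sum>i=1..n. \<Sum>l\<in>(UNIV :: 'k::finite set). (d (i, l))\<^sup>2)"
  unfolding L2_set_def sum.cartesian_product by (simp add: case_prod_beta')

lemma L2_set_average_le:
  fixes d :: "nat \<times> 'k::finite \<Rightarrow> real"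
  assumes n: "n \<ge> 1"
  shows "L2_set (\<lambda>l. \<Sum>i=1..n. (1 / real n) * d (i, l)) UNIV \<le> L2_set d (block_index n) / sqrt (real n)"
proof -
  have col: "(\<Sum>i=1..n. (1 / real n) * d (i, l))\<^sup>2 \<le> (1 / real n) * (\<Sum>i=1..n. (d (i, l))\<^sup>2)" for l
  proof -
    have "(\<Sum>i=1..n. (1 / real n) * d (i, l))\<^sup>2 \<le> (\<Sum>i=1..n. (1 / real n)\<^sup>2) * (\<Sum>i=1..n. (d (i, l))\<^sup>2)"
      by (rule Cauchy_Schwarz_ineq_sum)
    also have "(\<Sum>i=1..n. (1 / real n)\<^sup>2) = 1 / real n" using n by (simp add: power2_eq_square)
    finally show ?thesis .
  qed
  have "(\<Sum>l\<in>UNIV. (\<Sum>i=1..n. (1 / real n) * d (i, l))\<^sup>2) \<le> (\<Sum>l\<in>UNIV. (1 / real n) * (\<Sum>i=1..n. (d (i, l))\<^sup>2))"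
    by (intro sum_mono col)
  also have "\<dots> = (\<Sum>i=1..n. \<Sum>l\<in>UNIV. (d (i, l))\<^sup>2) / real n"
    by (subst sum.swap) (simp add: sum_divide_distrib sum_distrib_left)
  finally show ?thesis
    unfolding L2_set_block_index unfolding L2_set_def real_sqrt_divide[symmetric] by (rule real_sqrt_le_mono)
qed

lemma iid_gaussian_sample_vectors:
  assumes "iid_gaussian_sample M n \<mu> Y" "i \<in> {1..n}"
  shows "gaussian_vector M (Y i)"
  using assms unfolding iid_gaussian_sample_def by blast

lemma iid_gaussian_sample_joint_measurable:
  assumes "iid_gaussian_sample M n \<mu> Y"
  shows "joint n Y \<in> measurable M (\<Pi>\<^sub>M i\<in>{1..n}. borel)"
  unfolding joint_def[abs_def] using iid_gaussian_sample_vectors[OF assms]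
  by (intro measurable_restrict) (simp add: gaussian_vector_def)

lemma gaussian_vector_norm_square:
  fixes X :: "'a \<Rightarrow> real ^ 'k"
  assumes X: "gaussian_vector M X"
  shows "integrable M (\<lambda>\<omega>. (norm (X \<omega>))\<^sup>2)"
proof -
  have m: "X \<in> borel_measurable M" using X by (simp add: gaussian_vector_def)
  have "integrable M (\<lambda>\<omega>. (b \<bullet> X \<omega>)\<^sup>2)" for b
  proof -
    obtain m s where "s \<ge> 0" "distr M borel (\<lambda>\<omega>. b \<bullet> X \<omega>) = normal_law m s"
      using X unfolding gaussian_vector_def by blast
    from normal_law_moments(2)[OF this(1) _ this(2)] m show ?thesis by simp
  qed
  then have "integrable M (\<lambda>\<omega>. \<Sum>b\<in>Basis. (b \<bullet> X \<omega>)\<^sup>2)" by simp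
  moreover have "(norm (X \<omega>))\<^sup>2 = (\<Sum>b\<in>Basis. (b \<bullet> X \<omega>)\<^sup>2)" for \<omega>
    unfolding power2_norm_eq_inner euclidean_inner[of "X \<omega>" "X \<omega>"]
    by (intro sum.cong refl) (simp add: power2_eq_square inner_commute)
  ultimately show ?thesis by simp
qed

text \<open>
  A function with Lipschitz constant zero in the standard Gaussian coordinates is almost surely
  constant, hence equal to its mean.
\<close>

lemma degenerate_sample:
  fixes h :: "(nat \<Rightarrow> real ^ 'k) \<Rightarrow> real"
  assumes M: "prob_space M" and Y: "joint n Y \<in> measurable M (\<Pi>\<^sub>M i\<in>{1..n}. borel)"
    and law: "distr M (\<Pi>\<^sub>M i\<in>{1..n}. borel) (joint n Y)
      = distr (std_gauss (block_index n)) (\<Pi>\<^sub>M i\<in>{1..n}. borel) (joint n (gauss_block B \<mu>))"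
    and h: "h \<in> borel_measurable (\<Pi>\<^sub>M i\<in>{1..n}. borel)"
    and const: "\<And>g g'. \<bar>h (joint n (gauss_block B \<mu>) g) - h (joint n (gauss_block B \<mu>) g')\<bar> \<le> 0"
  shows "AE \<omega> in M. h (joint n Y \<omega>) = (\<integral>\<omega>. h (joint n Y \<omega>) \<partial>M)"
proof -
  interpret prob_space M by (rule M)
  let ?T = "joint n (gauss_block B \<mu>)" and ?P = "\<Pi>\<^sub>M i\<in>{1..n}. borel :: (real ^ 'k) measure"
  have T: "?T \<in> measurable (std_gauss (block_index n)) ?P"
    unfolding measurable_cong_sets[OF sets_std_gauss refl] joint_def[abs_def]
    by (intro measurable_restrict gauss_block_measurable) auto
  define c where "c = h (?T (\<lambda>_. 0))"
  have S: "{y \<in> space ?P. h y = c} \<in> sets ?P" using h by measurable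
  have "AE y in distr M ?P (joint n Y). h y = c"
    unfolding law AE_distr_iff[OF T S] using const[of _ "\<lambda>_. 0"] by (simp add: c_def)
  then have ae: "AE \<omega> in M. h (joint n Y \<omega>) = c" by (simp only: AE_distr_iff[OF Y S])
  have "(\<integral>\<omega>. h (joint n Y \<omega>) \<partial>M) = (\<integral>\<omega>. c \<partial>M)"
    using measurable_compose[OF Y h] ae by (intro integral_cong_AE) auto
  then show ?thesis using ae prob_space by simp
qed

context subadditive_functional
begin

lemma average_lipschitz:
  fixes B :: "'k \<Rightarrow> 'k \<Rightarrow> real" and \<sigma> \<mu> :: "real ^ 'k"
  assumes n: "n \<ge> 1" and \<sigma>: "\<And>k. \<sigma> $ k = L2_set (B k) UNIV"
  shows "\<bar>\<phi> (average n (joint n (gauss_block B \<mu>) g) - \<mu>) - \<phi> (average n (joint n (gauss_block B \<mu>) g') - \<mu>)\<bar>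
    \<le> lp_norm p \<sigma> / sqrt (real n) * L2_set (\<lambda>j. g j - g' j) (block_index n)"
proof -
  have "(average n (joint n (gauss_block B \<mu>) g) - \<mu>) - (average n (joint n (gauss_block B \<mu>) g') - \<mu>)
      = (\<Sum>i=1..n. (1 / real n) *\<^sub>R gauss_block B \<mu> i g - (1 / real n) *\<^sub>R gauss_block B \<mu> i g')"
    by (simp add: average_joint) (simp add: average_def scaleR_sum_right sum_subtractf)
  then have "\<bar>\<phi> (average n (joint n (gauss_block B \<mu>) g) - \<mu>) - \<phi> (average n (joint n (gauss_block B \<mu>) g') - \<mu>)\<bar>
      \<le> lp_norm p (\<Sum>i=1..n. (1 / real n) *\<^sub>R gauss_block B \<mu> i g - (1 / real n) *\<^sub>R gauss_block B \<mu> i g')"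
    using lipschitz[of "average n (joint n (gauss_block B \<mu>) g) - \<mu>" "average n (joint n (gauss_block B \<mu>) g') - \<mu>"] by (simp only:)
  also have "\<dots> \<le> L2_set (\<lambda>l. \<Sum>i=1..n. (1 / real n) * (g (i, l) - g' (i, l))) UNIV * lp_norm p \<sigma>"
    by (rule lp_norm_block_combination[OF p \<sigma>])
  also have "\<dots> \<le> L2_set (\<lambda>j. g j - g' j) (block_index n) / sqrt (real n) * lp_norm p \<sigma>"
    by (intro mult_right_mono L2_set_average_le[OF n, of "\<lambda>j. g j - g' j"] lp_norm_nonneg)
  finally show ?thesis by (simp add: mult.commute)
qed

text \<open>
  The resampled functional as a function of the uncentred weights and the sample, so that the two
  independent families appear as separate arguments.
\<close>

definition resampled_value :: "nat \<Rightarrow> (nat \<Rightarrow> real) \<Rightarrow> (nat \<Rightarrow> real ^ 'k) \<Rightarrow> real" where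
  "resampled_value n w y = \<phi> (weighted_average n (\<lambda>i. w i - average n w) y)"

lemma resampled_value_joint:
  "resampled_value n (joint n W \<omega>) (joint n Y \<omega>') = \<phi> (weighted_average n (\<lambda>i. centered n W i \<omega>) (\<lambda>i. Y i \<omega>'))"
  by (simp add: resampled_value_def weighted_average_def average_joint[of n W \<omega>])
     (simp add: average_def joint_def centered_def)

lemma resampled_value_joint':
  "resampled_value n (joint n W \<omega>) y = \<phi> (weighted_average n (\<lambda>i. centered n W i \<omega>) y)"
  by (simp add: resampled_value_def weighted_average_def average_joint[of n W \<omega>])
     (simp add: average_def joint_def centered_def)

lemma resampled_value_measurable:
  "(\<lambda>(w, y). resampled_value n w y) \<in> borel_measurable ((\<Pi>\<^sub>M i\<in>{1..n}. borel) \<Otimes>\<^sub>M (\<Pi>\<^sub>M i\<in>{1..n}. borel))"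
  unfolding split_beta' resampled_value_def weighted_average_def average_def
  by (intro measurable_compose[OF _ borel_measurable] borel_measurable_scaleR borel_measurable_const
      borel_measurable_sum borel_measurable_diff measurable_compose[OF measurable_fst measurable_component_singleton]
      measurable_compose[OF measurable_snd measurable_component_singleton])

text \<open>
  A crude bound that makes the resampled functional integrable.
\<close>

lemma resampled_value_bound:
  "\<bar>\<phi> (weighted_average n c y)\<bar> \<le> lp_norm p (1 :: real ^ 'k) / real n * (\<Sum>i=1..n. \<bar>c i\<bar> * norm (y i))"
proof -
  have "norm (weighted_average n c y) \<le> (1 / real n) * (\<Sum>i=1..n. \<bar>c i\<bar> * norm (y i))"
    unfolding weighted_average_def average_def norm_scaleR
    by (intro mult_mono order_trans[OF norm_sum] sum_mono) (auto intro: sum_nonneg)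
  then have "norm (weighted_average n c y) * lp_norm p (1 :: real ^ 'k)
      \<le> (1 / real n) * (\<Sum>i=1..n. \<bar>c i\<bar> * norm (y i)) * lp_norm p (1 :: real ^ 'k)"
    by (intro mult_right_mono lp_norm_nonneg)
  then show ?thesis using bound_norm[of "weighted_average n c y"] by (simp add: mult_ac)
qed

text \<open>
  For fixed weights the functional is Lipschitz with a constant depending on the weights, by
  \<open>lp_norm_block_combination\<close>; averaging over the weights is \<open>expectation_root_mean_square\<close>.
\<close>

lemma resampled_lipschitz:
  fixes B :: "'k \<Rightarrow> 'k \<Rightarrow> real" and \<sigma> \<mu> :: "real ^ 'k"
  assumes W: "square_integrable_weights M n W" and ex: "exchangeable M n W"
    and \<sigma>: "\<And>k. \<sigma> $ k = L2_set (B k) UNIV"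
  defines "h \<equiv> \<lambda>y. \<integral>\<omega>. resampled_value n (joint n W \<omega>) y \<partial>M"
  shows "\<bar>h (joint n (gauss_block B \<mu>) g) - h (joint n (gauss_block B \<mu>) g')\<bar>
    \<le> lp_norm p \<sigma> * weight_constant M n W / real n * L2_set (\<lambda>j. g j - g' j) (block_index n)"
proof -
  interpret W: square_integrable_weights M n W by (rule W)
  let ?y = "joint n (gauss_block B \<mu>) g" and ?y' = "joint n (gauss_block B \<mu>) g'"
  let ?V = "\<lambda>y \<omega>. resampled_value n (joint n W \<omega>) y"
  let ?X = "\<lambda>\<omega>. L2_set (\<lambda>l. \<Sum>i=1..n. centered n W i \<omega> * (g (i, l) - g' (i, l))) UNIV"
  have V_int: "integrable M (?V (joint n (gauss_block B \<mu>) u))" for u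
  proof (rule Bochner_Integration.integrable_bound)
    let ?z = "joint n (gauss_block B \<mu>) u"
    show "integrable M (\<lambda>\<omega>. lp_norm p (1 :: real ^ 'k) / real n * (\<Sum>i=1..n. \<bar>centered n W i \<omega>\<bar> * norm (?z i)))"
      by (intro integrable_mult_right Bochner_Integration.integrable_sum integrable_mult_left integrable_abs W.centered_integrable)
    have z: "?z \<in> space (\<Pi>\<^sub>M i\<in>{1..n}. borel)" by (simp add: space_PiM joint_def)
    show "?V ?z \<in> borel_measurable M"
      using measurable_compose[OF W.joint_measurable measurable_Pair1[OF resampled_value_measurable z]] by simp
    show "AE \<omega> in M. norm (?V ?z \<omega>) \<le> norm (lp_norm p (1 :: real ^ 'k) / real n * (\<Sum>i=1..n. \<bar>centered n W i \<omega>\<bar> * norm (?z i)))"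
      unfolding resampled_value_joint' real_norm_def
      by (intro AE_I2 order_trans[OF resampled_value_bound abs_ge_self])
  qed
  have diff: "\<bar>?V ?y \<omega> - ?V ?y' \<omega>\<bar> \<le> lp_norm p \<sigma> / real n * ?X \<omega>" for \<omega>
  proof -
    let ?c = "\<lambda>i. centered n W i \<omega> / real n"
    have "weighted_average n (\<lambda>i. centered n W i \<omega>) ?y - weighted_average n (\<lambda>i. centered n W i \<omega>) ?y'
        = (\<Sum>i=1..n. ?c i *\<^sub>R gauss_block B \<mu> i g - ?c i *\<^sub>R gauss_block B \<mu> i g')"
      by (simp add: weighted_average_def average_def joint_def scaleR_sum_right sum_subtractf)
    then have "\<bar>?V ?y \<omega> - ?V ?y' \<omega>\<bar> \<le> lp_norm p (\<Sum>i=1..n. ?c i *\<^sub>R gauss_block B \<mu> i g - ?c i *\<^sub>R gauss_block B \<mu> i g')"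
      unfolding resampled_value_joint'
      using lipschitz[of "weighted_average n (\<lambda>i. centered n W i \<omega>) ?y" "weighted_average n (\<lambda>i. centered n W i \<omega>) ?y'"]
      by (simp only:)
    also have "\<dots> \<le> L2_set (\<lambda>l. \<Sum>i=1..n. ?c i * (g (i, l) - g' (i, l))) UNIV * lp_norm p \<sigma>"
      by (rule lp_norm_block_combination[OF p \<sigma>])
    also have "L2_set (\<lambda>l. \<Sum>i=1..n. ?c i * (g (i, l) - g' (i, l))) UNIV = L2_set (\<lambda>l. (1 / real n) * (\<Sum>i=1..n. centered n W i \<omega> * (g (i, l) - g' (i, l)))) UNIV"
      by (simp add: sum_divide_distrib)
    also have "\<dots> = (1 / real n) * ?X \<omega>"
      by (rule L2_set_right_distrib[symmetric]) simp
    finally show ?thesis by (simp add: mult_ac)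
  qed
  have "\<bar>h ?y - h ?y'\<bar> = \<bar>\<integral>\<omega>. ?V ?y \<omega> - ?V ?y' \<omega> \<partial>M\<bar>"
    unfolding h_def by (simp add: V_int)
  also have "\<dots> \<le> (\<integral>\<omega>. \<bar>?V ?y \<omega> - ?V ?y' \<omega>\<bar> \<partial>M)" by (rule integral_abs_bound)
  also have "\<dots> \<le> (\<integral>\<omega>. lp_norm p \<sigma> / real n * ?X \<omega> \<partial>M)"
    by (intro integral_mono diff integrable_abs Bochner_Integration.integrable_diff V_int integrable_mult_right
        W.expectation_root_mean_square[OF ex, where d="\<lambda>i l. g (i, l) - g' (i, l)"])
  also have "\<dots> = lp_norm p \<sigma> / real n * (\<integral>\<omega>. ?X \<omega> \<partial>M)" by (rule integral_mult_right_zero)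
  also have "\<dots> \<le> lp_norm p \<sigma> / real n * (weight_constant M n W * L2_set (\<lambda>j. g j - g' j) (block_index n))"
    unfolding L2_set_block_index
    using W.expectation_root_mean_square(2)[OF ex, where d="\<lambda>i l. g (i, l) - g' (i, l)"]
    by (intro mult_left_mono) (auto simp: lp_norm_nonneg)
  finally show ?thesis by (simp add: mult_ac)
qed

lemma resampled_conditional_expectation:
  fixes Y :: "nat \<Rightarrow> 'a \<Rightarrow> real ^ 'k" and \<mu> \<sigma> :: "real ^ 'k" and B :: "'k \<Rightarrow> 'k \<Rightarrow> real"
  assumes M: "prob_space M" and n: "n \<ge> 2"
    and Y: "joint n Y \<in> measurable M (\<Pi>\<^sub>M i\<in>{1..n}. borel)" and gv: "\<And>i. i \<in> {1..n} \<Longrightarrow> gaussian_vector M (Y i)"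
    and \<sigma>: "\<And>k. \<sigma> $ k = L2_set (B k) UNIV"
    and rw: "resampling_weights M n Y W" and ex: "exchangeable M n W"
  obtains h where "h \<in> borel_measurable (\<Pi>\<^sub>M i\<in>{1..n}. borel)"
    "AE \<omega> in M. weight_expectation M n Y (\<lambda>\<omega>. \<phi> (weighted_average n (\<lambda>i. centered n W i \<omega>) (\<lambda>i. Y i \<omega>))) \<omega>
      = h (joint n Y \<omega>)"
    "(\<integral>\<omega>. h (joint n Y \<omega>) \<partial>M) = (\<integral>\<omega>. \<phi> (weighted_average n (\<lambda>i. centered n W i \<omega>) (\<lambda>i. Y i \<omega>)) \<partial>M)"
    "\<And>g g'. \<bar>h (joint n (gauss_block B \<mu>) g) - h (joint n (gauss_block B \<mu>) g')\<bar>
      \<le> lp_norm p \<sigma> * weight_constant M n W / real n * L2_set (\<lambda>j. g j - g' j) (block_index n)"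
    and "0 < weight_constant M n W"
proof -
  have W: "square_integrable_weights M n W"
    using rw n by (intro square_integrable_weights.intro M square_integrable_weights_axioms.intro)
      (auto simp: resampling_weights_def)
  interpret W: square_integrable_weights M n W by (rule W)
  have ind: "W.indep_set (sets (generated_algebra M n W)) (sets (generated_algebra M n Y))"
    using rw by (simp add: resampling_weights_def)
  have int: "integrable M (\<lambda>\<omega>. resampled_value n (joint n W \<omega>) (joint n Y \<omega>))"
  proof (rule Bochner_Integration.integrable_bound)
    show "integrable M (\<lambda>\<omega>. lp_norm p (1 :: real ^ 'k) / real n * (\<Sum>i=1..n. (centered n W i \<omega>)\<^sup>2 + (norm (Y i \<omega>))\<^sup>2))"
      by (intro integrable_mult_right Bochner_Integration.integrable_sum Bochner_Integration.integrable_add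
          W.centered_square gaussian_vector_norm_square gv)
    show "(\<lambda>\<omega>. resampled_value n (joint n W \<omega>) (joint n Y \<omega>)) \<in> borel_measurable M"
      using measurable_compose[OF measurable_Pair[OF W.joint_measurable Y] resampled_value_measurable] by simp
    show "AE \<omega> in M. norm (resampled_value n (joint n W \<omega>) (joint n Y \<omega>))
        \<le> norm (lp_norm p (1 :: real ^ 'k) / real n * (\<Sum>i=1..n. (centered n W i \<omega>)\<^sup>2 + (norm (Y i \<omega>))\<^sup>2))"
    proof (rule AE_I2)
      fix \<omega>
      have prod_le: "\<bar>a\<bar> * b \<le> a\<^sup>2 + b\<^sup>2" if "0 \<le> b" for a b :: real
      proof -
        have "2 * (\<bar>a\<bar> * b) \<le> a\<^sup>2 + b\<^sup>2" using sum_squares_bound[of "\<bar>a\<bar>" b] by simp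
        moreover have "0 \<le> \<bar>a\<bar> * b" using that by simp
        ultimately show ?thesis by linarith
      qed
      have "\<bar>resampled_value n (joint n W \<omega>) (joint n Y \<omega>)\<bar>
          \<le> lp_norm p (1 :: real ^ 'k) / real n * (\<Sum>i=1..n. \<bar>centered n W i \<omega>\<bar> * norm (Y i \<omega>))"
        unfolding resampled_value_joint by (rule resampled_value_bound)
      also have "\<dots> \<le> lp_norm p (1 :: real ^ 'k) / real n * (\<Sum>i=1..n. (centered n W i \<omega>)\<^sup>2 + (norm (Y i \<omega>))\<^sup>2)"
        by (intro mult_left_mono sum_mono prod_le) (auto simp: lp_norm_nonneg)
      finally show "norm (resampled_value n (joint n W \<omega>) (joint n Y \<omega>))
        \<le> norm (lp_norm p (1 :: real ^ 'k) / real n * (\<Sum>i=1..n. (centered n W i \<omega>)\<^sup>2 + (norm (Y i \<omega>))\<^sup>2))"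
        unfolding real_norm_def by (rule order_trans[OF _ abs_ge_self])
    qed
  qed
  note freeze = weight_expectation_freeze[OF M W.joint_measurable Y ind resampled_value_measurable int]
  show ?thesis
  proof (rule that[OF freeze(1) _ _ resampled_lipschitz[OF W ex \<sigma>]])
    show "0 < weight_constant M n W"
      using W.weight_constant_pos[OF ex] rw by (simp add: resampling_weights_def)
  qed (use freeze(2,3) in \<open>simp_all only: resampled_value_joint\<close>)
qed

theorem average_deviations:
  fixes Y :: "nat \<Rightarrow> 'a \<Rightarrow> real ^ 'k"
  assumes M: "prob_space M" and n: "n \<ge> 1" and Y: "iid_gaussian_sample M n \<mu> Y" and \<sigma>: "\<sigma> = std_dev M (Y 1)"
  defines "V \<equiv> \<lambda>\<omega>. \<phi> (average n (\<lambda>i. Y i \<omega>) - \<mu>)"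
  shows "\<sigma> \<noteq> 0 \<Longrightarrow> \<alpha> \<in> {0<..<1} \<Longrightarrow> measure M {\<omega> \<in> space M.
      V \<omega> < (\<integral>\<omega>. V \<omega> \<partial>M) + lp_norm p \<sigma> * normal_quantile (\<alpha> / 2) / sqrt (real n)} \<ge> 1 - \<alpha>"
    and "\<sigma> \<noteq> 0 \<Longrightarrow> \<alpha> \<in> {0<..<1} \<Longrightarrow> measure M {\<omega> \<in> space M.
      V \<omega> > (\<integral>\<omega>. V \<omega> \<partial>M) - lp_norm p \<sigma> * normal_quantile (\<alpha> / 2) / sqrt (real n)} \<ge> 1 - \<alpha>"
    and "\<sigma> = 0 \<Longrightarrow> AE \<omega> in M. V \<omega> = (\<integral>\<omega>. V \<omega> \<partial>M)"
proof -
  let ?P = "\<Pi>\<^sub>M i\<in>{1..n}. borel :: (real ^ 'k) measure"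
  obtain B :: "'k \<Rightarrow> 'k \<Rightarrow> real" where sd: "\<And>k. std_dev M (Y 1) $ k = L2_set (B k) UNIV"
    and law: "distr M ?P (joint n Y) = distr (std_gauss (block_index n)) ?P (joint n (gauss_block B \<mu>))"
    by (rule iid_gaussian_sample_law[OF M n Y]) (rule that)
  note Y_m = iid_gaussian_sample_joint_measurable[OF Y]
  define h where "h y = \<phi> (average n y - \<mu>)" for y
  have h_m: "h \<in> borel_measurable ?P"
    unfolding h_def average_def
    by (intro measurable_compose[OF _ borel_measurable] borel_measurable_scaleR borel_measurable_const
      borel_measurable_sum borel_measurable_diff measurable_component_singleton)
  have V: "V = (\<lambda>\<omega>. h (joint n Y \<omega>))"
    unfolding V_def h_def average_joint ..
  note lip = average_lipschitz[OF n sd[folded \<sigma>], where \<mu>=\<mu>, folded h_def]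
  have L: "0 < lp_norm p \<sigma> / sqrt (real n)" if "\<sigma> \<noteq> 0" using lp_norm_pos[OF p that] n by simp
  note conc = sample_concentration[OF M Y_m law h_m lip L]
  show "\<sigma> \<noteq> 0 \<Longrightarrow> \<alpha> \<in> {0<..<1} \<Longrightarrow> measure M {\<omega> \<in> space M.
      V \<omega> < (\<integral>\<omega>. V \<omega> \<partial>M) + lp_norm p \<sigma> * normal_quantile (\<alpha> / 2) / sqrt (real n)} \<ge> 1 - \<alpha>"
    using conc(1)[of \<alpha>] unfolding V by (simp only: times_divide_eq_left greaterThanLessThan_iff simp_thms True_implies_equals)
  show "\<sigma> \<noteq> 0 \<Longrightarrow> \<alpha> \<in> {0<..<1} \<Longrightarrow> measure M {\<omega> \<in> space M.
      V \<omega> > (\<integral>\<omega>. V \<omega> \<partial>M) - lp_norm p \<sigma> * normal_quantile (\<alpha> / 2) / sqrt (real n)} \<ge> 1 - \<alpha>"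
    using conc(2)[of \<alpha>] unfolding V by (simp only: times_divide_eq_left greaterThanLessThan_iff simp_thms True_implies_equals)
  show "AE \<omega> in M. V \<omega> = (\<integral>\<omega>. V \<omega> \<partial>M)" if "\<sigma> = 0"
  proof -
    have "lp_norm p \<sigma> = 0" using that by (simp add: lp_norm_zero[OF p])
    then show ?thesis unfolding V using lip by (intro degenerate_sample[OF M Y_m law h_m]) simp
  qed
qed

theorem resampled_deviations:
  fixes Y :: "nat \<Rightarrow> 'a \<Rightarrow> real ^ 'k"
  assumes M: "prob_space M" and n: "n \<ge> 2" and Y: "iid_gaussian_sample M n \<mu> Y" and \<sigma>: "\<sigma> = std_dev M (Y 1)"
    and rw: "resampling_weights M n Y W" and ex: "exchangeable M n W"
  defines "V \<equiv> \<lambda>\<omega>. \<phi> (weighted_average n (\<lambda>i. centered n W i \<omega>) (\<lambda>i. Y i \<omega>))"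
  shows "\<sigma> \<noteq> 0 \<Longrightarrow> \<alpha> \<in> {0<..<1} \<Longrightarrow> measure M {\<omega> \<in> space M. weight_expectation M n Y V \<omega>
      < (\<integral>\<omega>. V \<omega> \<partial>M) + lp_norm p \<sigma> * weight_constant M n W * normal_quantile (\<alpha> / 2) / real n} \<ge> 1 - \<alpha>"
    and "\<sigma> \<noteq> 0 \<Longrightarrow> \<alpha> \<in> {0<..<1} \<Longrightarrow> measure M {\<omega> \<in> space M. weight_expectation M n Y V \<omega>
      > (\<integral>\<omega>. V \<omega> \<partial>M) - lp_norm p \<sigma> * weight_constant M n W * normal_quantile (\<alpha> / 2) / real n} \<ge> 1 - \<alpha>"
    and "\<sigma> = 0 \<Longrightarrow> AE \<omega> in M. weight_expectation M n Y V \<omega> = (\<integral>\<omega>. V \<omega> \<partial>M)"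
proof -
  let ?P = "\<Pi>\<^sub>M i\<in>{1..n}. borel :: (real ^ 'k) measure"
  have n1: "n \<ge> 1" using n by simp
  obtain B :: "'k \<Rightarrow> 'k \<Rightarrow> real" where sd: "\<And>k. std_dev M (Y 1) $ k = L2_set (B k) UNIV"
    and law: "distr M ?P (joint n Y) = distr (std_gauss (block_index n)) ?P (joint n (gauss_block B \<mu>))"
    by (rule iid_gaussian_sample_law[OF M n1 Y]) (rule that)
  note Y_m = iid_gaussian_sample_joint_measurable[OF Y]
  obtain h where h: "h \<in> borel_measurable ?P"
    and ae: "AE \<omega> in M. weight_expectation M n Y V \<omega> = h (joint n Y \<omega>)"
    and mean: "(\<integral>\<omega>. h (joint n Y \<omega>) \<partial>M) = (\<integral>\<omega>. V \<omega> \<partial>M)"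
    and lip: "\<And>g g'. \<bar>h (joint n (gauss_block B \<mu>) g) - h (joint n (gauss_block B \<mu>) g')\<bar>
          \<le> lp_norm p \<sigma> * weight_constant M n W / real n * L2_set (\<lambda>j. g j - g' j) (block_index n)"
    and C: "0 < weight_constant M n W"
    by (rule resampled_conditional_expectation[OF M n Y_m iid_gaussian_sample_vectors[OF Y] sd[folded \<sigma>] rw ex,
          folded V_def]) (assumption, rule that)
  have L: "0 < lp_norm p \<sigma> * weight_constant M n W / real n" if "\<sigma> \<noteq> 0"
    using lp_norm_pos[OF p that] C n by simp
  note conc = sample_concentration[OF M Y_m law h lip L, unfolded mean]
  have [measurable]: "weight_expectation M n Y V \<in> borel_measurable M"
    unfolding weight_expectation_def by (rule borel_measurable_cond_exp2)
  have [measurable]: "(\<lambda>\<omega>. h (joint n Y \<omega>)) \<in> borel_measurable M" by (rule measurable_compose[OF Y_m h])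
  have "measure M {\<omega> \<in> space M. weight_expectation M n Y V \<omega> < c} = measure M {\<omega> \<in> space M. h (joint n Y \<omega>) < c}" for c
    using ae by (intro measure_eq_AE) auto
  then show "\<sigma> \<noteq> 0 \<Longrightarrow> \<alpha> \<in> {0<..<1} \<Longrightarrow> measure M {\<omega> \<in> space M. weight_expectation M n Y V \<omega>
      < (\<integral>\<omega>. V \<omega> \<partial>M) + lp_norm p \<sigma> * weight_constant M n W * normal_quantile (\<alpha> / 2) / real n} \<ge> 1 - \<alpha>"
    using conc(1)[of \<alpha>] by (simp only: times_divide_eq_left greaterThanLessThan_iff simp_thms True_implies_equals)
  have "measure M {\<omega> \<in> space M. c < weight_expectation M n Y V \<omega>} = measure M {\<omega> \<in> space M. c < h (joint n Y \<omega>)}" for c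
    using ae by (intro measure_eq_AE) auto
  then show "\<sigma> \<noteq> 0 \<Longrightarrow> \<alpha> \<in> {0<..<1} \<Longrightarrow> measure M {\<omega> \<in> space M. weight_expectation M n Y V \<omega>
      > (\<integral>\<omega>. V \<omega> \<partial>M) - lp_norm p \<sigma> * weight_constant M n W * normal_quantile (\<alpha> / 2) / real n} \<ge> 1 - \<alpha>"
    using conc(2)[of \<alpha>] by (simp only: times_divide_eq_left greaterThanLessThan_iff simp_thms True_implies_equals)
  show "AE \<omega> in M. weight_expectation M n Y V \<omega> = (\<integral>\<omega>. V \<omega> \<partial>M)" if "\<sigma> = 0"
  proof -
    have "AE \<omega> in M. h (joint n Y \<omega>) = (\<integral>\<omega>. h (joint n Y \<omega>) \<partial>M)"
    proof -
      have "lp_norm p \<sigma> = 0" using that by (simp add: lp_norm_zero[OF p])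
      then show ?thesis using lip by (intro degenerate_sample[OF M Y_m law h]) simp
    qed
    with ae show ?thesis unfolding mean by eventually_elim simp
  qed
qed

end

theorem proposition2p5:
  fixes M :: "'a measure" and n :: nat and p :: ennreal
    and \<mu> \<sigma> :: "real ^ 'k" and Y :: "nat \<Rightarrow> 'a \<Rightarrow> real ^ 'k"
    and \<phi> :: "real ^ 'k \<Rightarrow> real"
    and dev :: "'a \<Rightarrow> real"
    and resampled :: "(nat \<Rightarrow> 'a \<Rightarrow> real) \<Rightarrow> 'a \<Rightarrow> real"
  assumes "prob_space M" and "n \<ge> 2" and "p \<ge> 1"
    and "iid_gaussian_sample M n \<mu> Y"
    and "\<sigma> = std_dev M (Y 1)"
    and subadditive: "\<forall>x x'. \<phi> (x + x') \<le> \<phi> x + \<phi> x'"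
    and bounded: "\<forall>x. \<bar>\<phi> x\<bar> \<le> lp_norm p x"
    and "dev = (\<lambda>\<omega>. \<phi> (average n (\<lambda>i. Y i \<omega>) - \<mu>))"
    and "resampled = (\<lambda>W \<omega>. \<phi> (weighted_average n (\<lambda>i. centered n W i \<omega>) (\<lambda>i. Y i \<omega>)))"
  shows
    "(\<sigma> \<noteq> 0 \<longrightarrow>
       (\<forall>\<alpha>\<in>{0<..<1}.
          measure M {\<omega> \<in> space M.
            dev \<omega> < (\<integral>\<omega>'. dev \<omega>' \<partial>M)
              + lp_norm p \<sigma> * normal_quantile (\<alpha> / 2) / sqrt (real n)} \<ge> 1 - \<alpha> \<and>
          measure M {\<omega> \<in> space M.
            dev \<omega> > (\<integral>\<omega>'. dev \<omega>' \<partial>M)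
              - lp_norm p \<sigma> * normal_quantile (\<alpha> / 2) / sqrt (real n)} \<ge> 1 - \<alpha>) \<and>
       (\<forall>W. resampling_weights M n Y W \<longrightarrow> exchangeable M n W \<longrightarrow>
          (\<forall>\<alpha>\<in>{0<..<1}.
             measure M {\<omega> \<in> space M.
               weight_expectation M n Y (resampled W) \<omega> < (\<integral>\<omega>'. resampled W \<omega>' \<partial>M)
                 + lp_norm p \<sigma> * weight_constant M n W * normal_quantile (\<alpha> / 2) / real n}
               \<ge> 1 - \<alpha> \<and>
             measure M {\<omega> \<in> space M.
               weight_expectation M n Y (resampled W) \<omega> > (\<integral>\<omega>'. resampled W \<omega>' \<partial>M)
                 - lp_norm p \<sigma> * weight_constant M n W * normal_quantile (\<alpha> / 2) / real n}
               \<ge> 1 - \<alpha>))) \<and>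
     (\<sigma> = 0 \<longrightarrow>
       (AE \<omega> in M. dev \<omega> = (\<integral>\<omega>'. dev \<omega>' \<partial>M)) \<and>
       (\<forall>W. resampling_weights M n Y W \<longrightarrow> exchangeable M n W \<longrightarrow>
          (AE \<omega> in M. weight_expectation M n Y (resampled W) \<omega> = (\<integral>\<omega>'. resampled W \<omega>' \<partial>M))))"
proof -
  interpret subadditive_functional p \<phi>
    using assms(3) subadditive bounded by unfold_locales auto
  have n1: "n \<ge> 1" using assms(2) by simp
  show ?thesis
    unfolding assms(8,9)
    using average_deviations[OF assms(1) n1 assms(4,5)] resampled_deviations[OF assms(1,2,4,5)]
    by (intro conjI impI ballI allI)
qed

end
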